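(* Let $\mathcal K(T)$ be a concentrated $n$-associahedron, i.e. let $T$ be a concentrated rooted plane tree of depth $n\ge1$ which is not a path. The velocity fan $\mathcal F(T)$ of $\mathcal K(T)$ is a coarsening of the braid arrangement $\mathcal A_m$, and the triangulated velocity fan $\mathcal F(\Delta_T)$ of $\mathcal K(T)$ is the normal fan of a nestohedron.
   Context: **Trees.** A rooted plane tree $T$ is a finite rooted tree with a total order on the set $\mathrm{ch}(u)$ of children of every vertex $u$. $V^k(T)$ is the set of vertices at distance $k$ from the root; the depth of $T$ is the largest $k$ with $V^k(T)\ne\emptyset$. $V^k(T)$ is totally ordered lexicographically (compare the sequences of child-positions along the paths from the root); $u^k_i$ is its $i$-th element. $T$ has depth $n\ge1$ and is not a path. $T$ is concentrated if for every $k<n$ exactly one vertex of depth $k$ has children. **Brackets.** For $0\le k\le n$ a $k$-bracket of $T$ is $A=(A^0,\dots,A^k)$ with $A^i\subseteq V^i(T)$, $A^k\neq\emptyset$, such that the parent of every $u\in A^i$ ($i\ge 1$) lies in $A^{i-1}$, and for every $u\in A^{i-1}$ the set $A^i\cap\mathrm{ch}(u)$ is a (possibly empty) set of consecutive elements of $\mathrm{ch}(u)$. For $k$-brackets, $A\subseteq A'$ means $A^i\subseteq A'^i$ for all $i$. For $k\ge1$, $\pi(A)=(A^0,\dots,A^{k-1})$. The singleton $k$-bracket $A(u)$ of $u\in V^k(T)$ has $A(u)^i=\{\text{the depth-}i\text{ vertex on the path from the root to }u\}$; the maximum $k$-bracket is $(V^0(T),\dots,V^k(T))$. A bracket is nontrivial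 if it is neither singleton nor maximum. **$n$-bracketings.** An $n$-bracketing $\mathcal B$ of $T$ consists of sets $\mathcal B^k$ of $k$-brackets ($0\le k\le n$) and a strict partial order $<_{\mathcal B}$ on $\bigsqcup_k\mathcal B^k$ such that, writing $\mathcal B_A=\{A'\in\mathcal B^{k}:\pi(A')=A\}$ for $A\in\mathcal B^{k-1}$: (1) $\mathcal B^k$ contains the maximum and all singleton $k$-brackets; (2) $A\in\mathcal B^k$, $k\ge1$, implies $\pi(A)\in\mathcal B^{k-1}$; (3) if $A_1,A_2\in\mathcal B^k$ and $A_1^k\cap A_2^k\ne\emptyset$ then $A_1\subseteq A_2$ or $A_2\subseteq A_1$; (4a) for $A\in\mathcal B^{k-1}$, $1\le k\le n$: $\bigcup_{A'\in\mathcal B_A}A'^k=\bigcup_{u\in A^{k-1}}\mathrm{ch}(u)$; (4b) if $A_1,A_2\in\mathcal B_A$, $A_2\subsetneq A_1$, then every $u'\in A_1^k$ lies in $A_3^k$ for some $A_3\in\mathcal B_A$ with $A_3\subsetneq A_1$; (5a) distinct elements $A_1,A_2\in\mathcal B^k$ are comparable under $<_{\mathcal B}$ iff $\pi(A_1)=\pi(A_2)$ and $A_1^k\cap A_2^k=\emptyset$ (elements of different levels are incomparable); (5b) if $u_1$ precedes $u_2$ in $\mathrm{ch}(u)$ then $A(u_1)<_{\mathcal B}A(u_2)$; (5c) if $A,\tilde A\in\mathcal B^{k-1}$, $\tilde A\subseteq A$, $A_1\ne A_2\in\mathcal B_A$ are comparable, $\tilde A_1\ne\tilde A_2\in\mathcal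 B_{\tilde A}$ are comparable, and $\tilde A_i\subseteq A_i$ for $i=1,2$, then $A_1<_{\mathcal B}A_2\iff\tilde A_1<_{\mathcal B}\tilde A_2$. The categorical $n$-associahedron $\mathcal K(T)$ is the set of $n$-bracketings of $T$ ordered by: $\mathcal B_1\le\mathcal B_2$ iff $\mathcal B_1^k\subseteq\mathcal B_2^k$ for all $k$ and $<_{\mathcal B_1}$ is the restriction of $<_{\mathcal B_2}$. Its minimum $\mathcal B_{\min}$ has only singleton and maximum brackets. **Collisions.** A collision is an atom of $\mathcal K(T)$ (a minimal element of $\mathcal K(T)\setminus\{\mathcal B_{\min}\}$). The fusion bracket of a collision $\mathcal C$ is the (unique) nonsingleton bracket $E_0$ of $\mathcal C$ such that $\pi(E_0)$ is a singleton bracket and $E_0=\pi^{l}(A')$ for some nontrivial $A'$ in $\mathcal C$ and $l\ge0$. A bracket $E$ of $\mathcal C$ is essential if $E=\pi^l(A')$ for some nontrivial $A'$ in $\mathcal C$, $l\ge0$, and $\pi^j(E)=E_0$ for some $j\ge0$. **Contraction.** Let $E_0\in\mathcal C^{k_0}$, $\pi(E_0)=A(w)$, $W=E_0^{k_0}\subseteq\mathrm{ch}(w)$. The rooted plane tree $T/\mathcal C$ is obtained from $T$ by removing $W$ and all its descendants and inserting a depth-$k$ vertex $v_E$ for each essential $E\in\mathcal C^k$: $v_{E_0}$ is a child of $w$ taking the place of the consecutive set $W$; the children of $v_E$ are the $v_{E'}$ with $E'$ essential, $\pi(E')=E$, ordered by $<_{\mathcal C}$. The map $\psi:V(T)\to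 V(T/\mathcal C)$ fixes the remaining vertices and sends a depth-$k$ vertex $v$ in or below $W$ to $v_E$, where $E\in\mathcal C^k$ is the unique essential bracket with $v\in E^k$. **Fans.** Put $t_k=|V^k(T)|-1$, $m=\sum_{k=1}^nt_k$; vectors in $\mathbb R^m$ have coordinates $x^k_i$, $1\le k\le n$, $1\le i\le t_k$. For a collision $\mathcal C$, $\rho(\mathcal C)^k_i=d(\psi(u^k_i))-d(\psi(u^k_{i+1}))+1$, where $d(v)$ is the position of $v$ in the ordered set $V^k(T/\mathcal C)$. For $\mathcal B\in\mathcal K(T)$, $\tau(\mathcal B)=\mathrm{cone}\{\rho(\mathcal C):\mathcal C\le\mathcal B\text{ a collision}\}+\mathbb R\mathbf 1$, $\mathbf 1$ the all-ones vector, and $\mathcal F(T)=\{\tau(\mathcal B):\mathcal B\in\mathcal K(T)\}$. For collisions, $\mathcal C_1\to\mathcal C_2$ if they have a common upper bound in $\mathcal K(T)$ and every essential $k$-bracket of $\mathcal C_1$ is contained in an essential $k$-bracket of $\mathcal C_2$ (for every $k$); $\mathcal C_1\sim\mathcal C_2$ if no vertex of $T$ is a weak descendant (equal to or descended from) both of a top-level vertex of the fusion bracket of $\mathcal C_1$ and of a top-level vertex of that of $\mathcal C_2$ (top level of a $k$-bracket $A$ is $A^k$). $\Delta_T$ is the simplicial complex of sets of collisions that can be listed $\mathcal C_1,\dots,\mathcal C_r$ with $\mathcal C_i\sim\mathcal C_j$ or $\mathcal C_i\to\mathcal C_j$ for all $i<j$; $\mathcal F(\Delta_T)=\{\mathrm{cone}\{\rho(\mathcal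 C):\mathcal C\in Y\}+\mathbb R\mathbf 1:Y\in\Delta_T\}$. **Braid arrangement, nestohedra.** $\mathcal A_m$ is the fan in $\mathbb R^m$ defined by the hyperplanes $x_a=x_b$ (coordinates identified with $[m]$); a fan coarsens it if each of its cones is a union of cones of $\mathcal A_m$. A building set on $[m]$ is a collection $\mathbb B$ of nonempty subsets containing all singletons such that $B_1,B_2\in\mathbb B$, $B_1\cap B_2\ne\emptyset$ imply $B_1\cup B_2\in\mathbb B$; its nestohedron is the Minkowski sum $\sum_{B\in\mathbb B}\mathrm{conv}\{e_b:b\in B\}$. The normal fan of $P$ consists of the cones, one for each nonempty face $F$ of $P$, of vectors $v$ for which $\langle v,\cdot\rangle$ attains its minimum over $P$ at every point of $F$. *)

theory Defs
  imports "HOL-Analysis.Analysis" "HOL-Library.Set_Algebras"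
begin

section \<open>Rooted plane trees\<close>

text \<open>
  The value of \<open>parent\<close> at the root is irrelevant.  The relation \<open>sib\<close> contains \<open>(u, v)\<close> iff
  \<open>u\<close> and \<open>v\<close> are siblings and \<open>u\<close> comes before \<open>v\<close>.
\<close>

record 'v tree =
  verts :: "'v set"
  troot :: 'v
  parent :: "'v \<Rightarrow> 'v"
  sib :: "'v rel"

definition ch :: "'v tree \<Rightarrow> 'v \<Rightarrow> 'v set" where
  "ch T u = {v \<in> verts T. v \<noteq> troot T \<and> parent T v = u}"

definition plane_tree :: "'v tree \<Rightarrow> bool" where
  "plane_tree T \<longleftrightarrow>
     finite (verts T) \<and> troot T \<in> verts T \<and>
     (\<forall>v \<in> verts T - {troot T}. parent T v \<in> verts T) \<and>
     (\<forall>v \<in> verts T. \<exists>j. (parent T ^^ j) v = troot T) \<and>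
     sib T \<subseteq> (\<Union>u \<in> verts T. ch T u \<times> ch T u) \<and>
     (\<forall>u \<in> verts T. strict_linear_order_on (ch T u) (sib T \<inter> ch T u \<times> ch T u))"

definition vdepth :: "'v tree \<Rightarrow> 'v \<Rightarrow> nat" where
  "vdepth T v = (LEAST j. (parent T ^^ j) v = troot T)"

definition level :: "'v tree \<Rightarrow> nat \<Rightarrow> 'v set" where
  "level T k = {v \<in> verts T. vdepth T v = k}"

definition tdepth :: "'v tree \<Rightarrow> nat" where
  "tdepth T = Max {k. level T k \<noteq> {}}"

definition is_path :: "'v tree \<Rightarrow> bool" where
  "is_path T \<longleftrightarrow> (\<forall>u \<in> verts T. card (ch T u) \<le> 1)"

definition concentrated :: "'v tree \<Rightarrow> bool" where
  "concentrated T \<longleftrightarrow> (\<forall>k < tdepth T. \<exists>!u. u \<in> level T k \<and> ch T u \<noteq> {})"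

text \<open>The list of vertices from the root to \<open>v\<close>, both included.\<close>

definition path_to :: "'v tree \<Rightarrow> 'v \<Rightarrow> 'v list" where
  "path_to T v = map (\<lambda>i. (parent T ^^ (vdepth T v - i)) v) [0..<Suc (vdepth T v)]"

definition weak_desc :: "'v tree \<Rightarrow> 'v \<Rightarrow> 'v \<Rightarrow> bool" where
  "weak_desc T v u \<longleftrightarrow> v \<in> verts T \<and> u \<in> set (path_to T v)"

text \<open>
  Two distinct vertices of the same depth have paths that first differ in two siblings, so comparing
  the sequences of child positions amounts to comparing the paths lexicographically along \<open>sib\<close>.
  Positions start at 1.
\<close>

definition pos :: "'v tree \<Rightarrow> 'v \<Rightarrow> nat" where
  "pos T v = card {u \<in> level T (vdepth T v). (path_to T u, path_to T v) \<in> lexord (sib T)} + 1"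

definition nth_vertex :: "'v tree \<Rightarrow> nat \<Rightarrow> nat \<Rightarrow> 'v" where
  "nth_vertex T k i = (THE v. v \<in> level T k \<and> pos T v = i)"


section \<open>Brackets\<close>

text \<open>
  A \<open>k\<close>-bracket \<open>(A\<^sup>0, \<dots>, A\<^sup>k)\<close> is the list of its \<open>k + 1\<close> components.  Thus \<open>\<pi>\<close> is
  \<^const>\<open>butlast\<close>, the top level is \<^const>\<open>last\<close>, and brackets of different levels are different
  lists.
\<close>

type_synonym 'v bracket = "'v set list"

definition consecutive :: "'v tree \<Rightarrow> 'v \<Rightarrow> 'v set \<Rightarrow> bool" where
  "consecutive T u S \<longleftrightarrow> S \<subseteq> ch T u \<and>
     (\<forall>x \<in> S. \<forall>z \<in> S. \<forall>y \<in> ch T u. (x, y) \<in> sib T \<and> (y, z) \<in> sib T \<longrightarrow> y \<in> S)"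

definition is_bracket :: "'v tree \<Rightarrow> nat \<Rightarrow> 'v bracket \<Rightarrow> bool" where
  "is_bracket T k A \<longleftrightarrow>
     k \<le> tdepth T \<and> length A = Suc k \<and>
     (\<forall>i \<le> k. A ! i \<subseteq> level T i) \<and> A ! k \<noteq> {} \<and>
     (\<forall>i < k. \<forall>u \<in> A ! Suc i. parent T u \<in> A ! i) \<and>
     (\<forall>i < k. \<forall>u \<in> A ! i. consecutive T u (A ! Suc i \<inter> ch T u))"

definition bsub :: "'v bracket \<Rightarrow> 'v bracket \<Rightarrow> bool" where
  "bsub A A' \<longleftrightarrow> list_all2 (\<subseteq>) A A'"

definition bpsub :: "'v bracket \<Rightarrow> 'v bracket \<Rightarrow> bool" where
  "bpsub A A' \<longleftrightarrow> bsub A A' \<and> A \<noteq> A'"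

definition sing_br :: "'v tree \<Rightarrow> 'v \<Rightarrow> 'v bracket" where
  "sing_br T u = map (\<lambda>v. {v}) (path_to T u)"

definition max_br :: "'v tree \<Rightarrow> nat \<Rightarrow> 'v bracket" where
  "max_br T k = map (level T) [0..<Suc k]"

definition is_sing :: "'v tree \<Rightarrow> 'v bracket \<Rightarrow> bool" where
  "is_sing T A \<longleftrightarrow> (\<exists>u \<in> verts T. A = sing_br T u)"

definition nontrivial :: "'v tree \<Rightarrow> 'v bracket \<Rightarrow> bool" where
  "nontrivial T A \<longleftrightarrow> \<not> is_sing T A \<and> (\<forall>k \<le> tdepth T. A \<noteq> max_br T k)"


section \<open>Bracketings and the categorical associahedron\<close>

text \<open>
  A bracketing is the pair of the union of the sets \<open>\<B>\<^sup>k\<close> (which consists of the members of length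
  \<open>k + 1\<close>) and the strict order.
\<close>

type_synonym 'v bracketing = "'v bracket set \<times> 'v bracket rel"

definition over :: "'v bracket set \<Rightarrow> 'v bracket \<Rightarrow> 'v bracket set" where
  "over BS A = {A' \<in> BS. length A' = Suc (length A) \<and> butlast A' = A}"

definition comparable :: "'v bracket rel \<Rightarrow> 'v bracket \<Rightarrow> 'v bracket \<Rightarrow> bool" where
  "comparable R A A' \<longleftrightarrow> (A, A') \<in> R \<or> (A', A) \<in> R"

definition is_bracketing :: "'v tree \<Rightarrow> 'v bracketing \<Rightarrow> bool" where
  "is_bracketing T B \<longleftrightarrow> (case B of (BS, R) \<Rightarrow>
     (\<forall>A \<in> BS. \<exists>k. is_bracket T k A) \<and>
     R \<subseteq> BS \<times> BS \<and> irrefl R \<and> trans R \<and>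
     \<comment> \<open>(1)\<close>
     (\<forall>k \<le> tdepth T. max_br T k \<in> BS) \<and> (\<forall>u \<in> verts T. sing_br T u \<in> BS) \<and>
     \<comment> \<open>(2)\<close>
     (\<forall>A \<in> BS. length A \<ge> 2 \<longrightarrow> butlast A \<in> BS) \<and>
     \<comment> \<open>(3)\<close>
     (\<forall>A1 \<in> BS. \<forall>A2 \<in> BS. length A1 = length A2 \<and> last A1 \<inter> last A2 \<noteq> {} \<longrightarrow>
        bsub A1 A2 \<or> bsub A2 A1) \<and>
     \<comment> \<open>(4a); a \<open>(k-1)\<close>-bracket has length \<open>k\<close>\<close>
     (\<forall>A \<in> BS. length A \<le> tdepth T \<longrightarrow>
        (\<Union>A' \<in> over BS A. last A') = (\<Union>u \<in> last A. ch T u)) \<and>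
     \<comment> \<open>(4b)\<close>
     (\<forall>A \<in> BS. \<forall>A1 \<in> over BS A. \<forall>A2 \<in> over BS A. bpsub A2 A1 \<longrightarrow>
        (\<forall>u' \<in> last A1. \<exists>A3 \<in> over BS A. bpsub A3 A1 \<and> u' \<in> last A3)) \<and>
     \<comment> \<open>(5a)\<close>
     (\<forall>A1 \<in> BS. \<forall>A2 \<in> BS. A1 \<noteq> A2 \<longrightarrow>
        (comparable R A1 A2 \<longleftrightarrow>
           length A1 = length A2 \<and> butlast A1 = butlast A2 \<and> last A1 \<inter> last A2 = {})) \<and>
     \<comment> \<open>(5b)\<close>
     (\<forall>(u1, u2) \<in> sib T. (sing_br T u1, sing_br T u2) \<in> R) \<and>
     \<comment> \<open>(5c)\<close>
     (\<forall>A \<in> BS. \<forall>A' \<in> BS. bsub A' A \<longrightarrow>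
        (\<forall>A1 \<in> over BS A. \<forall>A2 \<in> over BS A. \<forall>A1' \<in> over BS A'. \<forall>A2' \<in> over BS A'.
           A1 \<noteq> A2 \<and> comparable R A1 A2 \<and> A1' \<noteq> A2' \<and> comparable R A1' A2' \<and>
           bsub A1' A1 \<and> bsub A2' A2 \<longrightarrow>
             ((A1, A2) \<in> R \<longleftrightarrow> (A1', A2') \<in> R))))"

definition assoc :: "'v tree \<Rightarrow> 'v bracketing set" where
  "assoc T = {B. is_bracketing T B}"

definition br_le :: "'v bracketing \<Rightarrow> 'v bracketing \<Rightarrow> bool" where
  "br_le B B' \<longleftrightarrow> fst B \<subseteq> fst B' \<and> snd B = snd B' \<inter> fst B \<times> fst B"

definition is_minimum :: "'v tree \<Rightarrow> 'v bracketing \<Rightarrow> bool" where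
  "is_minimum T B \<longleftrightarrow> B \<in> assoc T \<and> (\<forall>B' \<in> assoc T. br_le B B')"


section \<open>Collisions and contraction\<close>

definition collisions :: "'v tree \<Rightarrow> 'v bracketing set" where
  "collisions T = {C \<in> assoc T. \<not> is_minimum T C \<and>
     (\<forall>B \<in> assoc T. \<not> is_minimum T B \<and> br_le B C \<longrightarrow> B = C)}"

definition from_nontrivial :: "'v tree \<Rightarrow> 'v bracketing \<Rightarrow> 'v bracket \<Rightarrow> bool" where
  "from_nontrivial T C E \<longleftrightarrow> E \<in> fst C \<and>
     (\<exists>A' \<in> fst C. nontrivial T A' \<and> (\<exists>l. E = (butlast ^^ l) A'))"

definition fusion :: "'v tree \<Rightarrow> 'v bracketing \<Rightarrow> 'v bracket" where
  "fusion T C = (THE E0. from_nontrivial T C E0 \<and> \<not> is_sing T E0 \<and> is_sing T (butlast E0))"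

definition essential :: "'v tree \<Rightarrow> 'v bracketing \<Rightarrow> 'v bracket set" where
  "essential T C = {E. from_nontrivial T C E \<and> (\<exists>j. (butlast ^^ j) E = fusion T C)}"

definition fusion_parent :: "'v tree \<Rightarrow> 'v bracketing \<Rightarrow> 'v" where
  "fusion_parent T C = (THE w. w \<in> verts T \<and> butlast (fusion T C) = sing_br T w)"

definition in_or_below :: "'v tree \<Rightarrow> 'v set \<Rightarrow> 'v set" where
  "in_or_below T W = {v. \<exists>u \<in> W. weak_desc T v u}"

text \<open>
  The tree \<open>T/\<C>\<close>: \<open>Inl v\<close> is a remaining vertex of \<open>T\<close> and \<open>Inr E\<close> is the new vertex of the
  essential bracket \<open>E\<close>.
\<close>

definition contract :: "'v tree \<Rightarrow> 'v bracketing \<Rightarrow> ('v + 'v bracket) tree" where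
  "contract T C =
     (let E0 = fusion T C; W = last E0; V = verts T - in_or_below T W; Ess = essential T C in
      \<lparr> verts = Inl ` V \<union> Inr ` Ess,
        troot = Inl (troot T),
        parent = (\<lambda>x. case x of
            Inl v \<Rightarrow> Inl (parent T v)
          | Inr E \<Rightarrow> if E = E0 then Inl (fusion_parent T C) else Inr (butlast E)),
        sib = {(Inl u, Inl v) | u v. u \<in> V \<and> v \<in> V \<and> (u, v) \<in> sib T}
            \<union> {(Inl u, Inr E0) | u. u \<in> V \<and> (\<forall>x \<in> W. (u, x) \<in> sib T)}
            \<union> {(Inr E0, Inl u) | u. u \<in> V \<and> (\<forall>x \<in> W. (x, u) \<in> sib T)}
            \<union> {(Inr E, Inr E') | E E'. E \<in> Ess \<and> E' \<in> Ess \<and> (E, E') \<in> snd C} \<rparr>)"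

definition contract_map :: "'v tree \<Rightarrow> 'v bracketing \<Rightarrow> 'v \<Rightarrow> 'v + 'v bracket" where
  "contract_map T C v =
     (if v \<in> in_or_below T (last (fusion T C))
      then Inr (THE E. E \<in> essential T C \<and> length E = Suc (vdepth T v) \<and> v \<in> last E)
      else Inl v)"


section \<open>Velocity fans\<close>

definition coords :: "'v tree \<Rightarrow> (nat \<times> nat) set" where
  "coords T = {(k, i). 1 \<le> k \<and> k \<le> tdepth T \<and> 1 \<le> i \<and> i \<le> card (level T k) - 1}"

definition rho_coord :: "'v tree \<Rightarrow> 'v bracketing \<Rightarrow> nat \<Rightarrow> nat \<Rightarrow> real" where
  "rho_coord T C k i =
     (let d = (\<lambda>j. real (pos (contract T C) (contract_map T C (nth_vertex T k j))))
      in d i - d (i + 1) + 1)"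

text \<open>
  The space \<open>\<real>\<^sup>m\<close> is \<open>real ^ 'm\<close>, where \<open>idx\<close> is a bijection from the index type \<open>'m\<close> to the set of
  pairs \<^term>\<open>coords T\<close>; so \<open>x $ a\<close> is the coordinate \<open>x\<^sup>k\<^sub>i\<close> for \<open>idx a = (k, i)\<close>.
\<close>

definition rho :: "'v tree \<Rightarrow> ('m::finite \<Rightarrow> nat \<times> nat) \<Rightarrow> 'v bracketing \<Rightarrow> real ^ 'm" where
  "rho T idx C = (\<chi> a. rho_coord T C (fst (idx a)) (snd (idx a)))"

text \<open>The convex cone generated by \<open>S\<close> plus the line spanned by the all-ones vector \<open>1\<close>.\<close>

definition cone_ones :: "(real ^ 'm::finite) set \<Rightarrow> (real ^ 'm) set" where
  "cone_ones S = convex_cone hull S + range (\<lambda>c. c *\<^sub>R 1)"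

definition velocity_fan :: "'v tree \<Rightarrow> ('m::finite \<Rightarrow> nat \<times> nat) \<Rightarrow> (real ^ 'm) set set" where
  "velocity_fan T idx =
     (\<lambda>B. cone_ones (rho T idx ` {C \<in> collisions T. br_le C B})) ` assoc T"

definition coll_arrow :: "'v tree \<Rightarrow> 'v bracketing \<Rightarrow> 'v bracketing \<Rightarrow> bool" where
  "coll_arrow T C1 C2 \<longleftrightarrow>
     (\<exists>B \<in> assoc T. br_le C1 B \<and> br_le C2 B) \<and>
     (\<forall>E \<in> essential T C1. \<exists>E' \<in> essential T C2. bsub E E')"

definition coll_sim :: "'v tree \<Rightarrow> 'v bracketing \<Rightarrow> 'v bracketing \<Rightarrow> bool" where
  "coll_sim T C1 C2 \<longleftrightarrow>
     in_or_below T (last (fusion T C1)) \<inter> in_or_below T (last (fusion T C2)) = {}"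

definition coll_complex :: "'v tree \<Rightarrow> 'v bracketing set set" where
  "coll_complex T = {set Cs | Cs. set Cs \<subseteq> collisions T \<and> distinct Cs \<and>
     sorted_wrt (\<lambda>C1 C2. coll_sim T C1 C2 \<or> coll_arrow T C1 C2) Cs}"

definition triangulated_velocity_fan ::
    "'v tree \<Rightarrow> ('m::finite \<Rightarrow> nat \<times> nat) \<Rightarrow> (real ^ 'm) set set" where
  "triangulated_velocity_fan T idx = (\<lambda>Y. cone_ones (rho T idx ` Y)) ` coll_complex T"


section \<open>Fans, the braid arrangement and nestohedra\<close>

text \<open>The faces of a cone in the sense of fans are nonempty, unlike those of \<^const>\<open>face_of\<close>.\<close>

definition is_fan :: "(real ^ 'm::finite) set set \<Rightarrow> bool" where
  "is_fan F \<longleftrightarrow> finite F \<and>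
     (\<forall>C \<in> F. polyhedron C \<and> convex_cone C) \<and>
     (\<forall>C \<in> F. \<forall>G. G face_of C \<and> G \<noteq> {} \<longrightarrow> G \<in> F) \<and>
     (\<forall>C \<in> F. \<forall>D \<in> F. C \<inter> D face_of C \<and> C \<inter> D face_of D)"

text \<open>
  For each point \<open>y\<close>, the closed cone of the arrangement of the hyperplanes \<open>x\<^sub>a = x\<^sub>b\<close> that
  contains \<open>y\<close> in its relative interior.
\<close>

definition braid_fan :: "(real ^ 'm::finite) set set" where
  "braid_fan = range (\<lambda>y :: real ^ 'm. {x. \<forall>a b. y $ a \<le> y $ b \<longrightarrow> x $ a \<le> x $ b})"

definition coarsens_braid :: "(real ^ 'm::finite) set set \<Rightarrow> bool" where
  "coarsens_braid F \<longleftrightarrow> is_fan F \<and> (\<forall>C \<in> F. \<exists>D \<subseteq> braid_fan. C = \<Union>D)"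

definition building_set :: "'m set set \<Rightarrow> bool" where
  "building_set BB \<longleftrightarrow> {} \<notin> BB \<and> (\<forall>b. {b} \<in> BB) \<and>
     (\<forall>B1 \<in> BB. \<forall>B2 \<in> BB. B1 \<inter> B2 \<noteq> {} \<longrightarrow> B1 \<union> B2 \<in> BB)"

text \<open>The sum of sets is the Minkowski sum.\<close>

definition nestohedron :: "'m::finite set set \<Rightarrow> (real ^ 'm) set" where
  "nestohedron BB = (\<Sum>B \<in> BB. convex hull ((\<lambda>b. axis b 1) ` B))"

definition normal_fan :: "(real ^ 'm::finite) set \<Rightarrow> (real ^ 'm) set set" where
  "normal_fan P = (\<lambda>F. {v. \<forall>x \<in> F. \<forall>y \<in> P. v \<bullet> x \<le> v \<bullet> y}) ` {F. F face_of P \<and> F \<noteq> {}}"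

end

theory Submission
  imports Defs
begin

text \<open>
  Identify the coordinates with the gaps between consecutive vertices of a level.  In a concentrated
  tree every bracket is determined by a vertex \<open>u\<close> of its top level and the set \<open>U\<close> of gaps inside it:
  it is the sequence \<open>br U u\<close> of the blocks around the vertices of the path to \<open>u\<close> that arise by closing
  the gaps in \<open>U\<close>.  The order of a bracketing is determined by its brackets.

  For every vector \<open>v\<close> the brackets \<open>br {a. c \<le> v $ a} u\<close> form a bracketing, and the cone of a bracketing
  \<open>\<B>\<close> is the set of all \<open>v\<close> whose brackets lie in \<open>\<B>\<close>.  For \<open>x\<close> and \<open>y\<close> in this cone condition (3) makes
  the blocks of superlevel sets nested, so that the brackets of \<open>x + y\<close> are those of \<open>x\<close> and those of \<open>y\<close>.
  Hence intersections of cones are faces, and each face is the cone of the bracketing of one of its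
  points.  As membership only depends on superlevel sets, each cone is a union of braid cones.

  Make two gaps adjacent if some ends of theirs are weak descendants of each other.  The collisions
  correspond to the proper connected sets of gaps, with \<open>\<rho>(\<C>)\<close> the indicator vector; \<open>\<sim>\<close> means that two
  connected sets are not adjacent and \<open>\<rightarrow>\<close> is inclusion.  Thus \<open>\<Delta>\<^sub>T\<close> is the nested complex of the
  connected sets, whose cones form the normal fan of the nestohedron.
\<close>

section \<open>Cones\<close>

text \<open>Each cone is handled in two forms. Generated by finitely many indicator vectors, it is
  visibly polyhedral; as the set of vectors whose brackets lie in a given bracketing, it shows its
  faces. The bridge has two pillars. Modulo the all-ones line, every vector is a nonnegative
  combination of the indicators of the connected components of its superlevel sets. And closing only
  one component of a set of gaps has, seen from any vertex, either no effect or the effect of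
  closing the whole set. Adjacency of gaps is made for the second pillar: a bracket at
  \<open>u\<close> consists of the blocks around the ancestors of \<open>u\<close>, and ancestors of
  one vertex are mutually comparable. Gaps suffice as coordinates because concentration makes each
  level below the root a single family of siblings, so that consecutive sets are intervals of a
  level. The delicate point is that faces are again cones of the family: a point \<open>x\<close> of
  the face with as many brackets as possible has to be moved away from an arbitrary \<open>y\<close>
  of the candidate cone without acquiring new brackets.\<close>

definition ind :: "'m::finite set \<Rightarrow> real ^ 'm" where
  "ind U = (\<chi> a. if a \<in> U then 1 else 0)"

lemma ind_nth [simp]: "ind U $ a = (if a \<in> U then 1 else 0)"
  by (simp add: ind_def)

text \<open>Two opposite generators replace the line, so that monotonicity, minimality and
  polyhedrality of \<open>cone_ones\<close> become facts about one hull.\<close>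

lemma cone_ones_eq_hull:
  fixes S :: "(real ^ 'm::finite) set"
  shows "cone_ones S = convex_cone hull (S \<union> {1, - 1})"
proof -
  have "range (\<lambda>c. c *\<^sub>R (1 :: real ^ 'm)) = convex_cone hull {1, - 1}"
  proof
    have "c *\<^sub>R (1 :: real ^ 'm) \<in> convex_cone hull {1, - 1}" for c
    proof (cases "c \<ge> 0")
      case True
      then show ?thesis
        by (intro convex_cone_hull_mul hull_inc) auto
    next
      case False
      then have "(- c) *\<^sub>R (- 1 :: real ^ 'm) \<in> convex_cone hull {1, - 1}"
        by (intro convex_cone_hull_mul hull_inc) auto
      then show ?thesis by simp
    qed
    then show "range (\<lambda>c. c *\<^sub>R (1 :: real ^ 'm)) \<subseteq> convex_cone hull {1, - 1}" by blast
    have "convex_cone (range (\<lambda>c. c *\<^sub>R (1 :: real ^ 'm)))"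
      unfolding convex_cone_iff
    proof (intro conjI ballI allI impI)
      show "0 \<in> range (\<lambda>c. c *\<^sub>R (1 :: real ^ 'm))" by (metis rangeI scaleR_zero_left)
    next
      fix x y assume "x \<in> range (\<lambda>c. c *\<^sub>R (1 :: real ^ 'm))" "y \<in> range (\<lambda>c. c *\<^sub>R (1 :: real ^ 'm))"
      then show "x + y \<in> range (\<lambda>c. c *\<^sub>R (1 :: real ^ 'm))"
        by (metis (mono_tags, lifting) rangeE rangeI scaleR_left_distrib)
    next
      fix x and c :: real assume "x \<in> range (\<lambda>c. c *\<^sub>R (1 :: real ^ 'm))"
      then show "c *\<^sub>R x \<in> range (\<lambda>c. c *\<^sub>R (1 :: real ^ 'm))"
        by (metis (mono_tags, lifting) rangeE rangeI scaleR_scaleR)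
    qed
    then show "convex_cone hull {1, - 1} \<subseteq> range (\<lambda>c. c *\<^sub>R (1 :: real ^ 'm))"
      by (intro hull_minimal)
         (auto intro: range_eqI[of _ _ 1] range_eqI[of _ _ "- 1"])
  qed
  then have "cone_ones S = convex_cone hull S + convex_cone hull {1, - 1}"
    by (simp add: cone_ones_def)
  also have "\<dots> = convex_cone hull (S \<union> {1, - 1})"
    unfolding convex_cone_hull_Un set_plus_def by blast
  finally show ?thesis .
qed

lemma convex_cone_cone_ones: "convex_cone (cone_ones S)"
  by (simp add: cone_ones_eq_hull convex_cone_convex_cone_hull)

lemmas cone_ones_add = convex_cone_add[OF convex_cone_cone_ones]
  and cone_ones_scale = convex_cone_scaleR[OF convex_cone_cone_ones]
  and zero_in_cone_ones = convex_cone_contains_0[OF convex_cone_cone_ones]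

lemma cone_ones_inc: "x \<in> S \<Longrightarrow> x \<in> cone_ones S"
  by (simp add: cone_ones_eq_hull hull_inc)

lemma ones_in_cone_ones: "c *\<^sub>R 1 \<in> cone_ones S"
  unfolding cone_ones_def using convex_cone_hull_contains_0[of S]
  by (metis add_0 rangeI set_plus_intro)

lemma cone_ones_mono: "S \<subseteq> S' \<Longrightarrow> cone_ones S \<subseteq> cone_ones S'"
  unfolding cone_ones_eq_hull by (intro hull_mono) auto

lemma cone_ones_minimal:
  assumes "convex_cone K" "S \<subseteq> K" "\<And>c. c *\<^sub>R 1 \<in> K"
  shows "cone_ones S \<subseteq> K"
proof -
  have "1 \<in> K" "- 1 \<in> K" using assms(3)[of 1] assms(3)[of "- 1"] by auto
  then show ?thesis
    unfolding cone_ones_eq_hull using assms(1,2) by (intro hull_minimal) auto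
qed

lemma polyhedron_cone_ones: "finite S \<Longrightarrow> polyhedron (cone_ones S)"
  by (simp add: cone_ones_eq_hull polyhedron_convex_cone_hull)

section \<open>Connected sets of a graph\<close>

text \<open>The tubes of a graph associahedron. The closure is taken inside \<open>N\<close>, so
  that connecting paths do not leave \<open>N\<close>.\<close>

definition tube :: "'a rel \<Rightarrow> 'a set \<Rightarrow> bool" where
  "tube Q N \<longleftrightarrow> N \<noteq> {} \<and> (\<forall>a \<in> N. \<forall>b \<in> N. (a, b) \<in> (Q \<inter> N \<times> N)\<^sup>*)"

definition conn_comp :: "'a rel \<Rightarrow> 'a set \<Rightarrow> 'a \<Rightarrow> 'a set" where
  "conn_comp Q U a = {b. (a, b) \<in> (Q \<inter> U \<times> U)\<^sup>*}"

lemma self_in_conn_comp [simp]: "a \<in> conn_comp Q U a"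
  by (simp add: conn_comp_def)

lemma conn_comp_subset: "a \<in> U \<Longrightarrow> conn_comp Q U a \<subseteq> U"
proof
  fix b assume "a \<in> U" "b \<in> conn_comp Q U a"
  from this(2) have "(a, b) \<in> (Q \<inter> U \<times> U)\<^sup>*" by (simp add: conn_comp_def)
  then show "b \<in> U" using \<open>a \<in> U\<close> by induction simp_all
qed

lemma conn_comp_step: "b \<in> conn_comp Q U a \<Longrightarrow> (b, c) \<in> Q \<Longrightarrow> b \<in> U \<Longrightarrow> c \<in> U \<Longrightarrow> c \<in> conn_comp Q U a"
  unfolding conn_comp_def by (simp add: rtrancl.rtrancl_into_rtrancl)

lemma tube_subset_conn_comp: "tube Q N \<Longrightarrow> N \<subseteq> U \<Longrightarrow> a \<in> N \<Longrightarrow> N \<subseteq> conn_comp Q U a"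
  unfolding tube_def conn_comp_def using rtrancl_mono[of "Q \<inter> N \<times> N" "Q \<inter> U \<times> U"] by blast

lemma tube_singleton: "tube Q {a}"
  by (simp add: tube_def)

text \<open>Induction along a connected set: a property that holds at one element and passes along
  the edges inside \<open>N\<close> holds on all of \<open>N\<close>.\<close>

lemma tube_closed_eq:
  assumes "tube Q N" "a \<in> N" "a \<in> S" "\<And>b c. b \<in> S \<Longrightarrow> b \<in> N \<Longrightarrow> c \<in> N \<Longrightarrow> (b, c) \<in> Q \<Longrightarrow> c \<in> S"
  shows "N \<subseteq> S"
proof
  fix b assume "b \<in> N"
  with assms have "(a, b) \<in> (Q \<inter> N \<times> N)\<^sup>*" by (auto simp: tube_def)
  then show "b \<in> S"
  proof induction
    case base
    show ?case by (rule assms(3))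
  next
    case (step b c)
    then show ?case using assms(4) by blast
  qed
qed

text \<open>With loops at all elements, sets that meet are also joined by an edge. The single
  condition \<open>Q \<inter> N \<times> N' = {}\<close> therefore says both disjoint and not
  adjacent.\<close>

locale graph =
  fixes Q :: "'m::finite rel"
  assumes sym_Q: "sym Q" and refl_Q: "(a, a) \<in> Q"
begin

lemma conn_comp_sym: "b \<in> conn_comp Q U a \<Longrightarrow> a \<in> conn_comp Q U b"
proof -
  have "sym ((Q \<inter> U \<times> U)\<^sup>*)"
    using sym_Q by (intro sym_rtrancl) (auto simp: sym_def)
  then show "b \<in> conn_comp Q U a \<Longrightarrow> a \<in> conn_comp Q U b"
    unfolding conn_comp_def sym_def by blast
qed

lemma conn_comp_eq: "b \<in> conn_comp Q U a \<Longrightarrow> conn_comp Q U b = conn_comp Q U a"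
  using conn_comp_sym[of b U a] unfolding conn_comp_def
  by (intro Collect_cong) (metis mem_Collect_eq rtrancl_trans)

lemma tube_conn_comp: "tube Q (conn_comp Q U a)"
proof -
  let ?N = "conn_comp Q U a"
  have "(a, b) \<in> (Q \<inter> ?N \<times> ?N)\<^sup>*" if "b \<in> ?N" for b
  proof -
    from that have "(a, b) \<in> (Q \<inter> U \<times> U)\<^sup>*" by (simp add: conn_comp_def)
    then show ?thesis
    proof induction
      case (step y z)
      then have "y \<in> ?N" "z \<in> ?N" by (simp_all add: conn_comp_def rtrancl.rtrancl_into_rtrancl)
      with step show ?case by (simp add: rtrancl.rtrancl_into_rtrancl)
    qed auto
  qed
  moreover have "sym ((Q \<inter> ?N \<times> ?N)\<^sup>*)"
    using sym_Q by (intro sym_rtrancl) (auto simp: sym_def)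
  ultimately have "(b, c) \<in> (Q \<inter> ?N \<times> ?N)\<^sup>*" if "b \<in> ?N" "c \<in> ?N" for b c
    using that by (meson rtrancl_trans symD)
  moreover have "?N \<noteq> {}" using self_in_conn_comp by (rule ex_in_conv[THEN iffD1, OF exI])
  ultimately show ?thesis unfolding tube_def by simp
qed

lemma tube_imp_conn_comp_eq: "tube Q N \<Longrightarrow> a \<in> N \<Longrightarrow> conn_comp Q N a = N"
  using conn_comp_subset[of a N Q] tube_subset_conn_comp[of Q N N a] by auto

lemma tube_Un:
  assumes "tube Q N" "tube Q N'" "a \<in> N" "b \<in> N'" "(a, b) \<in> Q"
  shows "tube Q (N \<union> N')"
proof -
  have N: "N \<subseteq> conn_comp Q (N \<union> N') a" using assms by (intro tube_subset_conn_comp) auto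
  have "b \<in> conn_comp Q (N \<union> N') a" using assms by (rule_tac conn_comp_step[of a]) simp_all
  moreover have "N' \<subseteq> conn_comp Q (N \<union> N') b" using assms by (intro tube_subset_conn_comp) auto
  ultimately have "N' \<subseteq> conn_comp Q (N \<union> N') a" by (simp only: conn_comp_eq)
  with N have "conn_comp Q (N \<union> N') a = N \<union> N'"
    using conn_comp_subset[of a "N \<union> N'" Q] assms(3) by (intro subset_antisym) simp_all
  then show ?thesis using tube_conn_comp[of "N \<union> N'" a] by simp
qed

text \<open>The graphical building set; the loop at a common element serves as the edge that joins
  the two tubes.\<close>

lemma building_set_tubes: "building_set {N. tube Q N}"
  unfolding building_set_def
proof (intro conjI allI ballI impI)
  show "{} \<notin> {N. tube Q N}" by (simp add: tube_def)
  show "{b} \<in> {N. tube Q N}" for b by (simp add: tube_singleton)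
next
  fix B1 B2 assume "B1 \<in> {N. tube Q N}" "B2 \<in> {N. tube Q N}" "B1 \<inter> B2 \<noteq> {}"
  then obtain b where "b \<in> B1" "b \<in> B2" "tube Q B1" "tube Q B2" by auto
  then show "B1 \<union> B2 \<in> {N. tube Q N}" using tube_Un[OF _ _ _ _ refl_Q] by blast
qed

lemma ind_sum_comps: "ind U = sum ind (conn_comp Q U ` U)"
proof (rule vec_eq_iff[THEN iffD2], rule allI)
  fix a
  show "ind U $ a = sum ind (conn_comp Q U ` U) $ a"
  proof (cases "a \<in> U")
    case True
    have "a \<notin> M" if "M \<in> conn_comp Q U ` U - {conn_comp Q U a}" for M
      using that conn_comp_eq by blast
    then have "(\<Sum>M\<in>conn_comp Q U ` U. ind M $ a) = (\<Sum>M\<in>{conn_comp Q U a}. ind M $ a)"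
      using True by (intro sum.mono_neutral_right) auto
    then show ?thesis using True by (simp add: sum_component)
  next
    case False
    then have "a \<notin> M" if "M \<in> conn_comp Q U ` U" for M
      using that conn_comp_subset by fastforce
    then have "(\<Sum>M\<in>conn_comp Q U ` U. ind M $ a) = 0"
      by (intro sum.neutral) auto
    with False show ?thesis by (simp add: sum_component)
  qed
qed

section \<open>Components of superlevel sets and nested sets\<close>

text \<open>\<open>UNIV\<close> is left out because its indicator is the all-ones vector, which
  \<open>cone_ones\<close> supplies anyway.\<close>

definition sup_tubes :: "real ^ 'm \<Rightarrow> 'm set set" where
  "sup_tubes v = {N. N \<noteq> UNIV \<and> (\<exists>c. \<exists>a \<in> {b. c \<le> v $ b}. N = conn_comp Q {b. c \<le> v $ b} a)}"

text \<open>Lowering the top layer of \<open>v\<close> to the next value leaves the other superlevel sets unchanged.\<close>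

lemma in_cone_sup_tubes: "v \<in> cone_ones (ind ` sup_tubes v)"
proof (induction "card (range (($) v))" arbitrary: v rule: less_induct)
  case less
  let ?V = "range (($) v)"
  define M where "M = Max ?V"
  have M: "M \<in> ?V" "\<And>a. v $ a \<le> M" unfolding M_def by (auto intro: Max_in)
  show ?case
  proof (cases "?V - {M} = {}")
    case True
    then have "v $ a = M" for a by blast
    then have "v = M *\<^sub>R 1" by (simp add: vec_eq_iff)
    then show ?thesis by (metis ones_in_cone_ones)
  next
    case False
    define M' where "M' = Max (?V - {M})"
    have M': "M' \<in> ?V - {M}" "\<And>a. v $ a \<noteq> M \<Longrightarrow> v $ a \<le> M'"
    proof -
      show "M' \<in> ?V - {M}" unfolding M'_def using False by (intro Max_in) auto
      show "v $ a \<le> M'" if "v $ a \<noteq> M" for a unfolding M'_def using that by (intro Max_ge) auto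
    qed
    then have lt: "M' < M" using M by (metis DiffE imageE insertI1 order_less_le)
    define U where "U = {a. M \<le> v $ a}"
    define v' where "v' = v - (M - M') *\<^sub>R ind U"
    have v': "v' $ a = (if a \<in> U then M' else v $ a)" for a
      using M(2)[of a] by (auto simp: v'_def U_def)
    have "range (($) v') \<subseteq> ?V - {M}"
      using M' M lt by (auto simp: v' U_def)
    with M(1) have "range (($) v') \<subset> ?V" by blast
    then have "card (range (($) v')) < card ?V" by (intro psubset_card_mono) auto
    from less[OF this] have 1: "v' \<in> cone_ones (ind ` sup_tubes v')" .
    have "sup_tubes v' \<subseteq> sup_tubes v"
    proof
      fix N assume "N \<in> sup_tubes v'"
      then obtain c a where N: "N \<noteq> UNIV" "c \<le> v' $ a" "N = conn_comp Q {b. c \<le> v' $ b} a"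
        by (auto simp: sup_tubes_def)
      have "v' $ b \<le> M'" for b using M'(2)[of b] M(2)[of b] by (auto simp: v' U_def)
      then have c: "c \<le> M'" using N(2) order_trans by blast
      have "{b. c \<le> v' $ b} = {b. c \<le> v $ b}"
        using c lt M by (auto simp: v' U_def)
      with N show "N \<in> sup_tubes v" by (auto simp: sup_tubes_def)
    qed
    with 1 have 2: "v' \<in> cone_ones (ind ` sup_tubes v)"
      using cone_ones_mono[OF image_mono] by blast
    have "M' \<in> ?V" using M' by blast
    \<comment> \<open>An element with the second largest value lies outside the top layer
      \<open>U\<close>. Hence the components of \<open>U\<close> are proper, as membership in
      \<open>sup_tubes\<close> demands.\<close>
    then obtain a where "v $ a = M'" by auto
    then have "a \<notin> U" using lt by (auto simp: U_def)
    then have "conn_comp Q U ` U \<subseteq> sup_tubes v"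
      using conn_comp_subset[of _ U Q] by (fastforce simp: sup_tubes_def U_def)
    then have "sum ind X \<in> cone_ones (ind ` sup_tubes v)" if "X \<subseteq> conn_comp Q U ` U" for X
      using that finite[of X]
      by (induction X rule: infinite_finite_induct)
         (auto intro!: zero_in_cone_ones cone_ones_add intro: cone_ones_inc)
    then have "ind U \<in> cone_ones (ind ` sup_tubes v)"
      using ind_sum_comps[of U] by simp
    then have "v' + (M - M') *\<^sub>R ind U \<in> cone_ones (ind ` sup_tubes v)"
      using lt 2 by (intro cone_ones_add cone_ones_scale) auto
    then show ?thesis by (simp add: v'_def)
  qed
qed

text \<open>Nested sets of the graphical building set, without \<open>UNIV\<close>. For tubes of a
  graph a pairwise condition suffices: a union of pairwise unlinked tubes is never connected when
  there are at least two of them.\<close>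

definition nested :: "'m set set \<Rightarrow> bool" where
  "nested Y \<longleftrightarrow> (\<forall>N \<in> Y. tube Q N \<and> N \<noteq> UNIV) \<and>
     (\<forall>N \<in> Y. \<forall>N' \<in> Y. N \<subseteq> N' \<or> N' \<subseteq> N \<or> Q \<inter> N \<times> N' = {})"

text \<open>Of two components, the one with the higher threshold lies inside the superlevel set of
  the other. If an edge links them, it is connected to the other component and so contained in
  it.\<close>

lemma nested_sup_tubes: "nested (sup_tubes v)"
proof -
  have *: "N \<subseteq> N' \<or> Q \<inter> N \<times> N' = {}"
    if "c' \<le> c" "a \<in> {b. c \<le> v $ b}" "N = conn_comp Q {b. c \<le> v $ b} a"
       "a' \<in> {b. c' \<le> v $ b}" "N' = conn_comp Q {b. c' \<le> v $ b} a'" for N N' a a' c c'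
  proof (cases "Q \<inter> N \<times> N' = {}")
    case False
    then obtain x y where xy: "(x, y) \<in> Q" "x \<in> N" "y \<in> N'" by auto
    have N: "N \<subseteq> {b. c \<le> v $ b}" "N' \<subseteq> {b. c' \<le> v $ b}"
      unfolding that(3,5) by (rule conn_comp_subset, rule that)+
    have "(y, x) \<in> Q" using sym_Q xy(1) by (simp add: sym_def)
    moreover have "y \<in> {b. c' \<le> v $ b}" "x \<in> {b. c' \<le> v $ b}"
      using N xy that(1) by fastforce+
    ultimately have "x \<in> N'"
      using xy(3) unfolding that(5) by (rule_tac conn_comp_step[of y])
    moreover have "tube Q N" using that tube_conn_comp by metis
    moreover have "N \<subseteq> {b. c' \<le> v $ b}" using N(1) that(1) by fastforce
    ultimately have "N \<subseteq> conn_comp Q {b. c' \<le> v $ b} x"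
      using xy by (intro tube_subset_conn_comp) auto
    moreover have "conn_comp Q {b. c' \<le> v $ b} x = N'"
      using conn_comp_eq \<open>x \<in> N'\<close> that by metis
    ultimately have "N \<subseteq> N'" by simp
    then show ?thesis ..
  qed auto
  have Q: "Q \<inter> N \<times> N' = {} \<longleftrightarrow> Q \<inter> N' \<times> N = {}" for N N'
    using sym_Q by (auto simp: sym_def)
  show ?thesis
    unfolding nested_def
  proof (intro conjI ballI)
    fix N assume "N \<in> sup_tubes v"
    then show "tube Q N" "N \<noteq> UNIV" by (auto simp: sup_tubes_def tube_conn_comp)
  next
    fix N N' assume "N \<in> sup_tubes v" "N' \<in> sup_tubes v"
    then obtain a c a' c' where "a \<in> {b. c \<le> v $ b}" "N = conn_comp Q {b. c \<le> v $ b} a"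
       "a' \<in> {b. c' \<le> v $ b}" "N' = conn_comp Q {b. c' \<le> v $ b} a'"
      unfolding sup_tubes_def by blast
    then show "N \<subseteq> N' \<or> N' \<subseteq> N \<or> Q \<inter> N \<times> N' = {}"
      using *[of c' c a N a' N'] *[of c c' a' N' a N] Q[of N N'] by (meson linear)
  qed
qed

lemma sum_ind_nth: "sum ind Y $ a = real (card {N \<in> Y. a \<in> N})"
proof -
  have "sum ind Y $ a = (\<Sum>N\<in>Y. if a \<in> N then 1 else 0)" by (simp add: sum_component)
  also have "\<dots> = real (card {N \<in> Y. a \<in> N})"
    by (simp add: sum.If_cases Int_def conj_commute)
  finally show ?thesis .
qed

text \<open>
  The value of \<open>\<Sum>N\<in>Y. ind N\<close> at \<open>b\<close> counts the members of \<open>Y\<close> around \<open>b\<close>; they form a chain, so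
  a component of the superlevel set at \<open>c\<close> is a member of \<open>Y\<close> of height \<open>c\<close>.
\<close>

lemma sup_tubes_sum_ind:
  assumes Y: "nested Y" and conn: "tube Q UNIV"
  shows "sup_tubes (sum ind Y) = Y"
proof -
  define h where "h N = card {N' \<in> Y. N \<subseteq> N'}" for N
  have chain: "N \<subseteq> N' \<or> N' \<subseteq> N" if "N \<in> Y" "N' \<in> Y" "(a, b) \<in> Q" "a \<in> N" "b \<in> N'" for N N' a b
    using Y that unfolding nested_def by blast
  have h_less: "h N' < h N" if "N \<subset> N'" "N \<in> Y" for N N'
    unfolding h_def using that by (intro psubset_card_mono) auto
  have h_le: "real (h N) \<le> sum ind Y $ a" if "a \<in> N" for N a
    unfolding h_def sum_ind_nth using that by (auto intro!: card_mono)
  \<comment> \<open>On the chain of members around \<open>b\<close> the height \<open>h\<close> is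
    injective with values between 1 and the length of the chain, so every such value occurs.\<close>
  have ex: "\<exists>N \<in> Y. b \<in> N \<and> h N = k" if "real k \<le> sum ind Y $ b" "k \<ge> 1" for b k
  proof -
    let ?Z = "{N \<in> Y. b \<in> N}"
    have inj: "inj_on h ?Z"
    proof (rule inj_onI)
      fix N N' assume *: "N \<in> ?Z" "N' \<in> ?Z" "h N = h N'"
      then have "N \<subseteq> N' \<or> N' \<subseteq> N" using chain[of N N' b b] refl_Q by auto
      then show "N = N'" using h_less[of N N'] h_less[of N' N] * by auto
    qed
    have "h ` ?Z \<subseteq> {1..card ?Z}"
    proof
      fix j assume "j \<in> h ` ?Z"
      then obtain N where N: "N \<in> ?Z" "j = h N" by auto
      have "{N' \<in> Y. N \<subseteq> N'} \<subseteq> ?Z" using N by auto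
      then have "h N \<le> card ?Z" unfolding h_def by (intro card_mono) auto
      moreover have "h N > 0" unfolding h_def using N by (auto simp: card_gt_0_iff)
      ultimately show "j \<in> {1..card ?Z}" using N by auto
    qed
    moreover have "card (h ` ?Z) = card {1..card ?Z}" using card_image[OF inj] by simp
    ultimately have "h ` ?Z = {1..card ?Z}" by (intro card_subset_eq) auto
    moreover have "k \<in> {1..card ?Z}" using that unfolding sum_ind_nth by simp
    ultimately have "k \<in> h ` ?Z" by simp
    then show ?thesis by auto
  qed
  have comp: "conn_comp Q {b. c \<le> sum ind Y $ b} a = N"
    if N: "N \<in> Y" "a \<in> N" and c: "real (h N) - 1 < c" "c \<le> h N" for N a c
  proof
    let ?U = "{b. c \<le> sum ind Y $ b}"
    have "N \<subseteq> ?U" using h_le[of _ N] c by fastforce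
    then show "N \<subseteq> conn_comp Q ?U a" using Y N by (intro tube_subset_conn_comp) (auto simp: nested_def)
    have hpos: "h N \<ge> 1" unfolding h_def using N by (auto simp: Suc_le_eq card_gt_0_iff)
    have "conn_comp Q ?U a \<subseteq> N"
    proof (rule tube_closed_eq[of Q _ a])
      show "tube Q (conn_comp Q ?U a)" by (rule tube_conn_comp)
    next
      fix b d assume b: "b \<in> N" and "d \<in> conn_comp Q ?U a" and Q: "(b, d) \<in> Q"
      moreover have "a \<in> ?U" using N \<open>N \<subseteq> ?U\<close> by auto
      ultimately have "c \<le> sum ind Y $ d" using conn_comp_subset[of a ?U Q] by blast
      \<comment> \<open>The sum has integer values and \<open>c\<close> exceeds
        \<open>h N - 1\<close>, so the bound rounds up to \<open>h N\<close>.\<close>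
      then have "real (h N) \<le> sum ind Y $ d"
        using c unfolding sum_ind_nth by (simp add: less_Suc_eq_le[symmetric] del: less_Suc_eq_le)
      from ex[OF this hpos] obtain N' where N': "N' \<in> Y" "d \<in> N'" "h N' = h N" by auto
      have "N \<subseteq> N' \<or> N' \<subseteq> N" using chain[OF N(1) N'(1) Q b N'(2)] .
      then have "N = N'" using h_less[of N N'] h_less[of N' N] N N' by auto
      then show "d \<in> N" using N' by simp
    qed (use N in auto)
    then show "conn_comp Q ?U a \<subseteq> N" .
  qed
  show ?thesis
  proof
    show "Y \<subseteq> sup_tubes (sum ind Y)"
    proof
      fix N assume N: "N \<in> Y"
      have "tube Q N" "N \<noteq> UNIV" using Y N unfolding nested_def by simp_all
      then obtain a where a: "a \<in> N" "N \<noteq> UNIV" unfolding tube_def by blast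
      have "real (h N) - 1 < real (h N)" by simp
      then have "conn_comp Q {b. real (h N) \<le> sum ind Y $ b} a = N" by (rule comp[OF N a(1)]) simp
      then show "N \<in> sup_tubes (sum ind Y)"
        unfolding sup_tubes_def using a h_le[OF a(1)] by blast
    qed
    show "sup_tubes (sum ind Y) \<subseteq> Y"
    proof
      fix M assume "M \<in> sup_tubes (sum ind Y)"
      then obtain c a where M: "M \<noteq> UNIV" "c \<le> sum ind Y $ a" "M = conn_comp Q {b. c \<le> sum ind Y $ b} a"
        by (auto simp: sup_tubes_def)
      \<comment> \<open>For a nonpositive threshold the superlevel set is \<open>UNIV\<close>. As
        the graph is connected, its only component would be the excluded set
        \<open>UNIV\<close>.\<close>
      have "c > 0"
      proof (rule ccontr)
        assume "\<not> c > 0"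
        then have "c \<le> sum ind Y $ b" for b
          unfolding sum_ind_nth by (meson not_less of_nat_0_le_iff order_trans)
        then have "{b. c \<le> sum ind Y $ b} = UNIV" by auto
        then have "M = UNIV" using tube_imp_conn_comp_eq[OF conn UNIV_I] M by simp
        then show False using M by simp
      qed
      define k where "k = nat \<lceil>c\<rceil>"
      have k: "k \<ge> 1" "real k - 1 < c" "c \<le> k"
        using \<open>c > 0\<close> unfolding k_def by linarith+
      have "real k - 1 < sum ind Y $ a" using M(2) k by linarith
      then have "real k \<le> sum ind Y $ a"
        unfolding sum_ind_nth by (simp add: less_Suc_eq_le[symmetric] del: less_Suc_eq_le)
      from ex[OF this k(1)] obtain N where N: "N \<in> Y" "a \<in> N" "h N = k" by auto
      then have "M = N" using comp[of N a c] k M by auto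
      then show "M \<in> Y" using N by simp
    qed
  qed
qed

text \<open>Every nested set is recovered as \<open>sup_tubes\<close> of the sum of its indicators,
  so the cones may be indexed by vectors. This is the form in which normal cones appear.\<close>

lemma nested_cones_eq:
  assumes "tube Q UNIV"
  shows "(\<lambda>Y. cone_ones (ind ` Y)) ` {Y. nested Y} = range (\<lambda>v. cone_ones (ind ` sup_tubes v))"
proof -
  have "{Y. nested Y} = range sup_tubes"
  proof
    show "{Y. nested Y} \<subseteq> range sup_tubes"
      using sup_tubes_sum_ind[OF _ assms] by (auto intro!: range_eqI[OF sym])
    show "range sup_tubes \<subseteq> {Y. nested Y}"
      using nested_sup_tubes by auto
  qed
  then show ?thesis by (simp add: image_image)
qed

section \<open>Normal fans of nestohedra\<close>

text \<open>The normal cone of the face of the nestohedron on which \<open>v\<close> is minimal,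
  written out for the simplices that are summed.\<close>

definition min_cone :: "real ^ 'm \<Rightarrow> (real ^ 'm) set" where
  "min_cone v = {v'. \<forall>B b. tube Q B \<longrightarrow> b \<in> B \<longrightarrow> (\<forall>b' \<in> B. v $ b \<le> v $ b') \<longrightarrow>
     (\<forall>b' \<in> B. v' $ b \<le> v' $ b')}"

text \<open>If the minimum of \<open>v\<close> over a tube is attained in a component of a
  superlevel set, then the whole tube lies in that component; so indicators of components belong to
  the cone. Conversely, every component for a \<open>v'\<close> in the cone is also a component for
  \<open>v\<close>, and \<open>in_cone_sup_tubes\<close> applies to \<open>v'\<close>.\<close>

lemma min_cone_eq:
  assumes conn: "tube Q UNIV"
  shows "min_cone v = cone_ones (ind ` sup_tubes v)"
proof
  show "cone_ones (ind ` sup_tubes v) \<subseteq> min_cone v"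
  proof (rule cone_ones_minimal)
    show "convex_cone (min_cone v)"
      unfolding convex_cone_iff min_cone_def
      by (auto intro!: add_mono mult_left_mono)
    show "c *\<^sub>R 1 \<in> min_cone v" for c by (simp add: min_cone_def)
    show "ind ` sup_tubes v \<subseteq> min_cone v"
    proof
      fix x assume "x \<in> ind ` sup_tubes v"
      then obtain c a where x: "x = ind (conn_comp Q {b. c \<le> v $ b} a)" and a: "c \<le> v $ a"
        by (auto simp: sup_tubes_def)
      let ?U = "{b. c \<le> v $ b}"
      show "x \<in> min_cone v"
        unfolding min_cone_def
      proof (clarify)
        fix B b b' assume *: "tube Q B" "b \<in> B" "\<forall>b'\<in>B. v $ b \<le> v $ b'" "b' \<in> B"
        show "x $ b \<le> x $ b'"
        proof (cases "b \<in> conn_comp Q ?U a")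
          case True
          then have "c \<le> v $ b" using conn_comp_subset[of a ?U Q] a by auto
          then have "B \<subseteq> ?U" using * by force
          then have "b' \<in> conn_comp Q ?U b" using tube_subset_conn_comp[of Q B ?U b] * by auto
          then show ?thesis using True conn_comp_eq by (auto simp: x)
        qed (simp add: x)
      qed
    qed
  qed
  show "min_cone v \<subseteq> cone_ones (ind ` sup_tubes v)"
  proof
    fix v' assume v': "v' \<in> min_cone v"
    have "sup_tubes v' \<subseteq> sup_tubes v"
    proof
      fix M assume "M \<in> sup_tubes v'"
      then obtain c a where M: "M \<noteq> UNIV" "c \<le> v' $ a" "M = conn_comp Q {b. c \<le> v' $ b} a"
        by (auto simp: sup_tubes_def)
      have tM: "tube Q M" using M tube_conn_comp by simp
      have Mc: "M \<subseteq> {b. c \<le> v' $ b}" unfolding M(3) using M(2) by (intro conn_comp_subset) simp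
      define c0 where "c0 = Min (($) v ` M)"
      have aM: "a \<in> M" using M by simp
      have "c0 \<in> ($) v ` M" unfolding c0_def using aM by (intro Min_in) auto
      then obtain b where b: "b \<in> M" "v $ b = c0" by auto
      have c0: "c0 \<le> v $ x" if "x \<in> M" for x unfolding c0_def using that by auto
      define N where "N = conn_comp Q {x. c0 \<le> v $ x} b"
      have MN: "M \<subseteq> N" unfolding N_def using tM c0 b by (intro tube_subset_conn_comp) auto
      have tN: "tube Q N" unfolding N_def by (rule tube_conn_comp)
      have Nc: "N \<subseteq> {x. c0 \<le> v $ x}" unfolding N_def using b by (intro conn_comp_subset) auto
      \<comment> \<open>As \<open>N\<close> lies in the superlevel set at \<open>c0\<close>, the
        element \<open>b\<close> minimizes \<open>v\<close> over all of \<open>N\<close>. The cone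
        condition transfers this to \<open>v'\<close>, and \<open>N\<close> stays above the
        threshold \<open>c\<close>.\<close>
      have "\<forall>x\<in>N. v' $ b \<le> v' $ x"
        using v' tN b MN Nc unfolding min_cone_def by fastforce
      then have "N \<subseteq> {x. c \<le> v' $ x}" using Mc b by force
      then have "N \<subseteq> M" unfolding M(3) using aM MN by (intro tube_subset_conn_comp tN) auto
      with MN have "M = N" by simp
      then show "M \<in> sup_tubes v" using M b by (auto simp: sup_tubes_def N_def)
    qed
    then show "v' \<in> cone_ones (ind ` sup_tubes v)"
      using in_cone_sup_tubes[of v'] cone_ones_mono[OF image_mono] by blast
  qed
qed

section \<open>Minimal faces of a sum of simplices\<close>

lemma hull_axis_coords:
  fixes x :: "real ^ 'm"
  assumes "x \<in> convex hull ((\<lambda>b. axis b (1::real)) ` B)"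
  shows "0 \<le> x $ b" and "b \<notin> B \<Longrightarrow> x $ b = 0" and "(\<Sum>b\<in>UNIV. x $ b) = 1"
proof -
  let ?H = "{x :: real ^ 'm. (\<forall>b. 0 \<le> x $ b) \<and> (\<forall>b. b \<notin> B \<longrightarrow> x $ b = 0) \<and> (\<Sum>b\<in>UNIV. x $ b) = 1}"
  have "convex ?H"
  proof (rule convexI)
    fix x y and u v :: real
    assume "x \<in> ?H" "y \<in> ?H" "0 \<le> u" "0 \<le> v" "u + v = 1"
    then show "u *\<^sub>R x + v *\<^sub>R y \<in> ?H"
      by (simp add: sum.distrib sum_distrib_left[symmetric])
  qed
  moreover have "axis b 1 \<in> ?H" if "b \<in> B" for b using that by (auto simp: axis_def)
  ultimately have "convex hull ((\<lambda>b. axis b 1) ` B) \<subseteq> ?H" by (intro hull_minimal) auto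
  then show "0 \<le> x $ b" "b \<notin> B \<Longrightarrow> x $ b = 0" "(\<Sum>b\<in>UNIV. x $ b) = 1" using assms by auto
qed

lemma inner_minus_const:
  fixes x v :: "real ^ 'm"
  assumes "(\<Sum>b\<in>UNIV. x $ b) = 1"
  shows "v \<bullet> x - m = (\<Sum>b\<in>UNIV. (v $ b - m) * x $ b)"
  using assms by (simp add: inner_vec_def left_diff_distrib sum_subtractf sum_distrib_left[symmetric])

text \<open>\<open>v \<bullet> x - m\<close> is a sum of nonnegative terms
  \<open>(v $ b - m) * x $ b\<close>. If it vanishes, then \<open>x\<close> is supported where
  \<open>v\<close> equals \<open>m\<close>.\<close>

lemma hull_axis_min:
  fixes v v' :: "real ^ 'm"
  assumes x: "x \<in> convex hull ((\<lambda>b. axis b 1) ` B)" and m: "\<And>b. b \<in> B \<Longrightarrow> m \<le> v $ b"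
  shows "m \<le> v \<bullet> x"
    and "v \<bullet> x = m \<Longrightarrow> (\<And>b. b \<in> B \<Longrightarrow> v $ b = m \<Longrightarrow> v' $ b = m') \<Longrightarrow> v' \<bullet> x = m'"
proof -
  note X = hull_axis_coords[OF x]
  have nn: "0 \<le> (v $ b - m) * x $ b" for b
    using m[of b] X(1,2)[of b] by (cases "b \<in> B") auto
  show "m \<le> v \<bullet> x"
    using inner_minus_const[OF X(3), of v m] sum_nonneg[of UNIV "\<lambda>b. (v $ b - m) * x $ b"] nn by simp
  assume "v \<bullet> x = m" and v': "\<And>b. b \<in> B \<Longrightarrow> v $ b = m \<Longrightarrow> v' $ b = m'"
  then have "(\<Sum>b\<in>UNIV. (v $ b - m) * x $ b) = 0" using inner_minus_const[OF X(3), of v m] by simp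
  then have z: "(v $ b - m) * x $ b = 0" for b
    using nn sum_nonneg_eq_0_iff[of UNIV "\<lambda>b. (v $ b - m) * x $ b"] by simp
  have "(v' $ b - m') * x $ b = 0" for b
    using z[of b] v'[of b] X(2)[of b] by (cases "b \<in> B") auto
  then have "(\<Sum>b\<in>UNIV. (v' $ b - m') * x $ b) = 0" by (simp only: sum.neutral_const)
  then show "v' \<bullet> x = m'" using inner_minus_const[OF X(3), of v' m'] by simp
qed

abbreviation tubes :: "'m set set" where
  "tubes \<equiv> {B. tube Q B}"

lemma nestohedron_iff:
  "x \<in> nestohedron tubes \<longleftrightarrow>
    (\<exists>s. x = sum s tubes \<and> (\<forall>B \<in> tubes. s B \<in> convex hull ((\<lambda>b. axis b 1) ` B)))"
  unfolding nestohedron_def by (subst set_sum_alt) auto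

lemma polytope_nestohedron: "polytope (nestohedron tubes)"
proof -
  have "nestohedron tubes = convex hull (\<Sum>B\<in>tubes. (\<lambda>b. axis b 1) ` B)"
    unfolding nestohedron_def by (simp add: convex_hull_set_sum)
  moreover have "finite (\<Sum>B\<in>tubes. (\<lambda>b. axis b (1::real)) ` B)"
    by (intro finite_set_sum) auto
  ultimately show ?thesis using polytope_convex_hull by metis
qed

definition min_face :: "real ^ 'm \<Rightarrow> (real ^ 'm) set" where
  "min_face v = {x \<in> nestohedron tubes. \<forall>y \<in> nestohedron tubes. v \<bullet> x \<le> v \<bullet> y}"

definition min_on :: "real ^ 'm \<Rightarrow> 'm set \<Rightarrow> real" where
  "min_on v B = Min (($) v ` B)"

lemma min_on_le: "b \<in> B \<Longrightarrow> min_on v B \<le> v $ b"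
  by (simp add: min_on_def)

lemma min_on_attained:
  assumes "B \<in> tubes"
  obtains b where "b \<in> B" "v $ b = min_on v B"
proof -
  have "B \<noteq> {}" using assms by (auto simp: tube_def)
  then have "min_on v B \<in> ($) v ` B" unfolding min_on_def by (intro Min_in) auto
  then show ?thesis using that by auto
qed

lemma nestohedron_ge: "y \<in> nestohedron tubes \<Longrightarrow> (\<Sum>B\<in>tubes. min_on v B) \<le> v \<bullet> y"
proof -
  assume "y \<in> nestohedron tubes"
  then obtain s where s: "y = sum s tubes" "\<And>B. B \<in> tubes \<Longrightarrow> s B \<in> convex hull ((\<lambda>b. axis b 1) ` B)"
    unfolding nestohedron_iff by blast
  have "(\<Sum>B\<in>tubes. min_on v B) \<le> (\<Sum>B\<in>tubes. v \<bullet> s B)"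
    using hull_axis_min(1)[OF s(2) min_on_le] by (rule sum_mono)
  then show ?thesis by (simp add: s(1) inner_sum_right)
qed

lemma sum_axis_in_nestohedron:
  "(\<And>B. B \<in> tubes \<Longrightarrow> f B \<in> B) \<Longrightarrow> (\<Sum>B\<in>tubes. axis (f B) 1) \<in> nestohedron tubes"
  unfolding nestohedron_iff by (intro exI[of _ "\<lambda>B. axis (f B) 1"]) (auto intro!: hull_inc)

lemma inner_sum_axis: "v \<bullet> (\<Sum>B\<in>\<T>. axis (f B) 1) = (\<Sum>B\<in>\<T>. v $ f B)"
  for v :: "real ^ 'm"
  by (simp add: inner_sum_right inner_axis)

text \<open>Minimizing over a Minkowski sum splits into the summands: one minimizing vertex from
  each simplex attains the sum of the minima.\<close>

lemma min_face_eq: "min_face v = nestohedron tubes \<inter> {x. v \<bullet> x = (\<Sum>B\<in>tubes. min_on v B)}"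
  and min_face_nonempty: "min_face v \<noteq> {}"
proof -
  have "\<forall>B. \<exists>b. B \<in> tubes \<longrightarrow> b \<in> B \<and> v $ b = min_on v B" using min_on_attained by metis
  then obtain f where f: "\<And>B. B \<in> tubes \<Longrightarrow> f B \<in> B" "\<And>B. B \<in> tubes \<Longrightarrow> v $ f B = min_on v B" by metis
  let ?x = "\<Sum>B\<in>tubes. axis (f B) 1"
  have x: "?x \<in> nestohedron tubes" "v \<bullet> ?x = (\<Sum>B\<in>tubes. min_on v B)"
    using sum_axis_in_nestohedron[of f] f by (auto simp: inner_sum_axis)
  show "min_face v = nestohedron tubes \<inter> {x. v \<bullet> x = (\<Sum>B\<in>tubes. min_on v B)}"
    using x nestohedron_ge[of _ v] unfolding min_face_def by (fastforce intro: antisym)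
  then show "min_face v \<noteq> {}" using x by blast
qed

text \<open>A point of the minimal face decomposes into points of the minimal faces of the
  simplices, on which a \<open>v'\<close> of the cone is also minimal. For the converse a single
  summand is varied.\<close>

lemma normal_cone_min_face: "{v'. \<forall>x \<in> min_face v. \<forall>y \<in> nestohedron tubes. v' \<bullet> x \<le> v' \<bullet> y} = min_cone v"
proof (intro equalityI subsetI)
  fix v' assume v': "v' \<in> min_cone v"
  have "v' \<bullet> x \<le> v' \<bullet> y" if x: "x \<in> min_face v" and y: "y \<in> nestohedron tubes" for x y
  proof -
    obtain s where s: "x = sum s tubes" "\<And>B. B \<in> tubes \<Longrightarrow> s B \<in> convex hull ((\<lambda>b. axis b 1) ` B)"
      using x unfolding min_face_def nestohedron_iff by blast
    have ge: "min_on v B \<le> v \<bullet> s B" if "B \<in> tubes" for B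
      using hull_axis_min(1)[OF s(2)[OF that] min_on_le] .
    have "(\<Sum>B\<in>tubes. v \<bullet> s B) = (\<Sum>B\<in>tubes. min_on v B)"
      using x s(1) unfolding min_face_eq by (simp add: inner_sum_right)
    then have "(\<Sum>B\<in>tubes. v \<bullet> s B - min_on v B) = 0" by (simp add: sum_subtractf)
    then have eq: "v \<bullet> s B = min_on v B" if "B \<in> tubes" for B
      using that ge sum_nonneg_eq_0_iff[of tubes "\<lambda>B. v \<bullet> s B - min_on v B"] by simp
    have "v' \<bullet> s B = min_on v' B" if B: "B \<in> tubes" for B
    proof (rule hull_axis_min(2)[OF s(2)[OF B] min_on_le eq[OF B]])
      fix b assume b: "b \<in> B" "v $ b = min_on v B"
      then have "\<forall>b'\<in>B. v' $ b \<le> v' $ b'" using v' B min_on_le unfolding min_cone_def by auto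
      then have "v' $ b \<le> min_on v' B" using min_on_attained[OF B] by metis
      then show "v' $ b = min_on v' B" using min_on_le[OF b(1), of v'] by simp
    qed
    then have "v' \<bullet> x = (\<Sum>B\<in>tubes. min_on v' B)" by (simp add: s(1) inner_sum_right)
    then show ?thesis using nestohedron_ge[OF y] by simp
  qed
  then show "v' \<in> {v'. \<forall>x \<in> min_face v. \<forall>y \<in> nestohedron tubes. v' \<bullet> x \<le> v' \<bullet> y}" by blast
next
  fix v' assume "v' \<in> {v'. \<forall>x \<in> min_face v. \<forall>y \<in> nestohedron tubes. v' \<bullet> x \<le> v' \<bullet> y}"
  then have v': "\<And>x y. x \<in> min_face v \<Longrightarrow> y \<in> nestohedron tubes \<Longrightarrow> v' \<bullet> x \<le> v' \<bullet> y" by blast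
  show "v' \<in> min_cone v"
    unfolding min_cone_def
  proof clarify
    fix B b b' assume B: "tube Q B" and b: "b \<in> B" "\<forall>b'\<in>B. v $ b \<le> v $ b'" and b': "b' \<in> B"
    have "\<forall>D. \<exists>d. D \<in> tubes \<longrightarrow> d \<in> D \<and> v $ d = min_on v D" using min_on_attained by metis
    then obtain f where f: "\<And>D. D \<in> tubes \<Longrightarrow> f D \<in> D" "\<And>D. D \<in> tubes \<Longrightarrow> v $ f D = min_on v D" by metis
    have "v $ b = min_on v B"
      using min_on_attained[of B v] B b min_on_le[OF b(1), of v] by (metis antisym mem_Collect_eq)
    then have fb: "v $ (f(B := b)) D = min_on v D" "(f(B := b)) D \<in> D" if "D \<in> tubes" for D
      using f that b(1) by auto
    \<comment> \<open>These two points differ only in the summand of \<open>B\<close>, so comparing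
      them under \<open>v'\<close> isolates the values at \<open>b\<close> and
      \<open>b'\<close>.\<close>
    let ?x = "\<Sum>D\<in>tubes. axis ((f(B := b)) D) 1"
    let ?y = "\<Sum>D\<in>tubes. axis ((f(B := b')) D) 1"
    have "?x \<in> min_face v"
      unfolding min_face_eq using sum_axis_in_nestohedron[of "f(B := b)"] fb
      by (simp add: inner_sum_axis del: fun_upd_apply)
    moreover have "?y \<in> nestohedron tubes"
      using f b' by (intro sum_axis_in_nestohedron) auto
    ultimately have "v' \<bullet> ?x \<le> v' \<bullet> ?y" by (rule v')
    then have "(\<Sum>D\<in>tubes. v' $ (f(B := b)) D) \<le> (\<Sum>D\<in>tubes. v' $ (f(B := b')) D)"
      unfolding inner_sum_axis .
    moreover have "(\<Sum>D\<in>tubes. v' $ (f(B := c)) D) = v' $ c + (\<Sum>D\<in>tubes - {B}. v' $ f D)" for c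
    proof -
      have "(\<Sum>D\<in>tubes. v' $ (f(B := c)) D) = v' $ (f(B := c)) B + (\<Sum>D\<in>tubes - {B}. v' $ (f(B := c)) D)"
        using B by (intro sum.remove) auto
      also have "(\<Sum>D\<in>tubes - {B}. v' $ (f(B := c)) D) = (\<Sum>D\<in>tubes - {B}. v' $ f D)"
        by (intro sum.cong) auto
      finally show ?thesis by simp
    qed
    ultimately show "v' $ b \<le> v' $ b'" by simp
  qed
qed

lemma normal_fan_nestohedron: "normal_fan (nestohedron tubes) = range min_cone"
proof -
  have "{F. F face_of nestohedron tubes \<and> F \<noteq> {}} = range min_face"
  proof (intro equalityI subsetI)
    fix F assume "F \<in> {F. F face_of nestohedron tubes \<and> F \<noteq> {}}"
    then have F: "F exposed_face_of nestohedron tubes" "F \<noteq> {}"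
      using exposed_face_of_polyhedron[OF polytope_imp_polyhedron[OF polytope_nestohedron]] by auto
    then obtain a c where ac: "nestohedron tubes \<subseteq> {x. a \<bullet> x \<le> c}" "F = nestohedron tubes \<inter> {x. a \<bullet> x = c}"
      unfolding exposed_face_of_def by blast
    obtain x0 where x0: "x0 \<in> nestohedron tubes" "a \<bullet> x0 = c" using F(2) ac(2) by blast
    \<comment> \<open>An exposed face maximizes its functional, whereas normal cones are defined
      here by minimization; hence the sign.\<close>
    have "F = min_face (- a)"
    proof (intro equalityI subsetI)
      fix x assume "x \<in> F"
      then show "x \<in> min_face (- a)" using ac by (auto simp: min_face_def)
    next
      fix x assume "x \<in> min_face (- a)"
      then have "x \<in> nestohedron tubes" "a \<bullet> x0 \<le> a \<bullet> x" using x0 by (auto simp: min_face_def)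
      then show "x \<in> F" using ac x0 by force
    qed
    then show "F \<in> range min_face" by blast
  next
    fix F assume "F \<in> range min_face"
    then obtain v where "F = min_face v" by blast
    moreover have "min_face v face_of nestohedron tubes"
      unfolding min_face_eq using nestohedron_ge polytope_imp_convex[OF polytope_nestohedron]
      by (intro face_of_Int_supporting_hyperplane_ge) auto
    ultimately show "F \<in> {F. F face_of nestohedron tubes \<and> F \<noteq> {}}" using min_face_nonempty by simp
  qed
  then show ?thesis unfolding normal_fan_def using normal_cone_min_face by (simp add: image_image)
qed

end

section \<open>Concentrated trees\<close>

locale conc_tree =
  fixes T :: "'v tree"
  assumes plane: "plane_tree T" and conc: "concentrated T"
begin

section \<open>Depths, levels and the vertices with children\<close>

lemma finite_verts [simp]: "finite (verts T)"
  and root_in [simp]: "troot T \<in> verts T"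
  and parent_in: "v \<in> verts T \<Longrightarrow> v \<noteq> troot T \<Longrightarrow> parent T v \<in> verts T"
  and reaches_root: "v \<in> verts T \<Longrightarrow> \<exists>j. (parent T ^^ j) v = troot T"
  and sib_subset: "sib T \<subseteq> (\<Union>u \<in> verts T. ch T u \<times> ch T u)"
  and sib_linear: "u \<in> verts T \<Longrightarrow> strict_linear_order_on (ch T u) (sib T \<inter> ch T u \<times> ch T u)"
  using plane unfolding plane_tree_def by blast+

lemma vdepth_eq_0_iff: "v \<in> verts T \<Longrightarrow> vdepth T v = 0 \<longleftrightarrow> v = troot T"
proof -
  assume "v \<in> verts T"
  then have "(parent T ^^ vdepth T v) v = troot T"
    unfolding vdepth_def using reaches_root by (metis (mono_tags, lifting) LeastI_ex)
  moreover have "vdepth T (troot T) = 0"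
    unfolding vdepth_def by (rule Least_eq_0) simp
  ultimately show ?thesis by (metis funpow_0)
qed

lemma vdepth_parent:
  assumes "v \<in> verts T" "v \<noteq> troot T"
  shows "vdepth T v = Suc (vdepth T (parent T v))"
proof -
  obtain j where "(parent T ^^ j) v = troot T" using reaches_root assms by blast
  then have "(LEAST j. (parent T ^^ j) v = troot T) =
      Suc (LEAST j. (parent T ^^ Suc j) v = troot T)"
    using assms(2) by (intro Least_Suc) auto
  then show ?thesis by (simp add: vdepth_def funpow_swap1)
qed

lemma level_iff: "v \<in> level T k \<longleftrightarrow> v \<in> verts T \<and> vdepth T v = k"
  by (simp add: level_def)

lemma level_subset: "level T k \<subseteq> verts T"
  by (auto simp: level_def)

lemma finite_level [simp]: "finite (level T k)"
  using finite_subset[OF level_subset] by simp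

lemma level_0: "level T 0 = {troot T}"
  using vdepth_eq_0_iff by (auto simp: level_iff)

lemma parent_in_level: "v \<in> level T (Suc k) \<Longrightarrow> parent T v \<in> level T k"
proof -
  assume v: "v \<in> level T (Suc k)"
  then have "v \<in> verts T" "v \<noteq> troot T" using vdepth_eq_0_iff[of v] by (auto simp: level_iff)
  then show ?thesis using v vdepth_parent parent_in by (simp add: level_iff)
qed

lemma funpow_parent_level: "v \<in> level T (j + k) \<Longrightarrow> (parent T ^^ j) v \<in> level T k"
  by (induction j arbitrary: v) (auto simp: funpow_swap1 dest: parent_in_level)

lemma finite_depths: "finite {k. level T k \<noteq> {}}"
proof -
  have "{k. level T k \<noteq> {}} \<subseteq> vdepth T ` verts T" by (auto simp: level_iff)
  then show ?thesis by (rule finite_subset) simp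
qed

lemma vdepth_le: "v \<in> verts T \<Longrightarrow> vdepth T v \<le> tdepth T"
  unfolding tdepth_def using finite_depths by (intro Max_ge) (auto simp: level_iff)

lemma level_nonempty: "k \<le> tdepth T \<Longrightarrow> level T k \<noteq> {}"
proof -
  assume k: "k \<le> tdepth T"
  have "tdepth T \<in> {k. level T k \<noteq> {}}"
    unfolding tdepth_def using level_0 finite_depths by (intro Max_in) auto
  then obtain v where "v \<in> level T (tdepth T)" by auto
  then have "v \<in> level T ((tdepth T - k) + k)" using k by simp
  from funpow_parent_level[OF this] show ?thesis by blast
qed

text \<open>Meaningful only for \<open>k < tdepth T\<close>, where concentration gives existence and
  uniqueness; at the bottom level no vertex has children.\<close>

definition spine :: "nat \<Rightarrow> 'v" where
  "spine k = (THE u. u \<in> level T k \<and> ch T u \<noteq> {})"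

lemma spine:
  assumes "k < tdepth T"
  shows "spine k \<in> level T k" "u \<in> level T k \<Longrightarrow> ch T u \<noteq> {} \<Longrightarrow> u = spine k"
proof -
  have ex1: "\<exists>!u. u \<in> level T k \<and> ch T u \<noteq> {}"
    using conc assms by (simp add: concentrated_def)
  show "spine k \<in> level T k" using theI'[OF ex1] by (simp add: spine_def)
  show "u = spine k" if "u \<in> level T k" "ch T u \<noteq> {}"
    using the1_equality[OF ex1] that by (simp add: spine_def)
qed

lemma spine_verts: "k < tdepth T \<Longrightarrow> spine k \<in> verts T"
  and spine_depth: "k < tdepth T \<Longrightarrow> vdepth T (spine k) = k"
  using spine(1) by (auto simp: level_iff)

text \<open>The vertex has a child, so concentration leaves only one candidate. As a consequence
  every level below the root is one family of siblings, and its lexicographic order is given by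
  \<open>sib\<close>.\<close>

lemma parent_level: "v \<in> level T (Suc k) \<Longrightarrow> parent T v = spine k"
proof -
  assume v: "v \<in> level T (Suc k)"
  then have "v \<noteq> troot T" using vdepth_eq_0_iff[of v] by (auto simp: level_iff)
  then have "v \<in> ch T (parent T v)" using v by (auto simp: ch_def level_iff)
  moreover have "k < tdepth T" using v vdepth_le[of v] by (auto simp: level_iff)
  ultimately show ?thesis using spine(2)[of k "parent T v"] parent_in_level[OF v] by auto
qed

lemma ch_spine: "k < tdepth T \<Longrightarrow> ch T (spine k) = level T (Suc k)"
proof -
  assume k: "k < tdepth T"
  have "v \<in> level T (Suc k)" if "v \<in> ch T (spine k)" for v
    using that vdepth_parent[of v] spine_depth[OF k] by (auto simp: ch_def level_iff)
  moreover have "v \<in> ch T (spine k)" if "v \<in> level T (Suc k)" for v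
    using that parent_level[OF that] vdepth_eq_0_iff[of v] by (auto simp: ch_def level_iff)
  ultimately show ?thesis by blast
qed

lemma ch_other: "u \<in> verts T \<Longrightarrow> u \<noteq> spine (vdepth T u) \<or> vdepth T u = tdepth T \<Longrightarrow> ch T u = {}"
proof (rule ccontr)
  assume u: "u \<in> verts T" "u \<noteq> spine (vdepth T u) \<or> vdepth T u = tdepth T" "ch T u \<noteq> {}"
  then obtain v where v: "v \<in> verts T" "v \<noteq> troot T" "parent T v = u" by (auto simp: ch_def)
  then have "vdepth T v = Suc (vdepth T u)" using vdepth_parent by blast
  then show False
    using u v vdepth_le[of v] spine(2)[of "vdepth T u" u] by (auto simp: level_iff)
qed

lemma funpow_parent:
  assumes "v \<in> verts T" "i < vdepth T v"
  shows "(parent T ^^ (vdepth T v - i)) v = spine i"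
proof -
  obtain j where j: "vdepth T v - i = Suc j" using assms by (metis Suc_diff_Suc)
  then have "v \<in> level T (j + Suc i)" using assms by (auto simp: level_iff)
  then have "(parent T ^^ j) v \<in> level T (Suc i)" by (rule funpow_parent_level)
  then show ?thesis using parent_level j by simp
qed

lemma path_to_eq: "v \<in> verts T \<Longrightarrow> path_to T v = map spine [0..<vdepth T v] @ [v]"
  unfolding path_to_def using funpow_parent by auto

lemma length_path_to [simp]: "length (path_to T v) = Suc (vdepth T v)"
  by (simp add: path_to_def)

lemma path_to_nth_in: "v \<in> verts T \<Longrightarrow> i \<le> vdepth T v \<Longrightarrow> path_to T v ! i \<in> level T i"
  using spine(1)[of i] vdepth_le[of v] by (auto simp: path_to_eq nth_append level_iff)

lemma weak_desc_iff:
  "weak_desc T v u \<longleftrightarrow> v \<in> verts T \<and> (u = v \<or> (\<exists>i < vdepth T v. u = spine i))"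
proof -
  have "u \<in> set (map spine [0..<k] @ [v]) \<longleftrightarrow> u = v \<or> (\<exists>i < k. u = spine i)" for k
    by (auto simp: image_iff)
  then show ?thesis unfolding weak_desc_def using path_to_eq by metis
qed

lemma path_to_spine: "k < tdepth T \<Longrightarrow> path_to T (spine k) = map spine [0..<Suc k]"
  using spine_verts spine_depth by (simp add: path_to_eq)

lemma butlast_path_to:
  "v \<in> level T (Suc k) \<Longrightarrow> butlast (path_to T v) = path_to T (spine k)"
  using vdepth_le[of v] by (simp add: level_iff path_to_eq[of v] path_to_spine butlast_append)

lemma take_path_to:
  assumes "v \<in> verts T" "k < vdepth T v"
  shows "take (Suc k) (path_to T v) = path_to T (spine k)"
  using assms vdepth_le[of v] by (simp add: path_to_eq[of v] path_to_spine take_map)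

lemma weak_desc_refl: "v \<in> verts T \<Longrightarrow> weak_desc T v v"
  and weak_desc_spine: "v \<in> verts T \<Longrightarrow> i < vdepth T v \<Longrightarrow> weak_desc T v (spine i)"
  unfolding weak_desc_iff by blast+

lemma weak_descE:
  assumes "weak_desc T v u"
  obtains "v \<in> verts T" "u = v"
  | i where "v \<in> verts T" "i < vdepth T v" "u = spine i" "i < tdepth T"
            "u \<in> verts T" "vdepth T u = i"
proof (cases "u = v")
  case False
  then obtain i where i: "i < vdepth T v" "u = spine i" "v \<in> verts T"
    using assms unfolding weak_desc_iff by blast
  then have "i < tdepth T" using vdepth_le[of v] by simp
  with i show ?thesis using that(2)[of i] spine_depth spine_verts by simp
qed (use assms that(1) in \<open>simp add: weak_desc_iff\<close>)

lemma weak_desc_trans: "weak_desc T x y \<Longrightarrow> weak_desc T y z \<Longrightarrow> weak_desc T x z"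
  by (erule weak_descE; erule weak_descE) (simp_all add: weak_desc_refl weak_desc_spine)

text \<open>Both \<open>y\<close> and \<open>z\<close> lie on the path from the root to
  \<open>x\<close>. This comparability of ancestors is what links gaps along a path in
  \<open>gap_adj\<close>.\<close>

lemma weak_desc_linear:
  assumes xy: "weak_desc T x y" and xz: "weak_desc T x z" and le: "vdepth T y \<le> vdepth T z"
  shows "weak_desc T z y"
  using xz
proof (cases rule: weak_descE)
  case (2 i)
  from xy show ?thesis
  proof (cases rule: weak_descE)
    case (2 j)
    then show ?thesis
      using \<open>z \<in> verts T\<close> \<open>vdepth T z = i\<close> \<open>z = spine i\<close> le weak_desc_refl weak_desc_spine
      by (cases "j = i") simp_all
  qed (use 2 le in simp)
qed (use xy in simp)

lemma weak_desc_vdepth: "weak_desc T x y \<Longrightarrow> vdepth T y \<le> vdepth T x"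
  by (erule weak_descE) simp_all

lemma weak_desc_in: "weak_desc T x y \<Longrightarrow> x \<in> verts T" "weak_desc T x y \<Longrightarrow> y \<in> verts T"
  by (erule weak_descE; simp)+

subsection \<open>Positions\<close>

lemma sib_in_level:
  assumes "(u, v) \<in> sib T"
  obtains k where "u \<in> level T (Suc k)" "v \<in> level T (Suc k)" "k < tdepth T"
proof -
  obtain x where x: "x \<in> verts T" "u \<in> ch T x" "v \<in> ch T x" using sib_subset assms by blast
  then have "x = spine (vdepth T x)" "vdepth T x \<noteq> tdepth T" using ch_other[of x] by auto
  then have "vdepth T x < tdepth T" "ch T x = level T (Suc (vdepth T x))"
    using ch_spine[of "vdepth T x"] vdepth_le[OF x(1)] by auto
  with x show ?thesis using that by auto
qed

lemma sib_order:
  "irrefl (sib T)"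
  "(u, v) \<in> sib T \<Longrightarrow> (v, x) \<in> sib T \<Longrightarrow> (u, x) \<in> sib T"
  "u \<in> level T (Suc k) \<Longrightarrow> v \<in> level T (Suc k) \<Longrightarrow> u \<noteq> v \<Longrightarrow> (u, v) \<in> sib T \<or> (v, u) \<in> sib T"
proof -
  have lin: "strict_linear_order_on (level T (Suc k)) (sib T \<inter> level T (Suc k) \<times> level T (Suc k))"
    if "k < tdepth T" for k
    using sib_linear[OF spine_verts[OF that]] ch_spine[OF that] by simp
  show "irrefl (sib T)"
  proof (rule irreflI)
    fix u show "(u, u) \<notin> sib T"
    proof
      assume "(u, u) \<in> sib T"
      then obtain k where "u \<in> level T (Suc k)" "k < tdepth T" using sib_in_level by blast
      then show False using lin[of k] \<open>(u, u) \<in> sib T\<close>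
        by (auto simp: strict_linear_order_on_def irrefl_def)
    qed
  qed
  show "(u, x) \<in> sib T" if uv: "(u, v) \<in> sib T" and vx: "(v, x) \<in> sib T"
  proof -
    obtain k where k: "u \<in> level T (Suc k)" "v \<in> level T (Suc k)" "k < tdepth T"
      using sib_in_level[OF uv] .
    obtain k' where "v \<in> level T (Suc k')" "x \<in> level T (Suc k')"
      using sib_in_level[OF vx] .
    then have "x \<in> level T (Suc k)" using k by (auto simp: level_iff)
    then show ?thesis using lin[OF k(3)] k uv vx
      unfolding strict_linear_order_on_def trans_def by blast
  qed
  show "(u, v) \<in> sib T \<or> (v, u) \<in> sib T"
    if "u \<in> level T (Suc k)" "v \<in> level T (Suc k)" "u \<noteq> v"
  proof -
    have "k < tdepth T" using that vdepth_le[of u] by (auto simp: level_iff)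
    from lin[OF this] that show ?thesis
      by (auto simp: strict_linear_order_on_def total_on_def)
  qed
qed

text \<open>Paths to two vertices of one level agree except in their last entries, so
  \<open>lexord\<close> compares only these.\<close>

lemma pos_eq:
  assumes "v \<in> level T k"
  shows "pos T v = card {u \<in> level T k. (u, v) \<in> sib T} + 1"
proof -
  have "(path_to T u, path_to T v) \<in> lexord (sib T) \<longleftrightarrow> (u, v) \<in> sib T" if "u \<in> level T k" for u
    using that assms sib_order(1)
    by (auto simp: level_iff path_to_eq lexord_same_pref_iff irrefl_def)
  then show ?thesis
    using assms unfolding pos_def by (simp add: level_iff cong: conj_cong)
qed

lemma sib_iff_pos:
  assumes "u \<in> level T k" "v \<in> level T k"
  shows "(u, v) \<in> sib T \<longleftrightarrow> pos T u < pos T v"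
proof -
  have less: "pos T u < pos T v" if "(u, v) \<in> sib T" "u \<in> level T k" "v \<in> level T k" for u v
  proof -
    have "{x \<in> level T k. (x, u) \<in> sib T} \<subset> {x \<in> level T k. (x, v) \<in> sib T}"
      using that sib_order(1,2) by (auto simp: irrefl_def)
    then show ?thesis
      using that by (simp add: pos_eq[of _ k] psubset_card_mono)
  qed
  show ?thesis
  proof (cases k)
    case 0
    then show ?thesis using assms level_0 sib_order(1) by (auto simp: irrefl_def)
  next
    case (Suc j)
    then show ?thesis using less[of u v] less[of v u] assms sib_order(3)[of u j v] by fastforce
  qed
qed

lemma inj_on_pos: "inj_on (pos T) (level T k)"
proof (rule inj_onI)
  fix u v assume uv: "u \<in> level T k" "v \<in> level T k" "pos T u = pos T v"
  show "u = v"
  proof (cases k)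
    case 0
    then show ?thesis using uv level_0 by auto
  next
    case (Suc j)
    then show ?thesis
      using uv sib_iff_pos[of u k v] sib_iff_pos[of v k u] sib_order(3)[of u j v] by auto
  qed
qed

lemma pos_image: "pos T ` level T k = {1..card (level T k)}"
proof -
  have "pos T ` level T k \<subseteq> {1..card (level T k)}"
  proof
    fix i assume "i \<in> pos T ` level T k"
    then obtain v where v: "v \<in> level T k" "i = pos T v" by auto
    have "{u \<in> level T k. (u, v) \<in> sib T} \<subset> level T k"
      using v sib_order(1) by (auto simp: irrefl_def)
    then have "card {u \<in> level T k. (u, v) \<in> sib T} < card (level T k)"
      by (intro psubset_card_mono) auto
    then show "i \<in> {1..card (level T k)}" using v by (simp add: pos_eq[of v k])
  qed
  moreover have "card (pos T ` level T k) = card {1..card (level T k)}"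
    using card_image[OF inj_on_pos] by simp
  ultimately show ?thesis by (intro card_subset_eq) auto
qed

lemma nth_vertex:
  assumes "1 \<le> i" "i \<le> card (level T k)"
  shows "nth_vertex T k i \<in> level T k" "pos T (nth_vertex T k i) = i"
proof -
  have "i \<in> pos T ` level T k" using assms pos_image by auto
  then have "\<exists>!v. v \<in> level T k \<and> pos T v = i"
    using inj_on_pos[of k] by (auto simp: inj_on_def)
  from theI'[OF this] show "nth_vertex T k i \<in> level T k" "pos T (nth_vertex T k i) = i"
    by (simp_all add: nth_vertex_def)
qed

lemma nth_vertex_eq: "v \<in> level T k \<Longrightarrow> nth_vertex T k (pos T v) = v"
  using nth_vertex[of "pos T v" k] inj_on_pos[of k] pos_image[of k]
  by (metis atLeastAtMost_iff imageI inj_onD)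

lemma pos_le: "v \<in> level T k \<Longrightarrow> 1 \<le> pos T v \<and> pos T v \<le> card (level T k)"
  using pos_image[of k] by auto

lemma consecutive_level:
  assumes "k < tdepth T"
  shows "consecutive T (spine k) S \<longleftrightarrow> S \<subseteq> level T (Suc k) \<and>
     (\<forall>x \<in> S. \<forall>z \<in> S. \<forall>y \<in> level T (Suc k). pos T x \<le> pos T y \<and> pos T y \<le> pos T z \<longrightarrow> y \<in> S)"
proof -
  have "y \<in> S" if "x \<in> S" "z \<in> S" "y \<in> level T (Suc k)" "pos T x \<le> pos T y" "pos T y \<le> pos T z"
    "consecutive T (spine k) S" for x y z
  proof -
    have "S \<subseteq> level T (Suc k)" using that(6) ch_spine[OF assms] by (simp add: consecutive_def)
    then have xz: "x \<in> level T (Suc k)" "z \<in> level T (Suc k)" using that by auto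
    show ?thesis
    proof (cases "y = x \<or> y = z")
      case False
      then have "pos T x < pos T y" "pos T y < pos T z"
        using that xz inj_on_pos[of "Suc k"] by (metis inj_onD le_neq_implies_less)+
      then show ?thesis
        using that xz sib_iff_pos ch_spine[OF assms] unfolding consecutive_def by metis
    qed (use that in auto)
  qed
  then show ?thesis
    using sib_iff_pos[of _ "Suc k"] ch_spine[OF assms] unfolding consecutive_def
    by (smt (verit, ccfv_SIG) order_less_imp_le subset_iff)
qed

end

section \<open>Gaps, blocks and brackets\<close>

locale gap_tree = conc_tree T for T :: "'v tree" +
  fixes idx :: "'m::finite \<Rightarrow> nat \<times> nat"
  assumes bij_idx: "bij_betw idx UNIV (coords T)"
begin

text \<open>The index \<open>a\<close> stands for the gap between the vertices \<open>lft a\<close> and \<open>rgt a\<close> of level \<open>lev a\<close>.\<close>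

definition lev :: "'m \<Rightarrow> nat" where "lev a = fst (idx a)"
definition lft :: "'m \<Rightarrow> 'v" where "lft a = nth_vertex T (lev a) (snd (idx a))"
definition rgt :: "'m \<Rightarrow> 'v" where "rgt a = nth_vertex T (lev a) (snd (idx a) + 1)"

lemma gap_ends:
  shows lft_level: "lft a \<in> level T (lev a)" and rgt_level: "rgt a \<in> level T (lev a)"
    and pos_rgt: "pos T (rgt a) = Suc (pos T (lft a))"
    and lev_ge: "1 \<le> lev a" and lev_le: "lev a \<le> tdepth T"
    and pos_lft: "pos T (lft a) = snd (idx a)"
proof -
  have "idx a \<in> coords T" using bij_idx by (auto simp: bij_betw_def)
  then have *: "1 \<le> lev a" "lev a \<le> tdepth T" "1 \<le> snd (idx a)" "snd (idx a) \<le> card (level T (lev a)) - 1"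
    by (auto simp: coords_def lev_def)
  then show "1 \<le> lev a" "lev a \<le> tdepth T" by auto
  have "snd (idx a) + 1 \<le> card (level T (lev a))" using * by linarith
  with * show "lft a \<in> level T (lev a)" "rgt a \<in> level T (lev a)"
    "pos T (rgt a) = Suc (pos T (lft a))" "pos T (lft a) = snd (idx a)"
    unfolding lft_def rgt_def by (simp_all add: nth_vertex)
qed

lemma lft_verts: "lft a \<in> verts T" and rgt_verts: "rgt a \<in> verts T"
  and vdepth_lft: "vdepth T (lft a) = lev a" and vdepth_rgt: "vdepth T (rgt a) = lev a"
  using lft_level rgt_level by (auto simp: level_iff)

lemma lft_neq_rgt: "lft a \<noteq> rgt a"
  using pos_rgt[of a] by auto

lemma gap_eqI: "lev a = lev b \<Longrightarrow> pos T (lft a) = pos T (lft b) \<Longrightarrow> a = b"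
  using bij_idx by (auto simp: pos_lft lev_def bij_betw_def inj_on_def prod_eq_iff)

lemma gap_after:
  assumes "u \<in> level T k" "v \<in> level T k" "pos T u < pos T v"
  obtains a where "lev a = k" "lft a = u"
proof -
  have "card (level T 0) = 1" by (simp add: level_0)
  then have k: "k \<noteq> 0" using pos_le[OF assms(1)] pos_le[OF assms(2)] assms(3) by (cases k) auto
  have "k \<le> tdepth T" using assms(1) vdepth_le by (auto simp: level_iff)
  then have "(k, pos T u) \<in> coords T"
    using k pos_le[OF assms(1)] pos_le[OF assms(2)] assms(3) by (auto simp: coords_def)
  then obtain a where "idx a = (k, pos T u)" using bij_idx unfolding bij_betw_def by (metis imageE)
  then have "lev a = k" "lft a = u"
    using nth_vertex_eq[OF assms(1)] by (auto simp: lev_def lft_def)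
  then show ?thesis using that by blast
qed

lemma gap_before:
  assumes "u \<in> level T k" "v \<in> level T k" "pos T u < pos T v"
  obtains a where "lev a = k" "rgt a = v"
proof -
  have "pos T v - 1 \<in> pos T ` level T k"
    using pos_le[OF assms(1)] pos_le[OF assms(2)] assms(3) by (auto simp: pos_image)
  then obtain x where x: "x \<in> level T k" "pos T x = pos T v - 1" by auto
  then have "pos T x < pos T v" using assms(3) by simp
  then obtain a where a: "lev a = k" "lft a = x" using gap_after x(1) assms(2) by blast
  then have "pos T (rgt a) = pos T v" using pos_rgt[of a] x assms(3) by simp
  then have "rgt a = v" using inj_onD[OF inj_on_pos] rgt_level[of a] a assms(2) by metis
  with a show ?thesis using that by blast
qed

section \<open>Blocks of a set of gaps\<close>

text \<open>A gap is located by the position of its left end, hence the bounds that are weak on one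
  side and strict on the other. Both orders of \<open>u\<close> and \<open>v\<close> are
  covered.\<close>

definition between :: "'v \<Rightarrow> 'v \<Rightarrow> 'm \<Rightarrow> bool" where
  "between u v a \<longleftrightarrow> lev a = vdepth T u \<and>
     (pos T u \<le> pos T (lft a) \<and> pos T (lft a) < pos T v \<or>
      pos T v \<le> pos T (lft a) \<and> pos T (lft a) < pos T u)"

text \<open>Speaking of the gaps crossed on the way from \<open>u\<close> to \<open>v\<close>,
  instead of generating an equivalence, makes monotonicity and compatibility with intersections
  immediate.\<close>

definition blk :: "'m set \<Rightarrow> 'v \<Rightarrow> 'v set" where
  "blk U u = {v \<in> level T (vdepth T u). \<forall>a. between u v a \<longrightarrow> a \<in> U}"

lemma self_in_blk [simp]: "u \<in> verts T \<Longrightarrow> u \<in> blk U u"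
  by (auto simp: blk_def level_iff between_def)

lemma blk_level: "blk U u \<subseteq> level T (vdepth T u)"
  by (auto simp: blk_def)

lemma blk_vdepth: "v \<in> blk U u \<Longrightarrow> vdepth T v = vdepth T u"
  and blk_verts: "v \<in> blk U u \<Longrightarrow> v \<in> verts T"
  by (auto simp: blk_def level_iff)

lemma blk_sym: "u \<in> verts T \<Longrightarrow> v \<in> blk U u \<Longrightarrow> u \<in> blk U v"
  by (auto simp: blk_def between_def level_iff)

lemma blk_trans: "v \<in> blk U u \<Longrightarrow> w \<in> blk U v \<Longrightarrow> w \<in> blk U u"
proof -
  assume *: "v \<in> blk U u" "w \<in> blk U v"
  have "between u v a \<or> between v w a" if "between u w a" for a
    using that *(1) unfolding between_def blk_def level_iff by auto
  then show "w \<in> blk U u" using * unfolding blk_def level_iff by auto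
qed

lemma blk_eq: "u \<in> verts T \<Longrightarrow> v \<in> blk U u \<Longrightarrow> blk U v = blk U u"
  using blk_sym blk_trans by blast

lemma blk_convex:
  assumes "x \<in> blk U u" "z \<in> blk U u" "y \<in> level T (vdepth T u)"
    "pos T x \<le> pos T y" "pos T y \<le> pos T z" "u \<in> verts T"
  shows "y \<in> blk U u"
proof -
  have z: "z \<in> blk U x" using blk_eq[OF assms(6,1)] assms(2) by simp
  have d: "vdepth T x = vdepth T u" using blk_vdepth[OF assms(1)] .
  have "between x z a" if "between x y a" for a
    using that assms(4,5) by (auto simp: between_def)
  then have "y \<in> blk U x"
    using assms(3) z d unfolding blk_def by simp
  then show ?thesis using blk_trans assms(1) by blast
qed

lemma blk_mono: "U \<subseteq> U' \<Longrightarrow> blk U u \<subseteq> blk U' u"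
  by (auto simp: blk_def)

lemma blk_Int: "blk (U \<inter> U') u = blk U u \<inter> blk U' u"
  by (auto simp: blk_def)

lemma blk_cong: "(\<And>a. lev a = vdepth T u \<Longrightarrow> a \<in> U \<longleftrightarrow> a \<in> U') \<Longrightarrow> blk U u = blk U' u"
  by (auto simp: blk_def between_def)

lemma blk_UNIV: "blk UNIV u = level T (vdepth T u)"
  by (auto simp: blk_def)

lemma rgt_in_blk_lft: "rgt a \<in> blk U (lft a) \<longleftrightarrow> a \<in> U"
proof -
  have "between (lft a) (rgt a) b \<longleftrightarrow> b = a" for b
    using gap_eqI[of b a] by (auto simp: between_def vdepth_lft pos_rgt)
  then show ?thesis using rgt_level by (simp add: blk_def vdepth_lft)
qed

lemma gap_in_blk: "a \<in> U \<Longrightarrow> u \<in> verts T \<Longrightarrow> lft a \<in> blk U u \<longleftrightarrow> rgt a \<in> blk U u"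
  by (metis blk_eq blk_sym lft_verts rgt_in_blk_lft)

lemma gap_of_blk: "u \<in> verts T \<Longrightarrow> lft a \<in> blk U u \<Longrightarrow> rgt a \<in> blk U u \<Longrightarrow> a \<in> U"
  by (metis blk_eq rgt_in_blk_lft)

text \<open>Induction outwards from \<open>u\<close>: a block is exhausted by crossing closed gaps
  one at a time, and convexity keeps the intermediate vertices in the block.\<close>

lemma blk_subsetI:
  assumes u: "u \<in> verts T" "u \<in> S"
    and step: "\<And>a. a \<in> U \<Longrightarrow> lev a = vdepth T u \<Longrightarrow> lft a \<in> blk U u \<Longrightarrow> rgt a \<in> blk U u \<Longrightarrow>
      lft a \<in> S \<longleftrightarrow> rgt a \<in> S"
  shows "blk U u \<subseteq> S"
proof
  fix y assume "y \<in> blk U u"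
  then show "y \<in> S"
  \<comment> \<open>One of the two truncated differences is 0, so their sum is the distance between
    the positions.\<close>
  proof (induction "pos T u - pos T y + (pos T y - pos T u)" arbitrary: y rule: less_induct)
    case less
    have ul: "u \<in> level T (vdepth T u)" using u by (simp add: level_iff)
    have yl: "y \<in> level T (vdepth T u)" using less.prems blk_level by blast
    consider "pos T u = pos T y" | "pos T u < pos T y" | "pos T y < pos T u" by linarith
    then show ?case
    proof cases
      case 1
      then show ?thesis using u(2) inj_onD[OF inj_on_pos _ ul yl] by simp
    next
      case 2
      then obtain a where a: "lev a = vdepth T u" "rgt a = y" using gap_before[OF ul yl] by blast
      then have "pos T (lft a) < pos T y" "pos T u \<le> pos T (lft a)" using pos_rgt[of a] 2 by auto
      moreover have "lft a \<in> level T (vdepth T u)" using lft_level[of a] a by simp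
      ultimately have l: "lft a \<in> blk U u"
        using blk_convex[of u U u y "lft a"] less.prems u by simp
      then have "a \<in> U" using gap_of_blk u(1) less.prems a by simp
      moreover have "lft a \<in> S"
        using l \<open>pos T (lft a) < pos T y\<close> \<open>pos T u \<le> pos T (lft a)\<close> by (intro less.hyps) auto
      ultimately show ?thesis using step[of a] a l less.prems by simp
    next
      case 3
      then obtain a where a: "lev a = vdepth T u" "lft a = y" using gap_after[OF yl ul] by blast
      then have "pos T y < pos T (rgt a)" "pos T (rgt a) \<le> pos T u" using pos_rgt[of a] 3 by auto
      moreover have "rgt a \<in> level T (vdepth T u)" using rgt_level[of a] a by simp
      ultimately have l: "rgt a \<in> blk U u"
        using blk_convex[of y U u u "rgt a"] less.prems u by simp
      then have "a \<in> U" using gap_of_blk u(1) less.prems a by simp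
      moreover have "rgt a \<in> S"
        using l \<open>pos T y < pos T (rgt a)\<close> \<open>pos T (rgt a) \<le> pos T u\<close> by (intro less.hyps) auto
      ultimately show ?thesis using step[of a] a l less.prems by simp
    qed
  qed
qed

lemma blk_empty: "u \<in> verts T \<Longrightarrow> blk {} u = {u}"
  using blk_subsetI[of u "{u}" "{}"] by auto

lemma blk_eq_singleton_iff:
  "u \<in> verts T \<Longrightarrow> blk U u = {u} \<longleftrightarrow> (\<forall>a \<in> U. u \<noteq> lft a \<and> u \<noteq> rgt a)"
proof
  assume u: "u \<in> verts T" and "blk U u = {u}"
  then show "\<forall>a \<in> U. u \<noteq> lft a \<and> u \<noteq> rgt a"
    using gap_in_blk[OF _ u] lft_neq_rgt by (metis singletonD singletonI)
next
  assume u: "u \<in> verts T" and "\<forall>a \<in> U. u \<noteq> lft a \<and> u \<noteq> rgt a"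
  then show "blk U u = {u}"
    using blk_subsetI[of u "{u}" U] by auto
qed

definition convex_in :: "nat \<Rightarrow> 'v set \<Rightarrow> bool" where
  "convex_in k S \<longleftrightarrow> S \<subseteq> level T k \<and>
     (\<forall>x \<in> S. \<forall>z \<in> S. \<forall>y \<in> level T k. pos T x \<le> pos T y \<and> pos T y \<le> pos T z \<longrightarrow> y \<in> S)"

lemma convex_in_subset: "convex_in k S \<Longrightarrow> S \<subseteq> level T k"
  by (simp add: convex_in_def)

lemma convex_in_blk: "u \<in> verts T \<Longrightarrow> convex_in (vdepth T u) (blk U u)"
  unfolding convex_in_def using blk_level blk_convex by blast

lemma blk_eq_convexI:
  assumes S: "convex_in k S" "u \<in> S"
    and U: "\<And>a. lev a = k \<Longrightarrow> a \<in> U \<Longrightarrow> lft a \<in> S \<longleftrightarrow> rgt a \<in> S"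
      "\<And>a. lev a = k \<Longrightarrow> lft a \<in> S \<Longrightarrow> rgt a \<in> S \<Longrightarrow> a \<in> U"
  shows "blk U u = S"
proof
  have u: "u \<in> verts T" "vdepth T u = k"
    using convex_in_subset[OF S(1)] S(2) by (auto simp: level_iff)
  show "blk U u \<subseteq> S" using u S(2) U(1) by (intro blk_subsetI) auto
  show "S \<subseteq> blk U u"
  proof
    fix y assume y: "y \<in> S"
    then have yl: "y \<in> level T k" "u \<in> level T k"
      using convex_in_subset[OF S(1)] S(2) by auto
    have "a \<in> U" if "between u y a" for a
    proof -
      have *: "lev a = k" "lft a \<in> level T k" "rgt a \<in> level T k"
        using that u lft_level[of a] rgt_level[of a] by (auto simp: between_def)
      have cv: "z \<in> S" if "z \<in> level T k" "pos T u \<le> pos T z \<and> pos T z \<le> pos T y \<or>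
          pos T y \<le> pos T z \<and> pos T z \<le> pos T u" for z
        using S y that unfolding convex_in_def by blast
      have "lft a \<in> S \<and> rgt a \<in> S"
        using that pos_rgt[of a] unfolding between_def by (intro conjI cv *) auto
      then show ?thesis using U(2)[OF *(1)] by simp
    qed
    then show "y \<in> blk U u" using yl u by (simp add: blk_def)
  qed
qed

text \<open>By \<open>bracket_eq_br\<close> below, every bracket with \<open>u\<close> in its top level has this form.\<close>

definition br :: "'m set \<Rightarrow> 'v \<Rightarrow> 'v bracket" where
  "br U u = map (blk U) (path_to T u)"

lemma length_br [simp]: "length (br U u) = Suc (vdepth T u)"
  by (simp add: br_def)

lemma br_nth: "i \<le> vdepth T u \<Longrightarrow> br U u ! i = blk U (path_to T u ! i)"
  by (simp add: br_def)

lemma br_eq_snoc: "u \<in> verts T \<Longrightarrow> br U u = map (\<lambda>i. blk U (spine i)) [0..<vdepth T u] @ [blk U u]"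
  by (simp add: br_def path_to_eq)

lemma last_br [simp]: "u \<in> verts T \<Longrightarrow> last (br U u) = blk U u"
  by (simp add: br_eq_snoc)

lemma br_nth_spine: "u \<in> verts T \<Longrightarrow> i < vdepth T u \<Longrightarrow> br U u ! i = blk U (spine i)"
  by (simp add: br_eq_snoc nth_append)

lemma br_nth_top: "u \<in> verts T \<Longrightarrow> br U u ! vdepth T u = blk U u"
  by (simp add: br_eq_snoc nth_append)

lemma butlast_br: "u \<in> level T (Suc k) \<Longrightarrow> butlast (br U u) = br U (spine k)"
  by (simp add: br_def map_butlast[symmetric] butlast_path_to)

lemma take_br: "u \<in> verts T \<Longrightarrow> k < vdepth T u \<Longrightarrow> take (Suc k) (br U u) = br U (spine k)"
  by (simp add: br_def take_map take_path_to)

lemma br_empty: "u \<in> verts T \<Longrightarrow> br {} u = sing_br T u"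
  unfolding br_def sing_br_def using path_to_nth_in[of u] blk_empty
  by (intro nth_equalityI) (auto simp: level_iff)

lemma br_UNIV: "u \<in> verts T \<Longrightarrow> br UNIV u = max_br T (vdepth T u)"
  unfolding br_def max_br_def using path_to_nth_in[of u] blk_UNIV
  by (intro nth_equalityI) (auto simp: level_iff simp del: upt_Suc)

lemma bsub_iff: "bsub A A' \<longleftrightarrow> length A = length A' \<and> (\<forall>i < length A. A ! i \<subseteq> A' ! i)"
  by (auto simp: bsub_def list_all2_conv_all_nth)

lemma bsub_antisym: "bsub A A' \<Longrightarrow> bsub A' A \<Longrightarrow> A = A'"
  by (auto simp: bsub_iff intro!: nth_equalityI)

lemma bsub_refl: "bsub A A"
  by (auto simp: bsub_iff)

lemma bsub_last: "bsub A A' \<Longrightarrow> A \<noteq> [] \<Longrightarrow> last A \<subseteq> last A'"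
  unfolding bsub_iff by (cases "A' = []") (auto simp: last_conv_nth)

lemma bsub_butlast: "bsub A A' \<Longrightarrow> bsub (butlast A) (butlast A')"
  by (auto simp: bsub_iff nth_butlast)

lemma bsub_br_mono: "U \<subseteq> U' \<Longrightarrow> bsub (br U u) (br U' u)"
  using blk_mono by (auto simp: bsub_iff br_nth)

lemma br_cong:
  assumes "u \<in> verts T" "\<And>a. lev a \<le> vdepth T u \<Longrightarrow> a \<in> U \<longleftrightarrow> a \<in> U'"
  shows "br U u = br U' u"
proof (rule nth_equalityI)
  fix i assume "i < length (br U u)"
  then have i: "i \<le> vdepth T u" by simp
  then have "vdepth T (path_to T u ! i) = i" using path_to_nth_in[OF assms(1)] by (auto simp: level_iff)
  then have "blk U (path_to T u ! i) = blk U' (path_to T u ! i)" using i assms(2) by (intro blk_cong) auto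
  then show "br U u ! i = br U' u ! i" using i by (simp add: br_nth)
qed simp

lemma br_eq: "u \<in> verts T \<Longrightarrow> v \<in> blk U u \<Longrightarrow> br U v = br U u"
  using blk_vdepth[of v U u] blk_verts[of v U u] blk_eq[of u v U] by (simp add: br_eq_snoc)

lemma is_bracket_br:
  assumes u: "u \<in> verts T"
  shows "is_bracket T (vdepth T u) (br U u)"
  unfolding is_bracket_def
proof (intro conjI allI impI ballI)
  let ?k = "vdepth T u"
  show "?k \<le> tdepth T" using vdepth_le u .
  show "br U u ! i \<subseteq> level T i" if "i \<le> ?k" for i
    using that blk_level[of U "path_to T u ! i"] path_to_nth_in[OF u that]
    by (simp add: br_nth level_iff)
  show "br U u ! ?k \<noteq> {}" using self_in_blk[OF u, of U] u unfolding br_nth_top[OF u] by blast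
  have lv: "br U u ! i \<subseteq> level T i" if "i \<le> ?k" for i
    using that blk_level[of U "path_to T u ! i"] path_to_nth_in[OF u that]
    by (simp add: br_nth level_iff)
  fix i x assume i: "i < ?k"
  then have n: "i < tdepth T" using vdepth_le[OF u] by simp
  {
    assume "x \<in> br U u ! Suc i"
    then have "x \<in> level T (Suc i)" using lv[of "Suc i"] i by auto
    then show "parent T x \<in> br U u ! i"
      using parent_level i u spine_verts[OF n] by (simp add: br_nth_spine)
  next
    assume "x \<in> br U u ! i"
    then have x: "x \<in> level T i" using lv[of i] i by auto
    let ?y = "path_to T u ! Suc i"
    have "?y \<in> level T (Suc i)" using path_to_nth_in[OF u, of "Suc i"] i by simp
    then have "convex_in (Suc i) (br U u ! Suc i)"
      using convex_in_blk[of ?y U] i by (simp add: br_nth level_iff)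
    then have "consecutive T (spine i) (br U u ! Suc i)"
      unfolding consecutive_level[OF n] convex_in_def .
    moreover have "br U u ! Suc i \<subseteq> level T (Suc i)" using lv i by simp
    ultimately have cs: "consecutive T (spine i) (br U u ! Suc i)" "br U u ! Suc i \<subseteq> level T (Suc i)" .
    show "consecutive T x (br U u ! Suc i \<inter> ch T x)"
    proof (cases "x = spine i")
      case True
      then show ?thesis using cs ch_spine[OF n] by (simp add: inf_absorb1)
    next
      case False
      then have "ch T x = {}" using ch_other[of x] x by (simp add: level_iff)
      then show ?thesis by (simp add: consecutive_def)
    qed
  }
qed simp

text \<open>Nonemptiness of the top passes down through parents, and the parent of a vertex of level
  \<open>Suc i\<close> is \<open>spine i\<close>. So every lower component of a bracket contains the
  vertex whose children can occur in the next one.\<close>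

lemma bracketD:
  assumes A: "is_bracket T k A"
  shows "i < k \<Longrightarrow> spine i \<in> A ! i" and "i \<le> k \<Longrightarrow> convex_in i (A ! i)"
    and "length A = Suc k" and "last A = A ! k" and "last A \<noteq> {}" and "k \<le> tdepth T"
proof -
  have l: "length A = Suc k" using A by (simp add: is_bracket_def)
  then show "last A = A ! k" by (metis diff_Suc_1 last_conv_nth length_0_conv nat.distinct(1))
  with l show k: "length A = Suc k" "last A \<noteq> {}" "k \<le> tdepth T"
    using A by (simp_all add: is_bracket_def)
  have lv: "A ! i \<subseteq> level T i" if "i \<le> k" for i using A that by (simp add: is_bracket_def)
  have ne: "A ! i \<noteq> {} \<and> (i < k \<longrightarrow> spine i \<in> A ! i)" if "i \<le> k" for i
    using that
  proof (induction "k - i" arbitrary: i)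
    case 0
    then show ?case using A by (simp add: is_bracket_def)
  next
    case (Suc j)
    then have "A ! Suc i \<noteq> {}" "i < k" using Suc.hyps(1)[of "Suc i"] by auto
    then obtain x where x: "x \<in> A ! Suc i" by auto
    then have "parent T x \<in> A ! i" using A \<open>i < k\<close> by (simp add: is_bracket_def)
    moreover have "parent T x = spine i" using x lv[of "Suc i"] \<open>i < k\<close> by (intro parent_level) auto
    ultimately show ?case by auto
  qed
  show sp: "spine i \<in> A ! i" if "i < k" for i using ne[of i] that by simp
  show "convex_in i (A ! i)" if i: "i \<le> k"
  proof (cases i)
    case 0
    then show ?thesis using lv[of 0] ne[of 0] by (auto simp: level_0 convex_in_def)
  next
    case (Suc j)
    then have j: "j < k" "j < tdepth T" using i k by auto
    then have "consecutive T (spine j) (A ! Suc j \<inter> ch T (spine j))"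
      using A sp by (simp add: is_bracket_def)
    moreover have "A ! Suc j \<inter> ch T (spine j) = A ! Suc j"
      using ch_spine[OF j(2)] lv[of "Suc j"] j by auto
    ultimately show ?thesis unfolding Suc convex_in_def consecutive_level[OF j(2), symmetric] by simp
  qed
qed

section \<open>Brackets and the gaps inside them\<close>

text \<open>The least set of gaps that represents \<open>A\<close>; a set \<open>U\<close> with
  \<open>A = br U u\<close> may contain further gaps outside \<open>A\<close>.\<close>

definition gaps :: "'v bracket \<Rightarrow> 'm set" where
  "gaps A = {a. lev a < length A \<and> lft a \<in> A ! lev a \<and> rgt a \<in> A ! lev a}"

lemma bracket_eq_br:
  assumes A: "is_bracket T k A" and u: "u \<in> last A"
  shows "A = br (gaps A) u" and "u \<in> level T k"
proof -
  note D = bracketD[OF A]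
  show uk: "u \<in> level T k" using u D(4) convex_in_subset[OF D(2)[of k]] by auto
  then have uv: "u \<in> verts T" "vdepth T u = k" by (auto simp: level_iff)
  show "A = br (gaps A) u"
  proof (rule nth_equalityI)
    show "length A = length (br (gaps A) u)" using D(3) uv by simp
    fix i assume "i < length A"
    then have i: "i \<le> k" using D(3) by simp
    have "path_to T u ! i \<in> A ! i"
      using i uv u D(1)[of i] D(4) by (cases "i = k") (simp_all add: path_to_eq nth_append)
    then have "blk (gaps A) (path_to T u ! i) = A ! i"
      using i D(3) by (intro blk_eq_convexI[OF D(2)]) (auto simp: gaps_def)
    then show "A ! i = br (gaps A) u ! i" using i uv by (simp add: br_nth)
  qed
qed

lemma gaps_br: "u \<in> verts T \<Longrightarrow> gaps (br U u) \<subseteq> U"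
proof
  fix a assume u: "u \<in> verts T" and a: "a \<in> gaps (br U u)"
  then have i: "lev a \<le> vdepth T u" by (simp add: gaps_def)
  then have "path_to T u ! lev a \<in> verts T" using path_to_nth_in[OF u] by (auto simp: level_iff)
  then show "a \<in> U" using gap_of_blk a i by (auto simp: gaps_def br_nth)
qed

lemma gaps_mono: "bsub A A' \<Longrightarrow> gaps A \<subseteq> gaps A'"
  by (auto simp: gaps_def bsub_iff)

text \<open>A Galois connection between the brackets with \<open>u\<close> in the top and the sets
  of gaps. It turns comparisons of brackets into comparisons of values of vectors on
  \<open>gaps A\<close>.\<close>

lemma bsub_br_iff:
  assumes A: "is_bracket T k A" and u: "u \<in> last A"
  shows "bsub A (br U u) \<longleftrightarrow> gaps A \<subseteq> U"
proof
  have uv: "u \<in> verts T" using bracket_eq_br(2)[OF A u] by (simp add: level_iff)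
  show "gaps A \<subseteq> U" if "bsub A (br U u)"
    using gaps_mono[OF that] gaps_br[OF uv] by blast
  show "bsub A (br U u)" if "gaps A \<subseteq> U"
    using bsub_br_mono[OF that, of u] bracket_eq_br(1)[OF A u] by simp
qed

lemma br_gaps_br: "u \<in> verts T \<Longrightarrow> br (gaps (br U u)) u = br U u"
  using bracket_eq_br(1)[OF is_bracket_br, of u u U] by simp

lemma gap_in_gaps_br:
  assumes "u \<in> verts T" "a \<in> U" "lev a = vdepth T u" "lft a \<in> blk U u \<or> rgt a \<in> blk U u"
  shows "a \<in> gaps (br U u)"
  using assms gap_in_blk[of a U u] by (auto simp: gaps_def br_nth_top)

text \<open>Nestedness at every vertex prevents a gap of \<open>U\<close> from leading out of the
  larger block \<open>blk U' x\<close>, so adding \<open>U\<close> to \<open>U'\<close> does not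
  enlarge it. For intersections no such argument is called for, as blocks commute with them.\<close>

lemma br_Un_Int:
  assumes nest: "\<And>x. x \<in> verts T \<Longrightarrow> bsub (br U x) (br U' x) \<or> bsub (br U' x) (br U x)"
    and u: "u \<in> verts T" and sub: "bsub (br U u) (br U' u)"
  shows "br (U \<union> U') u = br U' u" and "br (U \<inter> U') u = br U u"
proof -
  have nb: "blk U x \<subseteq> blk U' x \<or> blk U' x \<subseteq> blk U x" if "x \<in> verts T" for x
    using nest[OF that] bsub_last[of "br U x" "br U' x"] bsub_last[of "br U' x" "br U x"] that
    by (auto simp: br_eq_snoc)
  have un: "blk (U \<union> U') x = blk U' x" if x: "x \<in> verts T" and le: "blk U x \<subseteq> blk U' x" for x
  proof
    \<comment> \<open>The \<open>U\<close>-block of \<open>p\<close> is nested with the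
      \<open>U'\<close>-block of \<open>x\<close>. If it is the larger one, it contains
      \<open>x\<close>, so it is \<open>blk U x\<close>, which lies in \<open>blk U' x\<close> by
      assumption.\<close>
    have half: "q \<in> blk U' x" if "p \<in> blk U' x" "a \<in> U" "p = lft a \<and> q = rgt a \<or> p = rgt a \<and> q = lft a"
      for p q a
    proof -
      have p: "p \<in> verts T" using that lft_verts rgt_verts by auto
      have q: "q \<in> blk U p" using that gap_in_blk[OF that(2) p] self_in_blk[OF p] by auto
      have "blk U' p = blk U' x" using that x blk_eq by blast
      with nb[OF p] consider "blk U p \<subseteq> blk U' x" | "blk U' x \<subseteq> blk U p" by auto
      then show ?thesis
      proof cases
        case 2
        then have "x \<in> blk U p" using x self_in_blk by blast
        then have "blk U p = blk U x" using p blk_eq by metis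
        then show ?thesis using q le by blast
      qed (use q in blast)
    qed
    show "blk (U \<union> U') x \<subseteq> blk U' x"
    proof (rule blk_subsetI[OF x self_in_blk[OF x]])
      fix a assume "a \<in> U \<union> U'"
      then show "lft a \<in> blk U' x \<longleftrightarrow> rgt a \<in> blk U' x"
        using half[of "lft a" a "rgt a"] half[of "rgt a" a "lft a"] gap_in_blk[of a U' x] x by blast
    qed
    show "blk U' x \<subseteq> blk (U \<union> U') x" by (rule blk_mono) simp
  qed
  have le: "blk U (path_to T u ! i) \<subseteq> blk U' (path_to T u ! i)" if "i \<le> vdepth T u" for i
    using sub that by (simp add: bsub_iff br_nth less_Suc_eq_le)
  have pv: "path_to T u ! i \<in> verts T" if "i \<le> vdepth T u" for i
    using path_to_nth_in[OF u that] by (auto simp: level_iff)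
  show "br (U \<union> U') u = br U' u"
    using un[OF pv le] by (intro nth_equalityI) (auto simp: br_nth less_Suc_eq_le)
  show "br (U \<inter> U') u = br U u"
    using le by (intro nth_equalityI) (auto simp: br_nth less_Suc_eq_le blk_Int)
qed

end

section \<open>Bracketings\<close>

context gap_tree
begin

text \<open>The conditions on a bracketing that do not involve the order, which they determine.\<close>

definition bracket_system :: "'v bracket set \<Rightarrow> bool" where
  "bracket_system BS \<longleftrightarrow>
     (\<forall>A \<in> BS. \<exists>k. is_bracket T k A) \<and>
     (\<forall>k \<le> tdepth T. max_br T k \<in> BS) \<and> (\<forall>u \<in> verts T. sing_br T u \<in> BS) \<and>
     (\<forall>A \<in> BS. length A \<ge> 2 \<longrightarrow> butlast A \<in> BS) \<and>
     (\<forall>A1 \<in> BS. \<forall>A2 \<in> BS. length A1 = length A2 \<and> last A1 \<inter> last A2 \<noteq> {} \<longrightarrow>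
        bsub A1 A2 \<or> bsub A2 A1) \<and>
     (\<forall>A \<in> BS. length A \<le> tdepth T \<longrightarrow>
        (\<Union>A' \<in> over BS A. last A') = (\<Union>u \<in> last A. ch T u)) \<and>
     (\<forall>A \<in> BS. \<forall>A1 \<in> over BS A. \<forall>A2 \<in> over BS A. bpsub A2 A1 \<longrightarrow>
        (\<forall>u' \<in> last A1. \<exists>A3 \<in> over BS A. bpsub A3 A1 \<and> u' \<in> last A3))"

lemma bracket_systemD:
  assumes "bracket_system BS"
  shows "A \<in> BS \<Longrightarrow> \<exists>k. is_bracket T k A"
    and "k \<le> tdepth T \<Longrightarrow> max_br T k \<in> BS"
    and "u \<in> verts T \<Longrightarrow> sing_br T u \<in> BS"
    and "A \<in> BS \<Longrightarrow> length A \<ge> 2 \<Longrightarrow> butlast A \<in> BS"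
    and "A1 \<in> BS \<Longrightarrow> A2 \<in> BS \<Longrightarrow> length A1 = length A2 \<Longrightarrow> last A1 \<inter> last A2 \<noteq> {} \<Longrightarrow>
        bsub A1 A2 \<or> bsub A2 A1"
    and "A \<in> BS \<Longrightarrow> length A \<le> tdepth T \<Longrightarrow> (\<Union>A' \<in> over BS A. last A') = (\<Union>u \<in> last A. ch T u)"
    and "A \<in> BS \<Longrightarrow> A1 \<in> over BS A \<Longrightarrow> A2 \<in> over BS A \<Longrightarrow> bpsub A2 A1 \<Longrightarrow> u' \<in> last A1 \<Longrightarrow>
        \<exists>A3 \<in> over BS A. bpsub A3 A1 \<and> u' \<in> last A3"
  using assms unfolding bracket_system_def by (simp_all, blast)

section \<open>The order of a bracketing\<close>

definition left_right :: "'v bracket set \<Rightarrow> 'v bracket rel" where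
  "left_right BS = {(A, A') \<in> BS \<times> BS. length A = length A' \<and> butlast A = butlast A' \<and>
     (\<forall>x \<in> last A. \<forall>y \<in> last A'. (x, y) \<in> sib T)}"

lemma sib_irrefl: "(u, u) \<notin> sib T"
  using sib_order(1) by (simp add: irrefl_def)

lemma sib_asym: "(u, v) \<in> sib T \<Longrightarrow> (v, u) \<notin> sib T"
  using sib_order(2) sib_irrefl by blast

lemma bracket_top_nonempty: "bracket_system BS \<Longrightarrow> A \<in> BS \<Longrightarrow> last A \<noteq> {}"
  using bracket_systemD(1) bracketD(5) by blast

lemma bracket_top_level:
  "is_bracket T k A \<Longrightarrow> x \<in> last A \<Longrightarrow> x \<in> level T k"
  using bracket_eq_br(2) by blast

lemma left_right_asym:
  assumes "bracket_system BS" "(A1, A2) \<in> left_right BS"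
  shows "(A2, A1) \<notin> left_right BS"
proof
  assume "(A2, A1) \<in> left_right BS"
  moreover obtain x y where "x \<in> last A1" "y \<in> last A2"
    using assms bracket_top_nonempty unfolding left_right_def by blast
  ultimately show False using assms(2) sib_asym[of x y] unfolding left_right_def by blast
qed

lemma root_bracket_unique:
  assumes "is_bracket T 0 A" "is_bracket T 0 A'"
  shows "A = A'"
proof -
  have "A = [{troot T}]" if A: "is_bracket T 0 A" for A
  proof -
    have "last A \<noteq> {}" "last A = A ! 0" "length A = 1" "A ! 0 \<subseteq> level T 0"
      using bracketD[OF A] convex_in_subset[OF bracketD(2)[OF A, of 0]] by auto
    then show ?thesis using level_0 by (cases A) auto
  qed
  then show ?thesis using assms by metis
qed

text \<open>Tops are intervals of one level, and disjoint intervals do not interleave.\<close>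

lemma disjoint_tops_ordered:
  assumes A: "is_bracket T k A1" "is_bracket T k A2" and disj: "last A1 \<inter> last A2 = {}"
  shows "(\<forall>x \<in> last A1. \<forall>y \<in> last A2. (x, y) \<in> sib T) \<or> (\<forall>x \<in> last A1. \<forall>y \<in> last A2. (y, x) \<in> sib T)"
proof -
  have c: "convex_in k (last A1)" "convex_in k (last A2)" "last A1 \<noteq> {}" "last A2 \<noteq> {}"
    using bracketD[OF A(1)] bracketD[OF A(2)] by auto
  have *: "\<forall>x \<in> S. \<forall>y \<in> S'. pos T x < pos T y"
    if S: "convex_in k S" "convex_in k S'" "S \<inter> S' = {}" and x0: "x0 \<in> S" "y0 \<in> S'" "pos T x0 < pos T y0"
    for S S' x0 y0
  proof (intro ballI, rule ccontr)
    fix x y assume xy: "x \<in> S" "y \<in> S'" "\<not> pos T x < pos T y"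
    have lv: "x \<in> level T k" "y \<in> level T k" "x0 \<in> level T k" "y0 \<in> level T k"
      using convex_in_subset[OF S(1)] convex_in_subset[OF S(2)] x0 xy by auto
    show False
    proof (cases "pos T y \<le> pos T x0")
      case True
      then have "x0 \<in> S'" using S(2) lv x0 xy unfolding convex_in_def
        by (meson order_less_imp_le)
      then show False using S x0 by blast
    next
      case False
      then have "y \<in> S" using S(1) lv x0 xy unfolding convex_in_def
        by (meson linorder_le_cases linorder_not_le)
      then show False using S xy by blast
    qed
  qed
  obtain x0 y0 where x0: "x0 \<in> last A1" "y0 \<in> last A2" using c by blast
  have lv: "last A1 \<subseteq> level T k" "last A2 \<subseteq> level T k" using c convex_in_subset by auto
  have "x0 \<noteq> y0" using x0 disj by blast
  then have "pos T x0 \<noteq> pos T y0" using x0 lv inj_onD[OF inj_on_pos] by blast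
  then consider "pos T x0 < pos T y0" | "pos T y0 < pos T x0" by linarith
  then show ?thesis
  proof cases
    case 1
    then show ?thesis using *[OF c(1,2) disj x0] sib_iff_pos lv by blast
  next
    case 2
    have "last A2 \<inter> last A1 = {}" using disj by blast
    from *[OF c(2,1) this x0(2,1) 2] show ?thesis using sib_iff_pos lv by blast
  qed
qed

lemma left_right_comparable:
  assumes BS: "bracket_system BS" and A: "A1 \<in> BS" "A2 \<in> BS"
  shows "comparable (left_right BS) A1 A2 \<longleftrightarrow>
    length A1 = length A2 \<and> butlast A1 = butlast A2 \<and> last A1 \<inter> last A2 = {}"
proof
  assume "comparable (left_right BS) A1 A2"
  then show "length A1 = length A2 \<and> butlast A1 = butlast A2 \<and> last A1 \<inter> last A2 = {}"
    using sib_irrefl unfolding comparable_def left_right_def by (auto 0 3)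
next
  assume *: "length A1 = length A2 \<and> butlast A1 = butlast A2 \<and> last A1 \<inter> last A2 = {}"
  obtain k k' where k: "is_bracket T k A1" "is_bracket T k' A2" using bracket_systemD(1)[OF BS] A by blast
  then have "k = k'" using * bracketD(3)[OF k(1)] bracketD(3)[OF k(2)] by simp
  then show "comparable (left_right BS) A1 A2"
    using disjoint_tops_ordered[of k A1 A2] k * A
    unfolding comparable_def left_right_def by auto
qed

text \<open>For (5c), the tops of the smaller brackets lie inside the tops of the larger ones and
  inherit their relative position; asymmetry gives the other direction.\<close>

lemma is_bracketing_left_right:
  assumes BS: "bracket_system BS"
  shows "is_bracketing T (BS, left_right BS)"
proof -
  let ?R = "left_right BS"
  have tr: "(A1, A3) \<in> ?R" if "(A1, A2) \<in> ?R" "(A2, A3) \<in> ?R" for A1 A2 A3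
  proof -
    have "A2 \<in> BS" using that unfolding left_right_def by simp
    then obtain y where y: "y \<in> last A2" using bracket_top_nonempty[OF BS] by blast
    have "(x, z) \<in> sib T" if "x \<in> last A1" "z \<in> last A3" for x z
      using that y \<open>(A1, A2) \<in> ?R\<close> \<open>(A2, A3) \<in> ?R\<close> sib_order(2)[of x y z]
      unfolding left_right_def by blast
    then show ?thesis using that unfolding left_right_def by simp
  qed
  have five_c: "(A1, A2) \<in> ?R \<longleftrightarrow> (A1', A2') \<in> ?R"
    if "A1 \<in> over BS A" "A2 \<in> over BS A" "A1' \<in> over BS A'" "A2' \<in> over BS A'"
      "comparable ?R A1 A2" "comparable ?R A1' A2'" "bsub A1' A1" "bsub A2' A2"
    for A A' A1 A2 A1' A2'
  proof -
    have ne: "A1' \<noteq> []" "A2' \<noteq> []" using that by (auto simp: over_def)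
    have imp: "(B1', B2') \<in> ?R" if "(B1, B2) \<in> ?R" "B1' \<in> over BS A'" "B2' \<in> over BS A'"
      "bsub B1' B1" "bsub B2' B2" for B1 B2 B1' B2'
    proof -
      have "B1' \<noteq> []" "B2' \<noteq> []" using that by (auto simp: over_def)
      then have "last B1' \<subseteq> last B1" "last B2' \<subseteq> last B2" using that bsub_last by auto
      then show ?thesis using that unfolding left_right_def over_def by auto
    qed
    show ?thesis
      using imp[of A1 A2 A1' A2'] imp[of A2 A1 A2' A1'] that left_right_asym[OF BS]
      unfolding comparable_def by blast
  qed
  have "irrefl ?R" using left_right_asym[OF BS] by (auto simp: irrefl_def)
  moreover have "trans ?R" using tr by (rule transI)
  moreover have "?R \<subseteq> BS \<times> BS" by (auto simp: left_right_def)
  moreover have "(sing_br T u1, sing_br T u2) \<in> ?R" if s: "(u1, u2) \<in> sib T" for u1 u2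
  proof -
    obtain k where "u1 \<in> level T (Suc k)" "u2 \<in> level T (Suc k)" using sib_in_level[OF s] .
    then show ?thesis
      using s bracket_systemD(3)[OF BS] br_empty[of u1] br_empty[of u2] butlast_br[of u1 k "{}"]
        butlast_br[of u2 k "{}"] length_br[of "{}" u1] length_br[of "{}" u2]
        last_br[of u1 "{}"] last_br[of u2 "{}"] blk_empty
      by (auto simp: left_right_def level_iff)
  qed
  ultimately show ?thesis
    using BS left_right_comparable[OF BS] five_c
    unfolding is_bracketing_def bracket_system_def by (simp add: case_prod_beta)
qed

text \<open>(5b) orders the singletons as the plane tree does, (5c) carries this to all comparable
  brackets, and (5a) leaves no further freedom.\<close>

lemma is_bracketingD:
  assumes "is_bracketing T (BS, R)"
  shows "bracket_system BS" and "R = left_right BS"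
proof -
  from assms show BS: "bracket_system BS" unfolding is_bracketing_def bracket_system_def by simp
  have R: "R \<subseteq> BS \<times> BS" "irrefl R" "trans R" using assms unfolding is_bracketing_def by simp_all
  have five_a: "comparable R A1 A2 \<longleftrightarrow>
      length A1 = length A2 \<and> butlast A1 = butlast A2 \<and> last A1 \<inter> last A2 = {}"
    if "A1 \<in> BS" "A2 \<in> BS" "A1 \<noteq> A2" for A1 A2
    using assms that unfolding is_bracketing_def by simp
  have five_b: "(sing_br T u1, sing_br T u2) \<in> R" if "(u1, u2) \<in> sib T" for u1 u2
    using assms that unfolding is_bracketing_def by auto
  have five_c: "(A1, A2) \<in> R \<longleftrightarrow> (A1', A2') \<in> R"
    if "A \<in> BS" "A' \<in> BS" "bsub A' A" "A1 \<in> over BS A" "A2 \<in> over BS A" "A1' \<in> over BS A'"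
      "A2' \<in> over BS A'" "A1 \<noteq> A2" "comparable R A1 A2" "A1' \<noteq> A2'" "comparable R A1' A2'"
      "bsub A1' A1" "bsub A2' A2" for A A' A1 A2 A1' A2'
    using assms that unfolding is_bracketing_def prod.case by blast
  have R_asym: "(A2, A1) \<notin> R" if "(A1, A2) \<in> R" for A1 A2
    using that R(2,3) unfolding irrefl_def trans_def by blast
  have sub: "R \<subseteq> left_right BS"
  proof (rule subrelI)
    fix A1 A2 assume r: "(A1, A2) \<in> R"
    then have A: "A1 \<in> BS" "A2 \<in> BS" "A1 \<noteq> A2" "comparable R A1 A2"
      using R unfolding irrefl_def comparable_def by auto
    then have eq: "length A1 = length A2" "butlast A1 = butlast A2" "last A1 \<inter> last A2 = {}"
      using five_a by auto
    obtain k k' where k: "is_bracket T k A1" "is_bracket T k' A2" using bracket_systemD(1)[OF BS] A by blast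
    then have "k = k'" using eq bracketD(3)[OF k(1)] bracketD(3)[OF k(2)] by simp
    with k have k: "is_bracket T k A1" "is_bracket T k A2" by auto
    then have "k \<noteq> 0" using root_bracket_unique[of A1 A2] A(3) by (cases k) auto
    then obtain j where j: "k = Suc j" by (cases k) auto
    have "(x, y) \<in> sib T" if x: "x \<in> last A1" and y: "y \<in> last A2" for x y
    proof (rule ccontr)
      assume "(x, y) \<notin> sib T"
      have xy: "x \<in> level T (Suc j)" "y \<in> level T (Suc j)" "x \<noteq> y"
        using bracket_top_level k x y j eq(3) by blast+
      then have yx: "(y, x) \<in> sib T" using sib_order(3) \<open>(x, y) \<notin> sib T\<close> by blast
      have jn: "j < tdepth T" using bracketD(6)[OF k(1)] j by simp
      have v: "x \<in> verts T" "y \<in> verts T" using xy by (auto simp: level_iff)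
      \<comment> \<open>The singletons of \<open>x\<close> and \<open>y\<close> lie inside
        \<open>A1\<close> and \<open>A2\<close>, and the singleton of their common parent lies
        inside \<open>butlast A1\<close>. In this configuration (5c) orders the singletons like
        \<open>A1\<close> and \<open>A2\<close>, against (5b).\<close>
      let ?S = "sing_br T (spine j)"
      have over: "sing_br T z \<in> over BS ?S" if "z \<in> level T (Suc j)" for z
        using that bracket_systemD(3)[OF BS, of z] butlast_br[of z j "{}"] length_br[of "{}" z]
          br_empty[of z] br_empty[OF spine_verts[OF jn]] length_br[of "{}" "spine j"] spine_depth[OF jn]
        by (auto simp: over_def level_iff)
      have ss: "bsub (sing_br T x) A1" "bsub (sing_br T y) A2"
        using bsub_br_mono[of "{}" "gaps A1" x] bsub_br_mono[of "{}" "gaps A2" y]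
          bracket_eq_br(1)[OF k(1) x] bracket_eq_br(1)[OF k(2) y] v br_empty by auto
      have "bsub (butlast (sing_br T x)) (butlast A1)" by (rule bsub_butlast[OF ss(1)])
      moreover have "butlast (sing_br T x) = ?S" using over[OF xy(1)] by (simp add: over_def)
      ultimately have sA: "bsub ?S (butlast A1)" by simp
      have l: "length A1 = Suc (Suc j)" using bracketD(3)[OF k(1)] j by simp
      then have AB: "butlast A1 \<in> BS" using bracket_systemD(4)[OF BS A(1)] by simp
      have "sing_br T x \<noteq> sing_br T y"
        using last_br[of x "{}"] last_br[of y "{}"] v blk_empty br_empty xy(3) by auto
      moreover have "(sing_br T y, sing_br T x) \<in> R" using five_b[OF yx] .
      moreover have "A1 \<in> over BS (butlast A1)" "A2 \<in> over BS (butlast A1)"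
        using A eq l by (simp_all add: over_def)
      ultimately have "(sing_br T x, sing_br T y) \<in> R"
        using five_c[of "butlast A1" ?S A1 A2 "sing_br T x" "sing_br T y"] AB
          bracket_systemD(3)[OF BS spine_verts[OF jn]] sA over[OF xy(1)] over[OF xy(2)] A(3,4) ss r
        unfolding comparable_def by blast
      then show False using R_asym \<open>(sing_br T y, sing_br T x) \<in> R\<close> by blast
    qed
    then show "(A1, A2) \<in> left_right BS" using A eq by (auto simp: left_right_def)
  qed
  have "left_right BS \<subseteq> R"
  proof (rule subrelI)
    fix A1 A2 assume lr: "(A1, A2) \<in> left_right BS"
    then have A: "A1 \<in> BS" "A2 \<in> BS" by (auto simp: left_right_def)
    have "A1 \<noteq> A2" using left_right_asym[OF BS lr] lr by auto
    then have "comparable R A1 A2"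
      using five_a[OF A] left_right_comparable[OF BS A] lr by (auto simp: comparable_def)
    then show "(A1, A2) \<in> R"
      using sub left_right_asym[OF BS lr] unfolding comparable_def by blast
  qed
  with sub show "R = left_right BS" by blast
qed

lemma assoc_eq: "assoc T = (\<lambda>BS. (BS, left_right BS)) ` {BS. bracket_system BS}"
  unfolding assoc_def using is_bracketingD is_bracketing_left_right by fastforce

lemma br_le_left_right: "br_le (BS, left_right BS) (BS', left_right BS') \<longleftrightarrow> BS \<subseteq> BS'"
  unfolding br_le_def left_right_def by auto

lemma max_br_eq:
  assumes "k \<le> tdepth T"
  obtains u where "u \<in> level T k" "max_br T k = br UNIV u"
  using level_nonempty[OF assms] br_UNIV by (metis all_not_in_conv level_iff)

subsection \<open>The bracketing of a vector\<close>

definition vec_brackets :: "real ^ 'm \<Rightarrow> 'v bracket set" where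
  "vec_brackets v = {br {a. c \<le> v $ a} u | c u. u \<in> verts T}"

lemma vec_bracketsI: "u \<in> verts T \<Longrightarrow> br {a. c \<le> v $ a} u \<in> vec_brackets v"
  by (auto simp: vec_brackets_def)

lemma vec_bracketsE:
  assumes "A \<in> vec_brackets v"
  obtains c u where "A = br {a. c \<le> v $ a} u" "u \<in> verts T"
  using assms unfolding vec_brackets_def by blast

lemma br_UNIV_in_vec_brackets: "u \<in> verts T \<Longrightarrow> br UNIV u \<in> vec_brackets v"
proof -
  have "{a. Min (range (($) v)) \<le> v $ a} = UNIV" by auto
  then show "u \<in> verts T \<Longrightarrow> br UNIV u \<in> vec_brackets v" using vec_bracketsI by metis
qed

lemma br_empty_in_vec_brackets: "u \<in> verts T \<Longrightarrow> br {} u \<in> vec_brackets v"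
proof -
  have "v $ a \<le> Max (range (($) v))" for a by (intro Max_ge) auto
  then have "v $ a < Max (range (($) v)) + 1" for a by (simp add: add.commute add_strict_increasing)
  then have "{a. Max (range (($) v)) + 1 \<le> v $ a} = {}" by (auto simp: not_le)
  then show "u \<in> verts T \<Longrightarrow> br {} u \<in> vec_brackets v" using vec_bracketsI by metis
qed

text \<open>Superlevel sets form a chain. This gives (3) once both brackets are rewritten around a
  vertex common to their tops. For (4a) and (4b) a threshold already present is reused around
  another vertex.\<close>

lemma bracket_system_vec: "bracket_system (vec_brackets v)"
  unfolding bracket_system_def
proof (intro conjI ballI allI impI)
  let ?E = "vec_brackets v"
  let ?U = "\<lambda>c. {a. c \<le> v $ a}"
  have mono: "c \<le> c' \<Longrightarrow> ?U c' \<subseteq> ?U c" for c c' by auto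
  show "\<exists>k. is_bracket T k A" if "A \<in> ?E" for A
    using that is_bracket_br by (auto simp: vec_brackets_def)
  show "max_br T k \<in> ?E" if "k \<le> tdepth T" for k
    using max_br_eq[OF that] br_UNIV_in_vec_brackets by (metis level_iff)
  show "sing_br T u \<in> ?E" if "u \<in> verts T" for u
    using br_empty_in_vec_brackets br_empty that by metis
  show "butlast A \<in> ?E" if "A \<in> ?E" and A2: "2 \<le> length A" for A
  proof -
    obtain c u where u: "A = br (?U c) u" "u \<in> verts T" using \<open>A \<in> ?E\<close> by (rule vec_bracketsE)
    then obtain k where k: "vdepth T u = Suc k" using A2 by (cases "vdepth T u") auto
    then have "butlast A = br (?U c) (spine k)" using u butlast_br by (simp add: level_iff)
    moreover have "k < tdepth T" using k vdepth_le[OF u(2)] by simp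
    ultimately show ?thesis using vec_bracketsI spine_verts by metis
  qed
  show "bsub A1 A2 \<or> bsub A2 A1"
    if A12: "A1 \<in> ?E" "A2 \<in> ?E" and *: "length A1 = length A2 \<and> last A1 \<inter> last A2 \<noteq> {}" for A1 A2
  proof -
    obtain c1 u1 c2 u2 where u: "A1 = br (?U c1) u1" "u1 \<in> verts T" "A2 = br (?U c2) u2" "u2 \<in> verts T"
      using A12 vec_bracketsE by metis
    then obtain z where "z \<in> blk (?U c1) u1" "z \<in> blk (?U c2) u2" using * by auto
    then have "A1 = br (?U c1) z" "A2 = br (?U c2) z"
      using br_eq[OF u(2), of z] br_eq[OF u(4), of z] u(1,3) by simp_all
    then show ?thesis using mono[of c1 c2] mono[of c2 c1] bsub_br_mono by (metis linear)
  qed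
  {
    fix A assume A: "A \<in> ?E" and l: "length A \<le> tdepth T"
    obtain c w where w: "A = br (?U c) w" "w \<in> verts T" using A by (rule vec_bracketsE)
    define k where "k = vdepth T w"
    have k: "k < tdepth T" using l w by (simp add: k_def)
    show "(\<Union>A'\<in>over ?E A. last A') = (\<Union>u\<in>last A. ch T u)"
    proof
      show "(\<Union>A'\<in>over ?E A. last A') \<subseteq> (\<Union>u\<in>last A. ch T u)"
      proof
        fix y assume "y \<in> (\<Union>A'\<in>over ?E A. last A')"
        then obtain A' where A': "A' \<in> ?E" "length A' = Suc (length A)" "butlast A' = A" "y \<in> last A'"
          by (auto simp: over_def)
        then obtain c' u' where u': "A' = br (?U c') u'" "u' \<in> verts T" using vec_bracketsE by metis
        have d: "u' \<in> level T (Suc k)" using A' u' w by (simp add: level_iff k_def)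
        then have "A = br (?U c') (spine k)" using A' u' butlast_br by simp
        then have "spine k \<in> last A" using self_in_blk[OF spine_verts[OF k]] spine_verts[OF k] by simp
        moreover have "y \<in> blk (?U c') u'" using A' u' by simp
        then have "y \<in> level T (Suc k)" using blk_level[of "?U c'" u'] d by (auto simp: level_iff)
        ultimately show "y \<in> (\<Union>u\<in>last A. ch T u)" using ch_spine[OF k] by blast
      qed
      show "(\<Union>u\<in>last A. ch T u) \<subseteq> (\<Union>A'\<in>over ?E A. last A')"
      proof
        fix y assume "y \<in> (\<Union>u\<in>last A. ch T u)"
        then obtain u where u: "u \<in> blk (?U c) w" "y \<in> ch T u" using w by auto
        then have "vdepth T u = k" "u \<in> verts T" using blk_vdepth blk_verts k_def by auto
        then have uk: "u = spine k" using ch_other[of u] u by auto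
        then have y: "y \<in> level T (Suc k)" using u ch_spine[OF k] by simp
        then have "butlast (br (?U c) y) = A" using butlast_br uk br_eq[OF w(2) u(1)] w by simp
        moreover have "length (br (?U c) y) = Suc (length A)" using y w by (simp add: level_iff k_def)
        ultimately have "br (?U c) y \<in> over ?E A"
          using y vec_bracketsI by (auto simp: over_def level_iff)
        moreover have "y \<in> last (br (?U c) y)" using y by (simp add: level_iff)
        ultimately show "y \<in> (\<Union>A'\<in>over ?E A. last A')" by blast
      qed
    qed
  next
    fix A A1 A2 x assume A: "A \<in> ?E" "A1 \<in> over ?E A" "A2 \<in> over ?E A" "bpsub A2 A1" "x \<in> last A1"
    obtain c w where w: "A = br (?U c) w" "w \<in> verts T" using A(1) by (rule vec_bracketsE)
    have "A1 \<in> ?E" "A2 \<in> ?E" using A(2,3) by (simp_all add: over_def)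
    then obtain c1 u1 c2 u2 where u: "A1 = br (?U c1) u1" "u1 \<in> verts T" "A2 = br (?U c2) u2" "u2 \<in> verts T"
      using vec_bracketsE by metis
    define k where "k = vdepth T w"
    have lv: "u1 \<in> level T (Suc k)" "u2 \<in> level T (Suc k)"
      using A(2,3) u w by (simp_all add: over_def level_iff k_def)
    have "blk (?U c2) u2 \<subseteq> blk (?U c1) u1"
    proof -
      have "A2 \<noteq> []" using u(3) length_br[of "?U c2" u2] by (metis list.size(3) nat.distinct(1))
      then have "last A2 \<subseteq> last A1" using A(4) bsub_last[of A2 A1] by (simp add: bpsub_def)
      then show ?thesis using u by simp
    qed
    then have "u2 \<in> blk (?U c1) u1" using self_in_blk[OF u(4)] by blast
    then have A1: "A1 = br (?U c1) u2" using br_eq[OF u(2)] u(1) by simp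
    have cc: "c1 \<le> c2"
    proof (rule ccontr)
      assume "\<not> c1 \<le> c2"
      then have "bsub A1 A2" using mono[of c2 c1] bsub_br_mono A1 u by simp
      then show False using A(4) bsub_antisym by (auto simp: bpsub_def)
    qed
    have x: "x \<in> blk (?U c1) u1" using A(5) u by simp
    then have A1x: "A1 = br (?U c1) x" using br_eq[OF u(2)] u(1) by simp
    have xl: "x \<in> level T (Suc k)" using x lv blk_level[of "?U c1" u1] by (auto simp: level_iff)
    then have xv: "x \<in> verts T" by (simp add: level_iff)
    \<comment> \<open>The threshold of \<open>A2\<close> taken around \<open>x\<close>. The
      projection does not change, since \<open>x\<close> and \<open>u2\<close> have the same parent
      \<open>spine k\<close>.\<close>
    let ?A3 = "br (?U c2) x"
    have "butlast ?A3 = br (?U c2) (spine k)" using butlast_br xl by simp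
    also have "\<dots> = butlast A2" using butlast_br lv u by simp
    finally have "?A3 \<in> over ?E A"
      using A(3) xl w vec_bracketsI[OF xv] by (auto simp: over_def level_iff k_def)
    moreover have "bpsub ?A3 A1"
    proof -
      have "?A3 \<noteq> A1"
      proof
        assume "?A3 = A1"
        then have "blk (?U c2) x = blk (?U c1) u2"
          using A1 last_br[OF xv] last_br[OF u(4)] by metis
        then have "u2 \<in> blk (?U c2) x" using self_in_blk[OF u(4)] by simp
        then have "A2 = A1" using br_eq[OF xv] u(3) \<open>?A3 = A1\<close> by simp
        then show False using A(4) by (simp add: bpsub_def)
      qed
      then show ?thesis using A1x bsub_br_mono[OF mono[OF cc]] by (simp add: bpsub_def)
    qed
    moreover have "x \<in> last ?A3" using xv by simp
    ultimately show "\<exists>A3\<in>over ?E A. bpsub A3 A1 \<and> x \<in> last A3" by blast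
  }
qed

subsection \<open>Sums of vectors in the cone of a bracketing\<close>

lemma br_family_nested:
  assumes BS: "bracket_system BS" and U: "\<forall>u \<in> verts T. br U u \<in> BS" "\<forall>u \<in> verts T. br U' u \<in> BS"
    and x: "x \<in> verts T"
  shows "bsub (br U x) (br U' x) \<or> bsub (br U' x) (br U x)"
proof -
  have "x \<in> last (br U x) \<inter> last (br U' x)" using x by simp
  then have "last (br U x) \<inter> last (br U' x) \<noteq> {}" by blast
  then show ?thesis using bracket_systemD(5)[OF BS, of "br U x" "br U' x"] U x by simp
qed

lemma br_Un_in:
  assumes BS: "bracket_system BS" and U: "\<forall>u \<in> verts T. br U u \<in> BS" "\<forall>u \<in> verts T. br U' u \<in> BS"
    and u: "u \<in> verts T"
  shows "br (U \<union> U') u \<in> {br U u, br U' u}" "br (U \<inter> U') u \<in> {br U u, br U' u}"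
proof -
  note n = br_family_nested[OF BS U]
  have n': "bsub (br U' x) (br U x) \<or> bsub (br U x) (br U' x)" if "x \<in> verts T" for x
    using n[OF that] by blast
  show "br (U \<union> U') u \<in> {br U u, br U' u}" "br (U \<inter> U') u \<in> {br U u, br U' u}"
    using n[OF u] br_Un_Int[OF n u] br_Un_Int[OF n' u] by (auto simp: Un_commute Int_commute)
qed

text \<open>The induction closes because the union over \<open>F\<close> again has all its brackets
  in \<open>BS\<close>, so that the case of two sets applies to it.\<close>

lemma br_UN_in:
  assumes BS: "bracket_system BS" and I: "finite I" "I \<noteq> {}"
    and U: "\<forall>i \<in> I. \<forall>u \<in> verts T. br (U i) u \<in> BS"
    and u: "u \<in> verts T"
  shows "\<exists>i \<in> I. br (\<Union>i\<in>I. U i) u = br (U i) u"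
  using I U u
proof (induction I arbitrary: u rule: finite_ne_induct)
  case (insert i F)
  have "\<forall>u \<in> verts T. br (\<Union>i\<in>F. U i) u \<in> BS"
    using insert.IH insert.prems by (metis insertCI)
  moreover have "\<forall>u \<in> verts T. br (U i) u \<in> BS" using insert.prems by simp
  ultimately have "br (U i \<union> (\<Union>i\<in>F. U i)) u \<in> {br (U i) u, br (\<Union>i\<in>F. U i) u}"
    using br_Un_in(1)[OF BS] insert.prems by blast
  then show ?case using insert.IH[of u] insert.prems by auto
qed auto

text \<open>The index \<open>h\<close> runs through the possible thresholds of \<open>x\<close>,
  with \<open>h = g\<close> as witness. The union is finite, so the lemmas on unions and
  intersections of families apply.\<close>

lemma superlevel_add: "{g. c \<le> (x + y) $ g} = (\<Union>h. {g. x $ h \<le> x $ g} \<inter> {g. c - x $ h \<le> y $ g})"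
  for x y :: "real ^ 'm"
proof (intro equalityI subsetI)
  fix g assume "g \<in> {g. c \<le> (x + y) $ g}"
  then show "g \<in> (\<Union>h. {g. x $ h \<le> x $ g} \<inter> {g. c - x $ h \<le> y $ g})"
    by (auto intro!: exI[of _ g])
qed auto

text \<open>By \<open>superlevel_add\<close> each bracket of \<open>x + y\<close> is one of
  \<open>x\<close> or of \<open>y\<close>. Conversely, a bracket \<open>A\<close> of either vector
  appears in \<open>x + y\<close> at the threshold \<open>a + b\<close>, the sum of the minima of
  \<open>x\<close> and \<open>y\<close> over \<open>gaps A\<close>.\<close>

lemma vec_brackets_add:
  assumes BS: "bracket_system BS" and x: "vec_brackets x \<subseteq> BS" and y: "vec_brackets y \<subseteq> BS"
  shows "vec_brackets (x + y) = vec_brackets x \<union> vec_brackets y"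
proof -
  have fam: "\<forall>u\<in>verts T. br {g. c \<le> x $ g} u \<in> BS" "\<forall>u\<in>verts T. br {g. c \<le> y $ g} u \<in> BS" for c
    using x y vec_bracketsI by blast+
  let ?S = "\<lambda>c h. {g. x $ h \<le> x $ g} \<inter> {g. c - x $ h \<le> y $ g}"
  have S: "br (?S c h) u \<in> {br {g. x $ h \<le> x $ g} u, br {g. c - x $ h \<le> y $ g} u}" if "u \<in> verts T" for c h u
    using br_Un_in(2)[OF BS fam that] .
  have sup: "\<exists>h. br {g. c \<le> (x + y) $ g} u = br (?S c h) u" if u: "u \<in> verts T" for c u
  proof -
    have "\<forall>i\<in>UNIV. \<forall>u\<in>verts T. br (?S c i) u \<in> BS"
      using S fam by (metis insertE singletonD)
    from br_UN_in[OF BS _ _ this u] show ?thesis unfolding superlevel_add by auto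
  qed
  have le: "vec_brackets (x + y) \<subseteq> vec_brackets x \<union> vec_brackets y"
  proof
    fix A assume "A \<in> vec_brackets (x + y)"
    then obtain c u where u: "A = br {g. c \<le> (x + y) $ g} u" "u \<in> verts T"
      by (rule vec_bracketsE)
    then obtain h where "A = br (?S c h) u" using sup by metis
    then have "A \<in> {br {g. x $ h \<le> x $ g} u, br {g. c - x $ h \<le> y $ g} u}" using S[OF u(2)] by metis
    then show "A \<in> vec_brackets x \<union> vec_brackets y" using vec_bracketsI[OF u(2)] by fast
  qed
  have ge: "A \<in> vec_brackets (x + y)"
    if A: "A = br {g. c0 \<le> z $ g} u" and u: "u \<in> verts T" and zz: "z = x \<and> z' = y \<or> z = y \<and> z' = x"
    for A z z' c0 u
  proof (cases "gaps A = {}")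
    case True
    then have "A = br {} u" using br_gaps_br[OF u] A by metis
    then show ?thesis using br_empty_in_vec_brackets u by metis
  next
    case False
    have ub: "is_bracket T (vdepth T u) A" "u \<in> last A" using A is_bracket_br u by auto
    define a b where "a = Min (($) x ` gaps A)" and "b = Min (($) y ` gaps A)"
    have ab: "a \<in> ($) x ` gaps A" "b \<in> ($) y ` gaps A" "\<And>g. g \<in> gaps A \<Longrightarrow> a \<le> x $ g" "\<And>g. g \<in> gaps A \<Longrightarrow> b \<le> y $ g"
      unfolding a_def b_def using False by (auto intro: Min_in)
    then obtain ga gb where g: "ga \<in> gaps A" "x $ ga = a" "gb \<in> gaps A" "y $ gb = b" by auto
    define cz where "cz = Min (($) z ` gaps A)"
    have cz: "cz = (if z = x then a else b)" using zz by (auto simp: cz_def a_def b_def)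
    have "gaps A \<subseteq> {g. cz \<le> z $ g}" using zz ab by (auto simp: cz)
    then have 1: "bsub A (br {g. cz \<le> z $ g} u)" using bsub_br_iff[OF ub] by simp
    have "c0 \<le> cz" using gaps_br[OF u, of "{g. c0 \<le> z $ g}"] A g zz by (auto simp: cz)
    then have "bsub (br {g. cz \<le> z $ g} u) A" unfolding A by (intro bsub_br_mono) auto
    with 1 have Az: "A = br {g. cz \<le> z $ g} u" using bsub_antisym by blast
    let ?D = "br {g. a + b \<le> (x + y) $ g} u"
    have "gaps A \<subseteq> {g. a + b \<le> (x + y) $ g}" using ab by (auto intro: add_mono)
    then have AD: "bsub A ?D" using bsub_br_iff[OF ub] by simp
    obtain h where h: "?D = br (?S (a + b) h) u" using sup[OF u] by blast
    then have "gaps A \<subseteq> ?S (a + b) h" using AD bsub_br_iff[OF ub] by simp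
    \<comment> \<open>Together the two bounds force \<open>x $ h = a\<close>. So the intersection
      that represents \<open>?D\<close> consists of superlevel sets at \<open>a\<close> and
      \<open>b\<close>, and it lies in the one that represents \<open>A\<close>.\<close>
    then have "x $ h \<le> a" "a + b - x $ h \<le> b" using g by auto
    then have "?S (a + b) h \<subseteq> {g. cz \<le> z $ g}" using zz by (auto simp: cz)
    then have "bsub ?D A" unfolding h Az by (rule bsub_br_mono)
    with AD have "A = ?D" using bsub_antisym by blast
    then show ?thesis using vec_bracketsI u by metis
  qed
  have "vec_brackets x \<subseteq> vec_brackets (x + y)" "vec_brackets y \<subseteq> vec_brackets (x + y)"
    using ge[where z = x and z' = y] ge[where z = y and z' = x] unfolding vec_brackets_def by blast+
  with le show ?thesis by blast
qed

lemma vec_brackets_scale: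
  assumes c: "c > 0"
  shows "vec_brackets (c *\<^sub>R v) = vec_brackets v"
proof -
  have sub: "vec_brackets v \<subseteq> vec_brackets (c *\<^sub>R v)" if c: "c > 0" for c v
  proof
    fix A assume "A \<in> vec_brackets v"
    then obtain d u where u: "A = br {a. d \<le> v $ a} u" "u \<in> verts T" by (rule vec_bracketsE)
    have "{a. d \<le> v $ a} = {a. c * d \<le> (c *\<^sub>R v) $ a}" using c by auto
    then show "A \<in> vec_brackets (c *\<^sub>R v)" using vec_bracketsI[OF u(2)] u(1) by metis
  qed
  have "vec_brackets (c *\<^sub>R v) \<subseteq> vec_brackets ((1 / c) *\<^sub>R c *\<^sub>R v)" using c by (intro sub) simp
  then show ?thesis using sub[OF c, of v] c by simp
qed

lemma vec_brackets_const: "vec_brackets (c *\<^sub>R 1) = br {} ` verts T \<union> br UNIV ` verts T"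
proof -
  have "vec_brackets (c *\<^sub>R 1) \<subseteq> br {} ` verts T \<union> br UNIV ` verts T"
  proof
    fix A assume "A \<in> vec_brackets (c *\<^sub>R 1)"
    then obtain d u where u: "A = br {a. d \<le> (c *\<^sub>R 1 :: real ^ 'm) $ a} u" "u \<in> verts T"
      by (rule vec_bracketsE)
    have "{a::'m. d \<le> (c *\<^sub>R 1 :: real ^ 'm) $ a} = (if d \<le> c then UNIV else {})" by simp
    then show "A \<in> br {} ` verts T \<union> br UNIV ` verts T" using u by (cases "d \<le> c") simp_all
  qed
  then show ?thesis using br_empty_in_vec_brackets br_UNIV_in_vec_brackets by blast
qed

lemma trivial_brackets_subset:
  assumes "bracket_system BS"
  shows "br {} ` verts T \<union> br UNIV ` verts T \<subseteq> BS"
  using bracket_systemD(2,3)[OF assms] br_empty br_UNIV vdepth_le by auto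

definition bcone :: "'v bracket set \<Rightarrow> (real ^ 'm) set" where
  "bcone BS = {v. vec_brackets v \<subseteq> BS}"

lemma const_in_bcone: "bracket_system BS \<Longrightarrow> c *\<^sub>R 1 \<in> bcone BS"
  unfolding bcone_def using vec_brackets_const trivial_brackets_subset by simp

lemma convex_cone_bcone:
  assumes BS: "bracket_system BS"
  shows "convex_cone (bcone BS)"
  unfolding convex_cone_iff
proof (intro conjI ballI allI impI)
  show z: "0 \<in> bcone BS" using const_in_bcone[OF BS, of 0] by simp
  show "x + y \<in> bcone BS" if "x \<in> bcone BS" "y \<in> bcone BS" for x y :: "real ^ 'm"
    using that vec_brackets_add[OF BS] by (simp add: bcone_def)
  show "c *\<^sub>R x \<in> bcone BS" if "x \<in> bcone BS" "0 \<le> c" for x :: "real ^ 'm" and c :: real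
    using that vec_brackets_scale[of c x] z by (cases "c = 0") (auto simp: bcone_def)
qed

text \<open>At an inner point of a segment of the cone, the brackets are those of both ends
  together. They lie in \<open>BS'\<close> only if the brackets of each end do.\<close>

lemma bcone_face:
  assumes BS: "bracket_system BS" and BS': "bracket_system BS'"
  shows "bcone BS \<inter> bcone BS' face_of bcone BS"
  unfolding face_of_def
proof (intro conjI ballI impI)
  show "bcone BS \<inter> bcone BS' \<subseteq> bcone BS" by blast
  show "convex (bcone BS \<inter> bcone BS')"
    using convex_cone_bcone[OF BS] convex_cone_bcone[OF BS'] by (auto simp: convex_cone_def intro: convex_Int)
  fix a b x :: "real ^ 'm" assume ab: "a \<in> bcone BS" "b \<in> bcone BS" and x: "x \<in> bcone BS \<inter> bcone BS'" "x \<in> open_segment a b"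
  then obtain t where t: "0 < t" "t < 1" "x = (1 - t) *\<^sub>R a + t *\<^sub>R b" by (auto simp: in_segment)
  have "vec_brackets ((1 - t) *\<^sub>R a) \<subseteq> BS" "vec_brackets (t *\<^sub>R b) \<subseteq> BS"
    using ab t vec_brackets_scale by (auto simp: bcone_def)
  then have "vec_brackets x = vec_brackets a \<union> vec_brackets b"
    using vec_brackets_add[OF BS] t vec_brackets_scale by simp
  then show "a \<in> bcone BS \<inter> bcone BS'" "b \<in> bcone BS \<inter> bcone BS'"
    using x ab by (auto simp: bcone_def)
qed

text \<open>The braid cone of \<open>y\<close> consists of the vectors \<open>x\<close> that vary
  weakly monotonically with \<open>y\<close>. A nonempty superlevel set of such an \<open>x\<close>
  is the superlevel set of \<open>y\<close> at the minimum of \<open>y\<close> over it, so no new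
  brackets arise.\<close>

lemma bcone_union_of_braid_cones:
  "\<exists>D \<subseteq> braid_fan. bcone BS = \<Union> D"
proof -
  let ?K = "\<lambda>y :: real ^ 'm. {x :: real ^ 'm. \<forall>a b. y $ a \<le> y $ b \<longrightarrow> x $ a \<le> x $ b}"
  have "?K y \<subseteq> bcone BS" if y: "y \<in> bcone BS" for y
  proof
    fix x assume x: "x \<in> ?K y"
    have "vec_brackets x \<subseteq> vec_brackets y"
    proof
      fix A assume "A \<in> vec_brackets x"
      then obtain c u where u: "A = br {a. c \<le> x $ a} u" "u \<in> verts T" by (rule vec_bracketsE)
      let ?U = "{a. c \<le> x $ a}"
      show "A \<in> vec_brackets y"
      proof (cases "?U = {}")
        case True
        then show ?thesis using u br_empty_in_vec_brackets by simp
      next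
        case False
        define d where "d = Min (($) y ` ?U)"
        have "d \<in> ($) y ` ?U" unfolding d_def using False by (intro Min_in) auto
        then obtain g where g: "c \<le> x $ g" "y $ g = d" by auto
        have "?U = {a. d \<le> y $ a}"
          using x g by (auto simp: d_def intro: order_trans)
        then show ?thesis using u vec_bracketsI by metis
      qed
    qed
    then show "x \<in> bcone BS" using y by (auto simp: bcone_def)
  qed
  then have "bcone BS = \<Union> (?K ` bcone BS)" by blast
  moreover have "?K ` bcone BS \<subseteq> braid_fan" by (auto simp: braid_fan_def)
  ultimately show ?thesis by blast
qed

end

subsection \<open>Faces\<close>

context gap_tree
begin

lemma finite_brackets: "finite {A. \<exists>k. is_bracket T k A}"
proof (rule finite_subset)
  show "{A. \<exists>k. is_bracket T k A} \<subseteq> {A. set A \<subseteq> Pow (verts T) \<and> length A \<le> Suc (tdepth T)}"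
  proof
    fix A assume "A \<in> {A. \<exists>k. is_bracket T k A}"
    then obtain k where k: "is_bracket T k A" by blast
    have "A ! i \<subseteq> verts T" if "i < length A" for i
      using that bracketD(3)[OF k] convex_in_subset[OF bracketD(2)[OF k, of i]] level_subset[of i] by auto
    then have "set A \<subseteq> Pow (verts T)" by (auto simp: set_conv_nth)
    then show "A \<in> {A. set A \<subseteq> Pow (verts T) \<and> length A \<le> Suc (tdepth T)}"
      using bracketD(3,6)[OF k] by simp
  qed
  show "finite {A. set A \<subseteq> Pow (verts T) \<and> length A \<le> Suc (tdepth T)}"
    by (rule finite_lists_length_le) simp
qed

lemma finite_bracket_system: "bracket_system BS \<Longrightarrow> finite BS"
  using finite_subset[OF _ finite_brackets] bracket_systemD(1) by (metis (lifting) mem_Collect_eq subsetI)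

lemma finite_bracket_systems: "finite {BS. bracket_system BS}"
proof (rule finite_subset)
  show "{BS. bracket_system BS} \<subseteq> Pow {A. \<exists>k. is_bracket T k A}"
    using bracket_systemD(1) by blast
  show "finite (Pow {A. \<exists>k. is_bracket T k A})" using finite_brackets by simp
qed

lemma small_perturbation:
  fixes x y :: "real ^ 'm"
  obtains e where "e > 0" "\<And>g h. x $ g < x $ h \<Longrightarrow> (x - e *\<^sub>R y) $ g < (x - e *\<^sub>R y) $ h"
proof -
  have "\<forall>\<^sub>F e in at_right 0. x $ g < x $ h \<longrightarrow> (x - e *\<^sub>R y) $ g < (x - e *\<^sub>R y) $ h" for g h
  proof (cases "x $ g < x $ h")
    case True
    have "((\<lambda>e. (x $ h - e * y $ h) - (x $ g - e * y $ g)) \<longlongrightarrow> (x $ h - 0 * y $ h) - (x $ g - 0 * y $ g)) (at_right 0)"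
      by (intro tendsto_intros)
    then have "\<forall>\<^sub>F e in at_right 0. 0 < (x $ h - e * y $ h) - (x $ g - e * y $ g)"
      using True by (intro order_tendstoD(1)) auto
    then show ?thesis by eventually_elim simp
  qed simp
  then have "\<forall>\<^sub>F e in at_right 0. \<forall>g h. x $ g < x $ h \<longrightarrow> (x - e *\<^sub>R y) $ g < (x - e *\<^sub>R y) $ h"
    by (intro eventually_all_finite)
  then have "\<forall>\<^sub>F e in at_right (0::real). e > 0 \<and> (\<forall>g h. x $ g < x $ h \<longrightarrow> (x - e *\<^sub>R y) $ g < (x - e *\<^sub>R y) $ h)"
    using eventually_at_right_less by (rule eventually_conj[rotated])
  then obtain e where "e > 0" "\<forall>g h. x $ g < x $ h \<longrightarrow> (x - e *\<^sub>R y) $ g < (x - e *\<^sub>R y) $ h"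
    using eventually_happens'[OF trivial_limit_at_right_real] by blast
  then show ?thesis using that by blast
qed

text \<open>Two gaps that are tied in \<open>x\<close> and that bound a new bracket would be separated by a bracket of
  \<open>y\<close>.\<close>

lemma vec_brackets_perturb:
  assumes yx: "vec_brackets y \<subseteq> vec_brackets x"
    and ref: "\<And>g h. x $ g < x $ h \<Longrightarrow> (x - e *\<^sub>R y) $ g < (x - e *\<^sub>R y) $ h" and e: "e > 0"
  shows "vec_brackets (x - e *\<^sub>R y) \<subseteq> vec_brackets x"
proof
  define z where "z = x - e *\<^sub>R y"
  have zn: "z $ a = x $ a - e * y $ a" for a by (simp add: z_def)
  \<comment> \<open>Every bracket of \<open>y\<close> around \<open>q\<close> is a bracket of
    \<open>x\<close>, and it can be written around \<open>q\<close> itself.\<close>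
  have yb: "\<exists>c''. br {b. c \<le> y $ b} q = br {b. c'' \<le> x $ b} q" if q: "q \<in> verts T" for q c
  proof -
    have "br {b. c \<le> y $ b} q \<in> vec_brackets x" using yx vec_bracketsI[OF q] by blast
    then obtain c'' q'' where q'': "br {b. c \<le> y $ b} q = br {b. c'' \<le> x $ b} q''" "q'' \<in> verts T"
      by (rule vec_bracketsE)
    then have "blk {b. c \<le> y $ b} q = blk {b. c'' \<le> x $ b} q''" using q last_br by metis
    then have "q \<in> blk {b. c'' \<le> x $ b} q''" using q self_in_blk by metis
    then show ?thesis using br_eq[OF q''(2)] q''(1) by metis
  qed
  fix A assume "A \<in> vec_brackets (x - e *\<^sub>R y)"
  then obtain c u where A: "A = br {a. c \<le> z $ a} u" and u: "u \<in> verts T"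
    unfolding z_def by (rule vec_bracketsE)
  show "A \<in> vec_brackets x"
  proof (cases "gaps A = {}")
    case True
    then have "A = br {} u" using br_gaps_br[OF u] A by metis
    then show ?thesis using br_empty_in_vec_brackets u by metis
  next
    case False
    have ub: "is_bracket T (vdepth T u) A" "u \<in> last A" using A is_bracket_br u by auto
    \<comment> \<open>The only threshold at which \<open>A\<close> can be a bracket of
      \<open>x\<close>: the least value of \<open>x\<close> on a gap of \<open>A\<close>, attained
      at \<open>h\<close>.\<close>
    define c' where "c' = Min (($) x ` gaps A)"
    have "c' \<in> ($) x ` gaps A" unfolding c'_def using False by (intro Min_in) auto
    then obtain h where h: "h \<in> gaps A" "x $ h = c'" by auto
    have c': "gaps A \<subseteq> {a. c' \<le> x $ a}" unfolding c'_def by auto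
    let ?X = "{a. c' \<le> x $ a}"
    have AX: "bsub A (br ?X u)" using c' bsub_br_iff[OF ub] by simp
    have hz: "c \<le> z $ h" using gaps_br[OF u] h A by blast
    have hl: "lev h \<le> vdepth T u" "lft h \<in> A ! lev h"
      using h(1) A by (auto simp: gaps_def)
    have hA: "lft h \<in> blk ?X (path_to T u ! lev h)"
    proof -
      have "A ! lev h \<subseteq> br ?X u ! lev h" using AX hl A unfolding bsub_iff by simp
      then show ?thesis using hl br_nth by auto
    qed
    have "bsub (br ?X u) A"
      unfolding bsub_iff
    proof (intro conjI allI impI)
      show "length (br ?X u) = length A" using A by simp
      fix i assume "i < length (br ?X u)"
      then have i: "i \<le> vdepth T u" by simp
      define p where "p = path_to T u ! i"
      have p: "p \<in> verts T" "vdepth T p = i" using path_to_nth_in[OF u i] by (auto simp: level_iff p_def)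
      let ?Z = "{a. c \<le> z $ a}"
      have "blk ?X p \<subseteq> blk ?Z p"
      proof (rule blk_subsetI[OF p(1) self_in_blk[OF p(1)]], rule ccontr)
        fix a assume a: "a \<in> ?X" "lev a = vdepth T p" "lft a \<in> blk ?X p" "rgt a \<in> blk ?X p"
          and ne: "(lft a \<in> blk ?Z p) \<noteq> (rgt a \<in> blk ?Z p)"
        then have "a \<notin> ?Z" using gap_in_blk[OF _ p(1), of a ?Z] by blast
        then have za: "z $ a < z $ h" using hz by simp
        then have "\<not> x $ h < x $ a" using ref[of h a] unfolding z_def[symmetric] by linarith
        then have xa: "x $ a = c'" using a(1) h(2) by simp
        then have "e * y $ h < e * y $ a" using za h(2) unfolding zn by simp
        then have ya: "y $ h < y $ a" using e by simp
        \<comment> \<open>This superlevel set of \<open>y\<close> contains \<open>a\<close> but not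
          \<open>h\<close>. Its brackets are brackets of \<open>x\<close>; one that contains
          \<open>a\<close> has a threshold at most \<open>c'\<close>, hence also closes the tied gap
          \<open>h\<close> within its range. A bracket that reaches \<open>h\<close> gives the
          contradiction.\<close>
        let ?Y = "{b. y $ a \<le> y $ b}"
        have hY: "h \<notin> ?Y" and aY: "a \<in> ?Y" using ya by auto
        define s where "s = lft a"
        have s: "s \<in> verts T" "s \<in> blk ?X p" "vdepth T s = i" "rgt a \<in> blk ?Y s"
          using a p aY lft_verts vdepth_lft rgt_in_blk_lft by (auto simp: s_def)
        obtain c0 where c0: "br ?Y s = br {b. c0 \<le> x $ b} s" using yb s(1) by blast
        then have "blk ?Y s = blk {b. c0 \<le> x $ b} s" using last_br s(1) by metis
        then have "a \<in> {b. c0 \<le> x $ b}" using s(4) rgt_in_blk_lft s_def by metis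
        then have c0': "?X \<subseteq> {b. c0 \<le> x $ b}" using xa by auto
        then have sp: "s \<in> blk {b. c0 \<le> x $ b} p" using s(2) blk_mono by blast
        show False
        proof (cases "lev h \<le> i")
          case True
          have "br {b. c0 \<le> x $ b} s = br {b. c0 \<le> x $ b} p" using br_eq[OF p(1) sp] .
          moreover have "path_to T p ! lev h = path_to T u ! lev h"
            using True i hl p u unfolding p_def by (simp add: path_to_eq nth_append)
          ultimately have "br ?Y s ! lev h = blk {b. c0 \<le> x $ b} (path_to T u ! lev h)"
            using c0 True p(2) br_nth by metis
          then have l: "lft h \<in> br ?Y s ! lev h" using hA blk_mono[OF c0'] by blast
          have "path_to T s ! lev h \<in> verts T" using path_to_nth_in[OF s(1)] True s(3) by (auto simp: level_iff)
          moreover have "h \<in> {b. c0 \<le> x $ b}" using h c' c0' by auto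
          ultimately have "rgt h \<in> br ?Y s ! lev h"
            using l c0 True s(3) gap_in_blk br_nth by metis
          then have "h \<in> gaps (br ?Y s)" using l True s(3) by (simp add: gaps_def)
          then show False using gaps_br[OF s(1)] hY by blast
        next
          case False
          \<comment> \<open>Here \<open>h\<close> lies deeper than level \<open>i\<close>, where the
            bracket around \<open>s\<close> ends. The bracket around an end of \<open>h\<close>
            reaches it, and its component at level \<open>i\<close> is the block of
            \<open>p = spine i\<close>.\<close>
          define q where "q = lft h"
          have q: "q \<in> verts T" "vdepth T q = lev h" by (auto simp: q_def lft_verts vdepth_lft)
          have iu: "i < vdepth T u" using False hl(1) by simp
          then have pq: "p = spine i" unfolding p_def by (simp add: path_to_eq[OF u] nth_append)
          obtain c1 where c1: "br ?Y q = br {b. c1 \<le> x $ b} q" using yb q(1) by blast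
          have "br ?Y q ! i = blk ?Y p" "br {b. c1 \<le> x $ b} q ! i = blk {b. c1 \<le> x $ b} p"
            using False q br_nth_spine pq by auto
          then have bp: "blk ?Y p = blk {b. c1 \<le> x $ b} p" using c1 by simp
          have "blk ?Y s = blk {b. c0 \<le> x $ b} s" using c0 last_br s(1) by metis
          then have "p \<in> blk ?Y s" using sp blk_sym p(1) by blast
          then have "lft a \<in> blk ?Y p" using blk_sym s(1) s_def by blast
          moreover have "rgt a \<in> blk ?Y p" using calculation gap_in_blk[OF aY p(1)] by simp
          ultimately have "a \<in> {b. c1 \<le> x $ b}" unfolding bp by (rule gap_of_blk[OF p(1)])
          then have "h \<in> {b. c1 \<le> x $ b}" using xa h(2) by simp
          then have "h \<in> gaps (br {b. c1 \<le> x $ b} q)"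
            using gap_in_gaps_br[OF q(1)] q self_in_blk[OF q(1)] by (simp add: q_def)
          then have "h \<in> gaps (br ?Y q)" using c1 by simp
          then show False using gaps_br[OF q(1)] hY by blast
        qed
      qed
      then show "br ?X u ! i \<subseteq> A ! i" using i A by (simp add: br_nth p_def)
    qed
    with AX have "A = br ?X u" using bsub_antisym by blast
    then show ?thesis using vec_bracketsI u by metis
  qed
qed

text \<open>Take \<open>x\<close> in \<open>G\<close> with the largest number of brackets. A
  midpoint with any \<open>y\<close> of \<open>G\<close> has the brackets of both, so maximality
  puts those of \<open>y\<close> among those of \<open>x\<close>. Conversely, if all brackets of
  \<open>y\<close> are brackets of \<open>x\<close>, then \<open>x\<close> lies between a positive
  multiple of \<open>y\<close> and a point of the cone, and the face property applies.\<close>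

lemma face_of_bcone:
  assumes BS: "bracket_system BS" and G: "G face_of bcone BS" "G \<noteq> {}"
  shows "\<exists>x. G = bcone (vec_brackets x)"
proof -
  have GB: "G \<subseteq> bcone BS" using G(1) face_of_imp_subset by blast
  have "conic (bcone BS)" using convex_cone_bcone[OF BS] by (simp add: convex_cone_def)
  then have conG: "conic G" using G(1) face_of_conic by blast
  have "card (vec_brackets x) < Suc (card BS)" if "x \<in> G" for x
    using that GB card_mono[OF finite_bracket_system[OF BS]] by (auto simp: bcone_def less_Suc_eq_le)
  then obtain x where x: "x \<in> G" "\<And>y. y \<in> G \<Longrightarrow> card (vec_brackets y) \<le> card (vec_brackets x)"
    using ex_has_greatest_nat[of "\<lambda>x. x \<in> G" _ "\<lambda>x. card (vec_brackets x)" "Suc (card BS)"] G(2) by blast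
  have xB: "vec_brackets x \<subseteq> BS" using x GB by (auto simp: bcone_def)
  have "G = bcone (vec_brackets x)"
  proof
    show "G \<subseteq> bcone (vec_brackets x)"
    proof
      fix y assume y: "y \<in> G"
      then have yB: "vec_brackets y \<subseteq> BS" using GB by (auto simp: bcone_def)
      have "(1/2) *\<^sub>R x + (1/2) *\<^sub>R y \<in> G"
        using face_of_imp_convex[OF G(1)] x y by (intro convexD) auto
      moreover have eq: "vec_brackets ((1/2) *\<^sub>R x + (1/2) *\<^sub>R y) = vec_brackets x \<union> vec_brackets y"
        using vec_brackets_add[OF BS, of "(1/2) *\<^sub>R x" "(1/2) *\<^sub>R y"] xB yB vec_brackets_scale by simp
      ultimately have "card (vec_brackets x \<union> vec_brackets y) \<le> card (vec_brackets x)" using x(2) by metis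
      moreover have "finite (vec_brackets x \<union> vec_brackets y)"
        using finite_subset[of _ BS] xB yB finite_bracket_system[OF BS] by simp
      ultimately have "vec_brackets x = vec_brackets x \<union> vec_brackets y"
        by (intro card_seteq) auto
      then show "y \<in> bcone (vec_brackets x)" by (auto simp: bcone_def)
    qed
    show "bcone (vec_brackets x) \<subseteq> G"
    proof
      fix y assume y: "y \<in> bcone (vec_brackets x)"
      then have yx: "vec_brackets y \<subseteq> vec_brackets x" by (simp add: bcone_def)
      obtain e where e: "e > 0" "\<And>g h. x $ g < x $ h \<Longrightarrow> (x - e *\<^sub>R y) $ g < (x - e *\<^sub>R y) $ h"
        using small_perturbation[of x y] by blast
      \<comment> \<open>The factor 2 makes \<open>x\<close> the midpoint of \<open>a\<close> and
        \<open>b\<close>. The first point stays in the cone by \<open>vec_brackets_perturb\<close>,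
        the second because it is a positive multiple of \<open>y\<close>.\<close>
      define a b where "a = 2 *\<^sub>R (x - e *\<^sub>R y)" and "b = (2 * e) *\<^sub>R y"
      have "vec_brackets a \<subseteq> vec_brackets x"
        using vec_brackets_perturb[OF yx e(2) e(1)] vec_brackets_scale[of 2] by (simp add: a_def)
      then have aB: "a \<in> bcone BS" using xB by (auto simp: bcone_def)
      have bB: "b \<in> bcone BS" using yx xB e(1) vec_brackets_scale[of "2 * e" y] by (auto simp: bcone_def b_def)
      have xab: "x = (1 - 1/2) *\<^sub>R a + (1/2) *\<^sub>R b" by (simp add: a_def b_def algebra_simps)
      have "b \<in> G"
      proof (cases "a = b")
        case True
        then have "x = b" using xab by (simp add: scaleR_left_distrib[symmetric])
        then show ?thesis using x by simp
      next
        case False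
        then have "x \<in> open_segment a b" using xab unfolding in_segment by (intro conjI exI[of _ "1/2"]) auto
        then show ?thesis using G(1) aB bB x(1) unfolding face_of_def by blast
      qed
      then have "(1 / (2 * e)) *\<^sub>R b \<in> G" using conG e(1) by (intro conicD) auto
      then show "y \<in> G" using e(1) by (simp add: b_def)
    qed
  qed
  then show ?thesis ..
qed

section \<open>Collisions\<close>

subsection \<open>The graph of gaps\<close>

text \<open>Closing a gap at \<open>spine k\<close> affects all levels below, so such a gap is adjacent to all gaps below.\<close>

definition gap_adj :: "'m rel" where
  "gap_adj = {(a, b). \<exists>u \<in> {lft a, rgt a}. \<exists>v \<in> {lft b, rgt b}. weak_desc T u v \<or> weak_desc T v u}"

sublocale graph gap_adj
proof
  show "sym gap_adj" unfolding gap_adj_def sym_def by blast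
  show "(a, a) \<in> gap_adj" for a using weak_desc_refl[OF lft_verts] by (auto simp: gap_adj_def)
qed

lemma gap_adjI:
  "u = lft a \<or> u = rgt a \<Longrightarrow> v = lft b \<or> v = rgt b \<Longrightarrow> weak_desc T u v \<or> weak_desc T v u \<Longrightarrow>
    (a, b) \<in> gap_adj"
  unfolding gap_adj_def by blast

lemma end_of_gap:
  assumes "u \<in> verts T" "blk U u \<noteq> {u}"
  obtains g where "g \<in> U" "u = lft g \<or> u = rgt g"
  using blk_eq_singleton_iff assms by blast

lemma br_eq_empty_iff:
  assumes u: "u \<in> verts T"
  shows "br U u = br {} u \<longleftrightarrow> (\<forall>x. weak_desc T u x \<longrightarrow> blk U x = {x})"
proof -
  have "br U u = br {} u \<longleftrightarrow> (\<forall>x \<in> set (path_to T u). blk U x = blk {} x)"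
    unfolding br_def by (simp add: map_eq_conv)
  also have "\<dots> \<longleftrightarrow> (\<forall>x. weak_desc T u x \<longrightarrow> blk U x = blk {} x)"
    using u by (auto simp: weak_desc_def)
  finally show ?thesis using blk_empty weak_desc_in(2) by metis
qed

text \<open>If the component touches one ancestor \<open>x\<close> of \<open>u\<close>, then each
  gap of \<open>U\<close> at any ancestor of \<open>u\<close> is adjacent to it, ancestors being
  comparable. From there the component spreads over the blocks of \<open>U\<close> around all
  ancestors.\<close>

lemma br_conn_comp:
  assumes a: "a \<in> U" and u: "u \<in> verts T"
  shows "br (conn_comp gap_adj U a) u \<in> {br {} u, br U u}"
proof (cases "br (conn_comp gap_adj U a) u = br {} u")
  case False
  let ?N = "conn_comp gap_adj U a"
  have NU: "?N \<subseteq> U" using conn_comp_subset[OF a] .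
  from False obtain x where x: "weak_desc T u x" "blk ?N x \<noteq> {x}" using br_eq_empty_iff[OF u] by blast
  have xv: "x \<in> verts T" using weak_desc_in(2)[OF x(1)] .
  obtain g where g: "g \<in> ?N" "x = lft g \<or> x = rgt g" using end_of_gap[OF xv x(2)] .
  have near: "h \<in> ?N" if "h \<in> U" "(g', h) \<in> gap_adj" "g' \<in> ?N" for g' h
    using conn_comp_step[of g' gap_adj U a h] that NU by blast
  have "blk ?N y = blk U y" if y: "weak_desc T u y" for y
  proof
    have yv: "y \<in> verts T" using weak_desc_in(2)[OF y] .
    show "blk ?N y \<subseteq> blk U y" using blk_mono[OF NU] .
    \<comment> \<open>An end on the path to \<open>u\<close> is comparable with \<open>x\<close>.
      Any other end in the block was reached through a gap of the component and is an end of such a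
      gap itself.\<close>
    have end_in: "h \<in> ?N" if h: "h \<in> U" and e: "e = lft h \<or> e = rgt h" "e \<in> blk ?N y" for h e
    proof (cases "e = y")
      case True
      have "weak_desc T x y \<or> weak_desc T y x"
        using weak_desc_linear[OF x(1) y] weak_desc_linear[OF y x(1)] by linarith
      then have "(g, h) \<in> gap_adj" using g(2) e(1) True by (intro gap_adjI) auto
      then show ?thesis using near h g(1) by blast
    next
      case False
      have ev: "e \<in> verts T" using e(2) blk_verts by blast
      have "y \<in> blk ?N e" using e(2) blk_sym[OF yv] by blast
      then have "blk ?N e \<noteq> {e}" using False by auto
      then obtain g' where g': "g' \<in> ?N" "e = lft g' \<or> e = rgt g'" using end_of_gap[OF ev] by blast
      then have "(g', h) \<in> gap_adj" using e(1) weak_desc_refl[OF ev] by (intro gap_adjI) auto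
      then show ?thesis using near h g'(1) by blast
    qed
    show "blk U y \<subseteq> blk ?N y"
    proof (rule blk_subsetI[OF yv self_in_blk[OF yv]])
      fix h assume h: "h \<in> U"
      show "lft h \<in> blk ?N y \<longleftrightarrow> rgt h \<in> blk ?N y"
        using end_in[OF h] gap_in_blk[OF _ yv] by blast
    qed
  qed
  then have "br ?N u = br U u" unfolding br_def using u by (auto simp: weak_desc_def)
  then show ?thesis by simp
qed simp

lemma br_nonempty_mono:
  "weak_desc T u x \<Longrightarrow> br U x \<noteq> br {} x \<Longrightarrow> br U u \<noteq> br {} u"
  using br_eq_empty_iff weak_desc_in weak_desc_trans by metis

lemma end_br_nonempty: "a \<in> U \<Longrightarrow> u = lft a \<or> u = rgt a \<Longrightarrow> br U u \<noteq> br {} u"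
proof -
  assume a: "a \<in> U" "u = lft a \<or> u = rgt a"
  then have u: "u \<in> verts T" using lft_verts rgt_verts by blast
  then have "blk U u \<noteq> {u}" using blk_eq_singleton_iff a by blast
  then show "br U u \<noteq> br {} u" using br_eq_empty_iff[OF u] weak_desc_refl[OF u] by blast
qed

lemma br_eq_UNIV_gaps:
  assumes "br U u = br UNIV u" "u \<in> verts T" "lev g \<le> vdepth T u"
  shows "g \<in> U"
proof -
  let ?x = "path_to T u ! lev g"
  have x: "?x \<in> level T (lev g)" using path_to_nth_in assms by blast
  then have "blk U ?x = level T (lev g)"
    using arg_cong[OF assms(1), of "\<lambda>l. l ! lev g"] assms(3) by (simp add: br_nth blk_UNIV level_iff)
  then show ?thesis using gap_of_blk[of ?x g U] lft_level rgt_level x by (simp add: level_iff)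
qed

text \<open>At the least level that has gaps, \<open>br_conn_comp\<close> merges the whole level
  inside one component. This includes the spine vertex when there are lower gaps, so all of these
  are joined to the component as well.\<close>

lemma tube_UNIV: "tube gap_adj UNIV"
proof -
  define k where "k = Min (range lev)"
  have "k \<in> range lev" unfolding k_def by (intro Min_in) auto
  then obtain a where a: "lev a = k" by auto
  have k: "k \<le> lev b" for b unfolding k_def by simp
  let ?N = "conn_comp gap_adj UNIV a"
  have aN: "a \<in> ?N" by simp
  have "br ?N (lft a) = br UNIV (lft a)"
    using br_conn_comp[of a UNIV "lft a"] end_br_nonempty[OF aN, of "lft a"] lft_verts by auto
  then have lv: "blk ?N (lft a) = level T k"
    using last_br[OF lft_verts] blk_UNIV a vdepth_lft by metis
  have "b \<in> ?N" for b
  proof -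
    have "br ?N (lft b) \<noteq> br {} (lft b)"
    proof (cases "lev b = k")
      case True
      then have l: "lft b \<in> blk ?N (lft a)" "rgt b \<in> blk ?N (lft a)" using lv lft_level[of b] rgt_level[of b] by auto
      then have "b \<in> ?N" using gap_of_blk[OF lft_verts] by blast
      then show ?thesis using end_br_nonempty by blast
    next
      case False
      then have lt: "k < lev b" using k[of b] by simp
      then have kn: "k < tdepth T" using lev_le[of b] by simp
      have "spine k \<in> blk ?N (lft a)" using spine(1)[OF kn] lv by simp
      then have "blk ?N (spine k) = level T k" using blk_eq[OF lft_verts] lv by metis
      then have "blk ?N (spine k) \<noteq> {spine k}"
        using lft_level[of a] rgt_level[of a] lft_neq_rgt[of a] a by (metis singletonD)
      moreover have "weak_desc T (lft b) (spine k)"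
        using lt vdepth_lft[of b] by (intro weak_desc_spine lft_verts) simp
      ultimately show ?thesis using br_eq_empty_iff[OF lft_verts] by blast
    qed
    then have "br ?N (lft b) = br UNIV (lft b)" using br_conn_comp[of a UNIV "lft b"] lft_verts by auto
    then show "b \<in> ?N" using br_eq_UNIV_gaps lft_verts vdepth_lft by (metis order_refl)
  qed
  then have "?N = UNIV" by blast
  then show ?thesis using tube_conn_comp by metis
qed

subsection \<open>Nontrivial brackets\<close>

lemma vec_brackets_ind:
  "vec_brackets (ind N) = br {} ` verts T \<union> br N ` verts T \<union> br UNIV ` verts T"
proof
  show "vec_brackets (ind N) \<subseteq> br {} ` verts T \<union> br N ` verts T \<union> br UNIV ` verts T"
  proof
    fix A assume "A \<in> vec_brackets (ind N)"
    then obtain c u where u: "A = br {a. c \<le> ind N $ a} u" "u \<in> verts T" by (rule vec_bracketsE)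
    have "{a. c \<le> ind N $ a} = (if c \<le> 0 then UNIV else if c \<le> 1 then N else {})" by auto
    then show "A \<in> br {} ` verts T \<union> br N ` verts T \<union> br UNIV ` verts T" using u by (simp split: if_splits)
  qed
  have "{a. 1 \<le> ind N $ a} = N" by auto
  then have "br N u \<in> vec_brackets (ind N)" if "u \<in> verts T" for u using vec_bracketsI[OF that, of 1 "ind N"] by simp
  then show "br {} ` verts T \<union> br N ` verts T \<union> br UNIV ` verts T \<subseteq> vec_brackets (ind N)"
    using br_empty_in_vec_brackets br_UNIV_in_vec_brackets by blast
qed

lemma is_sing_br_iff: "u \<in> verts T \<Longrightarrow> is_sing T (br U u) \<longleftrightarrow> br U u = br {} u"
proof
  assume u: "u \<in> verts T" and "is_sing T (br U u)"
  then obtain u' where u': "u' \<in> verts T" "br U u = br {} u'" using br_empty by (auto simp: is_sing_def)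
  then have "blk U u = {u'}" using last_br[OF u] last_br[OF u'(1)] blk_empty[OF u'(1)] by metis
  then have "u = u'" using self_in_blk[OF u, of U] by simp
  then show "br U u = br {} u" using u' by simp
qed (auto simp: is_sing_def br_empty)

lemma nontrivial_br_iff:
  "u \<in> verts T \<Longrightarrow> nontrivial T (br U u) \<longleftrightarrow> br U u \<noteq> br {} u \<and> br U u \<noteq> br UNIV u"
proof -
  assume u: "u \<in> verts T"
  have "length (max_br T k) = Suc k" for k by (simp add: max_br_def)
  then have "br U u = max_br T k \<longleftrightarrow> k = vdepth T u \<and> br U u = br UNIV u" for k
    using br_UNIV[OF u] length_br by (metis nat.inject)
  then show ?thesis using is_sing_br_iff[OF u] vdepth_le[OF u] by (auto simp: nontrivial_def)
qed

lemma butlast_pow_br: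
  assumes "u \<in> verts T" "k < vdepth T u"
  shows "(butlast ^^ (vdepth T u - k)) (br U u) = br U (spine k)"
proof -
  have "Suc (vdepth T u) - (vdepth T u - k) = Suc k" using assms by simp
  then show ?thesis using take_br[OF assms] by (simp add: butlast_power)
qed

lemma butlast_pow_br_cases:
  assumes u: "u \<in> verts T" and E: "E = (butlast ^^ l) (br U u)" "E \<noteq> []"
  obtains x where "weak_desc T u x" "E = br U x"
proof (cases "l = 0")
  case True
  then show ?thesis using that[of u] weak_desc_refl[OF u] E by simp
next
  case False
  have "length E = Suc (vdepth T u) - l" unfolding E by (simp add: butlast_power)
  then have l: "l \<le> vdepth T u" using E(2) by (cases "l \<le> vdepth T u") auto
  define k where "k = vdepth T u - l"
  have k: "k < vdepth T u" "l = vdepth T u - k" using False l by (auto simp: k_def)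
  then show ?thesis using that[of "spine k"] weak_desc_spine[OF u k(1)] butlast_pow_br[OF u k(1)] E by simp
qed

text \<open>For a proper \<open>U\<close> the bracket may still be maximum. A gap outside
  \<open>U\<close> then lies strictly deeper, and the bracket around its left end projects to the
  given one without being maximum. This is why collisions use projections of nontrivial
  brackets.\<close>

lemma br_extends_to_nontrivial:
  assumes U: "U \<noteq> UNIV" and u: "u \<in> verts T" and ne: "br U u \<noteq> br {} u"
  obtains u' l where "u' \<in> verts T" "nontrivial T (br U u')" "br U u = (butlast ^^ l) (br U u')"
proof (cases "br U u = br UNIV u")
  case False
  then show ?thesis using that[of u 0] nontrivial_br_iff[OF u] u ne by simp
next
  case True
  obtain g where g: "g \<notin> U" using U by blast
  define k where "k = vdepth T u"
  have kg: "k < vdepth T (lft g)"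
    using br_eq_UNIV_gaps[OF True u] g unfolding k_def vdepth_lft by (meson not_le)
  then have kn: "k < tdepth T" using vdepth_le[OF lft_verts[of g]] by simp
  have "blk U u = level T k" using True last_br[OF u] blk_UNIV k_def by metis
  then have "spine k \<in> blk U u" using spine(1)[OF kn] by simp
  then have eq: "br U (spine k) = br U u" using br_eq[OF u] by simp
  have "br U (spine k) \<noteq> br {} (spine k)"
  proof
    assume *: "br U (spine k) = br {} (spine k)"
    then have "blk U u = {spine k}"
      using eq last_br[OF u] last_br[OF spine_verts[OF kn]] blk_empty[OF spine_verts[OF kn]] by metis
    then have "u = spine k" using self_in_blk[OF u, of U] by simp
    then show False using * ne by simp
  qed
  then have "br U (lft g) \<noteq> br {} (lft g)"
    using br_nonempty_mono[OF weak_desc_spine[OF lft_verts kg]] by blast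
  moreover have "br U (lft g) \<noteq> br UNIV (lft g)"
    using br_eq_UNIV_gaps[of U "lft g" g] g lft_verts vdepth_lft by auto
  ultimately have "nontrivial T (br U (lft g))" using nontrivial_br_iff[OF lft_verts] by simp
  moreover have "br U u = (butlast ^^ (vdepth T (lft g) - k)) (br U (lft g))"
    using butlast_pow_br[OF lft_verts kg] eq by simp
  ultimately show ?thesis using that lft_verts by blast
qed

definition trivial_brackets :: "'v bracket set" where
  "trivial_brackets = br {} ` verts T \<union> br UNIV ` verts T"

lemma trivial_brackets_system: "bracket_system trivial_brackets"
  using bracket_system_vec[of "0 *\<^sub>R 1"] unfolding vec_brackets_const trivial_brackets_def .

lemma nontrivial_not_in_trivial: "u \<in> verts T \<Longrightarrow> nontrivial T (br U u) \<Longrightarrow> br U u \<notin> trivial_brackets"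
proof
  assume u: "u \<in> verts T" "nontrivial T (br U u)" "br U u \<in> trivial_brackets"
  then obtain x V where x: "x \<in> verts T" "br U u = br V x" "V = {} \<or> V = UNIV"
    unfolding trivial_brackets_def by blast
  then have "\<not> nontrivial T (br V x)" using nontrivial_br_iff[OF x(1)] by auto
  then show False using u x by simp
qed

lemma is_minimum_iff:
  assumes "bracket_system BS"
  shows "is_minimum T (BS, left_right BS) \<longleftrightarrow> BS = trivial_brackets"
proof
  assume m: "is_minimum T (BS, left_right BS)"
  then have "br_le (BS, left_right BS) (trivial_brackets, left_right trivial_brackets)"
    using trivial_brackets_system assoc_eq by (auto simp: is_minimum_def)
  then show "BS = trivial_brackets"
    using br_le_left_right trivial_brackets_subset[OF assms] by (auto simp: trivial_brackets_def)
next
  assume "BS = trivial_brackets"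
  then show "is_minimum T (BS, left_right BS)"
    using assms trivial_brackets_subset br_le_left_right
    unfolding is_minimum_def assoc_eq trivial_brackets_def by auto
qed

lemma vec_brackets_ind_nontrivial:
  assumes "U \<noteq> {}" "U \<noteq> UNIV"
  shows "vec_brackets (ind U) \<noteq> trivial_brackets"
proof -
  obtain a where "a \<in> U" using assms by blast
  then have "br U (lft a) \<noteq> br {} (lft a)" using end_br_nonempty by blast
  then obtain u' where "u' \<in> verts T" "nontrivial T (br U u')"
    using br_extends_to_nontrivial[OF assms(2) lft_verts] by metis
  then show ?thesis using nontrivial_not_in_trivial vec_brackets_ind by blast
qed

subsection \<open>Bracketings above the minimum contain a collision\<close>

lemma take_bracket_in:
  assumes BS: "bracket_system BS" and A: "A \<in> BS"
  shows "Suc m \<le> length A \<Longrightarrow> take (Suc m) A \<in> BS"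
proof (induction "length A - Suc m" arbitrary: m)
  case 0
  then show ?case using A by simp
next
  case (Suc j)
  then have l: "Suc (Suc m) \<le> length A" by simp
  then have "take (Suc (Suc m)) A \<in> BS" using Suc by simp
  moreover have "length (take (Suc (Suc m)) A) = Suc (Suc m)" using l by simp
  ultimately have "butlast (take (Suc (Suc m)) A) \<in> BS" using bracket_systemD(4)[OF BS] by simp
  then show ?case using l by (simp add: butlast_take)
qed

lemma last_take_Suc: "Suc m \<le> length A \<Longrightarrow> last (take (Suc m) A) = A ! m"
  by (simp add: take_Suc_conv_app_nth)

text \<open>\<open>M\<close> consists of the minimal brackets over \<open>D\<close>, except that those inside the at most one member of
  \<open>\<A>\<close> are replaced by it.\<close>

lemma partition_over:
  assumes BS: "bracket_system BS" and D: "D \<in> BS" "length D = Suc k" "spine k \<in> last D" and k: "k < tdepth T"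
    and A': "\<And>A'. A' \<in> \<A> \<Longrightarrow> A' \<in> over BS D" and one: "\<And>X Y. X \<in> \<A> \<Longrightarrow> Y \<in> \<A> \<Longrightarrow> X = Y"
  obtains M where "M \<subseteq> over BS D" "\<A> \<subseteq> M"
    "\<forall>X \<in> M. \<forall>Y \<in> M. last X \<inter> last Y \<noteq> {} \<longrightarrow> X = Y"
    "\<forall>u \<in> level T (Suc k). \<exists>X \<in> M. u \<in> last X"
proof -
  define M where "M = \<A> \<union>
    {X \<in> over BS D. (\<forall>Y \<in> over BS D. \<not> bpsub Y X) \<and> (\<forall>A' \<in> \<A>. last X \<inter> last A' = {})}"
  have cmp: "bpsub X Y \<or> bpsub Y X \<or> X = Y"
    if "X \<in> over BS D" "Y \<in> over BS D" "last X \<inter> last Y \<noteq> {}" for X Y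
    using that bracket_systemD(5)[OF BS, of X Y] unfolding over_def bpsub_def by auto
  show ?thesis
  proof (rule that[of M])
    show "M \<subseteq> over BS D" using A' by (auto simp: M_def)
    show "\<A> \<subseteq> M" by (auto simp: M_def)
    have "X = Y" if "X \<in> M" "Y \<in> M" "last X \<inter> last Y \<noteq> {}" for X Y
      using that one[of X Y] cmp[of X Y] unfolding M_def by blast
    then show "\<forall>X \<in> M. \<forall>Y \<in> M. last X \<inter> last Y \<noteq> {} \<longrightarrow> X = Y" by blast
    show "\<forall>u \<in> level T (Suc k). \<exists>X \<in> M. u \<in> last X"
    proof
      fix u assume u: "u \<in> level T (Suc k)"
      have "u \<in> (\<Union>x\<in>last D. ch T x)" using ch_spine[OF k] u D(3) by blast
      then have "u \<in> (\<Union>X\<in>over BS D. last X)" using bracket_systemD(6)[OF BS D(1)] D(2) k by simp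
      then obtain X0 where X0: "X0 \<in> over BS D \<and> u \<in> last X0" by blast
      \<comment> \<open>The top is smallest among those containing \<open>u\<close>. By (4b) nothing
        over \<open>D\<close> lies strictly inside such an \<open>X\<close>, since otherwise a
        smaller bracket would contain \<open>u\<close>.\<close>
      obtain X where X: "X \<in> over BS D" "u \<in> last X"
        "\<And>Y. Y \<in> over BS D \<Longrightarrow> u \<in> last Y \<Longrightarrow> card (last X) \<le> card (last Y)"
        using ex_has_least_nat[of "\<lambda>X. X \<in> over BS D \<and> u \<in> last X" X0 "\<lambda>X. card (last X)"] X0 by blast
      have min: "\<not> bpsub Y X" if Y: "Y \<in> over BS D" for Y
      proof
        assume "bpsub Y X"
        then obtain Z where Z: "Z \<in> over BS D" "bpsub Z X" "u \<in> last Z"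
          using bracket_systemD(7)[OF BS D(1) X(1) Y _ X(2)] by blast
        have ne: "Z \<noteq> []" "X \<noteq> []" "butlast Z = butlast X" using Z(1) X(1) by (auto simp: over_def)
        then have sub: "last Z \<subseteq> last X" using Z(2) bsub_last unfolding bpsub_def by blast
        have "X \<in> BS" using X(1) by (simp add: over_def)
        then obtain j where "is_bracket T j X" using bracket_systemD(1)[OF BS] by blast
        then have "last X \<subseteq> level T j" using bracket_top_level by blast
        then have "finite (last X)" by (rule finite_subset) simp
        then have "last Z = last X" using sub X(3)[OF Z(1,3)] by (intro card_seteq) auto
        then have "Z = X" using ne by (metis append_butlast_last_id)
        then show False using Z(2) by (simp add: bpsub_def)
      qed
      show "\<exists>X \<in> M. u \<in> last X"
      proof (cases "\<exists>A' \<in> \<A>. last X \<inter> last A' \<noteq> {}")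
        case False
        then show ?thesis using X min by (auto simp: M_def)
      next
        case True
        then obtain A' where a: "A' \<in> \<A>" "last X \<inter> last A' \<noteq> {}" by blast
        then have "bsub X A'" using cmp[OF X(1) A'[OF a(1)]] min[OF A'[OF a(1)]] bsub_refl by (auto simp: bpsub_def)
        moreover have "X \<noteq> []" using X(1) by (auto simp: over_def)
        ultimately have "u \<in> last A'" using bsub_last X(2) by blast
        then show ?thesis using a by (auto simp: M_def)
      qed
    qed
  qed
qed

text \<open>A bracketing may contain many brackets around a vertex. The gap set is built level by
  level, by choosing a partition of the next level into brackets over the current one that respects
  \<open>A\<close>.\<close>

lemma exists_family:
  assumes BS: "bracket_system BS" and A: "A \<in> BS"
  shows "\<exists>U. (\<forall>u \<in> verts T. br U u \<in> BS) \<and> (\<exists>u \<in> verts T. br U u = A)"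
proof -
  obtain K where K: "is_bracket T K A" using bracket_systemD(1)[OF BS A] by blast
  note KD = bracketD[OF K]
  have lA: "length A = Suc K" using KD(3) .
  have Ax: "A ! i \<subseteq> level T i" if "i \<le> K" for i using convex_in_subset[OF KD(2)[OF that]] .
  have Ane: "A ! i \<noteq> {}" if "i \<le> K" for i using that KD(1)[of i] KD(4,5) by (cases "i = K") auto
  \<comment> \<open>The index \<open>min k K\<close> freezes the condition on \<open>A\<close> once
    its own level \<open>K\<close> has been passed.\<close>
  have "\<exists>U. (\<forall>u \<in> verts T. vdepth T u \<le> k \<longrightarrow> br U u \<in> BS) \<and>
      (\<forall>x \<in> A ! min k K. br U x = take (Suc (min k K)) A)" if "k \<le> tdepth T" for k
    using that
  proof (induction k)
    case 0
    have "A ! 0 = {troot T}" using Ax[of 0] Ane[of 0] level_0 by auto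
    moreover have "br {} (troot T) = [{troot T}]"
      using vdepth_eq_0_iff[of "troot T"] blk_empty by (simp add: br_eq_snoc)
    moreover have "take (Suc 0) A = [A ! 0]" using lA by (cases A) auto
    ultimately show ?case
      using bracket_systemD(3)[OF BS] br_empty by (intro exI[of _ "{}"]) auto
  next
    case (Suc k)
    then have kn: "k < tdepth T" by simp
    from Suc obtain U where U: "\<And>u. u \<in> verts T \<Longrightarrow> vdepth T u \<le> k \<Longrightarrow> br U u \<in> BS"
      "\<And>x. x \<in> A ! min k K \<Longrightarrow> br U x = take (Suc (min k K)) A" by auto
    let ?D = "br U (spine k)"
    have D: "?D \<in> BS" "length ?D = Suc k" "spine k \<in> last ?D"
      using U(1)[OF spine_verts[OF kn]] spine_depth[OF kn] spine_verts[OF kn] by auto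
    let ?A' = "take (Suc (Suc k)) A"
    \<comment> \<open>At most one prescribed member: the truncation of \<open>A\<close> while its
      levels last, none below them.\<close>
    define \<A> where "\<A> = {X. X = ?A' \<and> k < K}"
    have A': "X \<in> over BS ?D" if "X \<in> \<A>" for X
    proof -
      have X: "X = ?A'" "k < K" using that by (auto simp: \<A>_def)
      then have "spine k \<in> A ! min k K" using KD(1) by simp
      then have "?D = take (Suc k) A" using U(2) X(2) by (simp add: min_def)
      then show ?thesis using X lA take_bracket_in[OF BS A, of "Suc k"]
        by (simp add: over_def butlast_take)
    qed
    have one: "X = Y" if "X \<in> \<A>" "Y \<in> \<A>" for X Y using that by (simp add: \<A>_def)
    obtain M where M: "M \<subseteq> over BS ?D" "\<A> \<subseteq> M"
      "\<forall>X \<in> M. \<forall>Y \<in> M. last X \<inter> last Y \<noteq> {} \<longrightarrow> X = Y"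
      "\<forall>u \<in> level T (Suc k). \<exists>X \<in> M. u \<in> last X"
      by (rule partition_over[OF BS D kn A' one])
    \<comment> \<open>Earlier levels are kept. In the new level exactly the gaps inside members of
      the partition are closed, so that its blocks are their tops.\<close>
    define U' where "U' = {a \<in> U. lev a \<le> k} \<union>
      {a. lev a = Suc k \<and> (\<exists>X \<in> M. lft a \<in> last X \<and> rgt a \<in> last X)}"
    have low: "br U' u = br U u" if "u \<in> verts T" "vdepth T u \<le> k" for u
      using that by (intro br_cong) (auto simp: U'_def)
    have top: "br U' u = X" if X: "X \<in> M" "u \<in> last X" for u X
    proof -
      have XB: "X \<in> BS" "length X = Suc (Suc k)" "butlast X = ?D"
        using X(1) M(1) D(2) by (auto simp: over_def)
      then obtain j where j: "is_bracket T j X" using bracket_systemD(1)[OF BS] by blast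
      then have "j = Suc k" using bracketD(3)[OF j] XB by simp
      then have cv: "convex_in (Suc k) (last X)" using bracketD(2,4)[OF j] by simp
      then have u: "u \<in> level T (Suc k)" using convex_in_subset X(2) by blast
      have "blk U' u = last X"
      proof (rule blk_eq_convexI[OF cv X(2)])
        fix a assume "lev a = Suc k" "a \<in> U'"
        then obtain Y where "Y \<in> M" "lft a \<in> last Y" "rgt a \<in> last Y" by (auto simp: U'_def)
        then show "lft a \<in> last X \<longleftrightarrow> rgt a \<in> last X" using M(3) X(1) by blast
      next
        fix a assume "lev a = Suc k" "lft a \<in> last X" "rgt a \<in> last X"
        then show "a \<in> U'" using X(1) by (auto simp: U'_def)
      qed
      moreover have "butlast (br U' u) = ?D"
        using butlast_br[OF u] low[OF spine_verts[OF kn]] spine_depth[OF kn] by simp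
      moreover have "u \<in> verts T" using u by (simp add: level_iff)
      ultimately show ?thesis
        using XB by (metis append_butlast_last_id last_br length_br length_0_conv nat.distinct(1))
    qed
    have "br U' u \<in> BS" if u: "u \<in> verts T" "vdepth T u \<le> Suc k" for u
    proof (cases "vdepth T u = Suc k")
      case True
      then have "u \<in> level T (Suc k)" using u by (simp add: level_iff)
      then obtain X where X: "X \<in> M" "u \<in> last X" using M(4) by blast
      then have "X \<in> BS" using M(1) by (auto simp: over_def)
      then show ?thesis using top[OF X] by simp
    qed (use u low U(1) in auto)
    moreover have "br U' x = take (Suc (min (Suc k) K)) A" if x: "x \<in> A ! min (Suc k) K" for x
    proof (cases "k < K")
      case True
      then have "?A' \<in> M" "last ?A' = A ! Suc k" using M(2) lA last_take_Suc[of "Suc k" A] by (auto simp: \<A>_def)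
      then show ?thesis using top[of ?A' x] x True by (simp add: min_def)
    next
      case False
      then have "x \<in> A ! K" using x by (simp add: min_def)
      then have xl: "x \<in> level T K" using Ax by blast
      have "min k K = K" "min (Suc k) K = K" using False by auto
      then have "br U x = take (Suc K) A" using U(2)[of x] \<open>x \<in> A ! K\<close> by simp
      then show ?thesis using low[of x] xl False \<open>min (Suc k) K = K\<close> by (simp add: level_iff)
    qed
    ultimately show ?case by blast
  qed
  from this[of "tdepth T"] obtain U where U: "\<forall>u \<in> verts T. vdepth T u \<le> tdepth T \<longrightarrow> br U u \<in> BS"
    "\<forall>x \<in> A ! min (tdepth T) K. br U x = take (Suc (min (tdepth T) K)) A" by auto
  have "min (tdepth T) K = K" using KD(6) by simp
  then have 1: "\<forall>x \<in> A ! K. br U x = A" using U(2) lA by simp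
  obtain x where x: "x \<in> A ! K" using Ane by blast
  then have "x \<in> verts T" using Ax[of K] by (auto simp: level_iff)
  then show ?thesis using U(1) vdepth_le 1 x by (intro exI[of _ U]) blast
qed

text \<open>A gap set representing a bracket outside the minimum is neither empty nor everything.
  Passing to one of its components creates only brackets already present or singletons.\<close>

lemma tube_below:
  assumes BS: "bracket_system BS" and ne: "BS \<noteq> trivial_brackets"
  obtains N where "tube gap_adj N" "N \<noteq> UNIV" "vec_brackets (ind N) \<subseteq> BS"
proof -
  have tr: "trivial_brackets \<subseteq> BS" using trivial_brackets_subset[OF BS] by (simp add: trivial_brackets_def)
  then obtain A where A: "A \<in> BS" "A \<notin> trivial_brackets" using ne by blast
  then obtain U u where U: "\<forall>u \<in> verts T. br U u \<in> BS" "u \<in> verts T" "br U u = A"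
    using exists_family[OF BS A(1)] by blast
  then have "U \<noteq> {}" "U \<noteq> UNIV" using A(2) by (auto simp: trivial_brackets_def)
  then obtain a where a: "a \<in> U" by blast
  let ?N = "conn_comp gap_adj U a"
  have "?N \<noteq> UNIV" using conn_comp_subset[OF a, of gap_adj] \<open>U \<noteq> UNIV\<close> by blast
  moreover have "br ?N x \<in> BS" if "x \<in> verts T" for x
    using br_conn_comp[OF a that] U(1) tr that by (auto simp: trivial_brackets_def)
  then have "vec_brackets (ind ?N) \<subseteq> BS"
    using tr unfolding vec_brackets_ind trivial_brackets_def by blast
  ultimately show ?thesis using that tube_conn_comp by blast
qed

lemma br_eqD: "br U u = br U' u \<Longrightarrow> weak_desc T u x \<Longrightarrow> blk U x = blk U' x"
  unfolding br_def weak_desc_def by (simp add: map_eq_conv)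

text \<open>Bracketings of different proper tubes are incomparable, which makes them atoms. The two
  sets agree wherever \<open>N'\<close> is felt, and connectedness of \<open>N\<close> leaves no
  room for further gaps.\<close>

lemma vec_brackets_tube_eq:
  assumes N: "tube gap_adj N" and N': "tube gap_adj N'" "N' \<noteq> UNIV"
    and sub: "vec_brackets (ind N') \<subseteq> vec_brackets (ind N)"
  shows "N' = N"
proof -
  have three: "br N' u \<in> {br {} u, br N u, br UNIV u}" if u: "u \<in> verts T" for u
  proof -
    have "br N' u \<in> vec_brackets (ind N)" using sub vec_brackets_ind u by blast
    then obtain V x where x: "x \<in> verts T" "V \<in> {{}, N, UNIV}" "br N' u = br V x"
      unfolding vec_brackets_ind by blast
    then have "blk N' u = blk V x" using last_br u by metis
    then have "u \<in> blk V x" using self_in_blk u by metis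
    then have "br V x = br V u" using br_eq[OF x(1)] by simp
    then show ?thesis using x by auto
  qed
  \<comment> \<open>\<open>three\<close> still allows a maximum bracket. A nontrivial extension
    excludes this case, and projecting back gives the equality.\<close>
  have eq: "br N' u = br N u" if u: "u \<in> verts T" and ne: "br N' u \<noteq> br {} u" for u
  proof -
    obtain u' l where u': "u' \<in> verts T" "nontrivial T (br N' u')" "br N' u = (butlast ^^ l) (br N' u')"
      using br_extends_to_nontrivial[OF N'(2) u ne] .
    then have "br N' u' = br N u'" using three[OF u'(1)] nontrivial_br_iff[OF u'(1)] by auto
    then have *: "br N' u = (butlast ^^ l) (br N u')" using u'(3) by simp
    have "br N' u \<noteq> []" by (metis length_br list.size(3) nat.distinct(1))
    then obtain x where x: "weak_desc T u' x" "br N' u = br N x"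
      using butlast_pow_br_cases[OF u'(1) *] by blast
    have xv: "x \<in> verts T" using weak_desc_in(2)[OF x(1)] .
    have "blk N' u = blk N x" using x(2) last_br[OF u] last_br[OF xv] by metis
    then have "u \<in> blk N x" using self_in_blk[OF u, of N'] by simp
    then show ?thesis using br_eq[OF xv] x(2) by simp
  qed
  have mem: "c \<in> N' \<longleftrightarrow> c \<in> N" if v: "v = lft c \<or> v = rgt c" "br N' v \<noteq> br {} v" for c v
  proof -
    have vv: "v \<in> verts T" using v lft_verts rgt_verts by blast
    have b: "blk N' v = blk N v" using br_eqD[OF eq[OF vv v(2)] weak_desc_refl[OF vv]] .
    have "c \<in> V \<longleftrightarrow> lft c \<in> blk V v \<and> rgt c \<in> blk V v" for V
      using v(1) gap_of_blk[OF vv] gap_in_blk[OF _ vv] self_in_blk[OF vv] by blast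
    then show ?thesis using b by simp
  qed
  have N'N: "N' \<subseteq> N" using mem end_br_nonempty by blast
  have "N' \<noteq> {}" using N'(1) by (simp add: tube_def)
  then obtain a where a: "a \<in> N'" "a \<in> N" using N'N by blast
  \<comment> \<open>An edge from a gap of \<open>N'\<close> leads to an ancestor, where equal
    brackets have equal blocks, or to a descendant, where the bracket of \<open>N'\<close> is again
    not a singleton.\<close>
  have "N \<subseteq> N'"
  proof (rule tube_closed_eq[OF N a(2,1)])
    fix b c assume b: "b \<in> N'" "b \<in> N" and c: "c \<in> N" and "(b, c) \<in> gap_adj"
    then obtain u v where uv: "u = lft b \<or> u = rgt b" "v = lft c \<or> v = rgt c"
      "weak_desc T u v \<or> weak_desc T v u" unfolding gap_adj_def by blast
    have ne: "br N' u \<noteq> br {} u" using end_br_nonempty[OF b(1) uv(1)] .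
    have v: "v \<in> verts T" and u: "u \<in> verts T" using uv lft_verts rgt_verts by blast+
    from uv(3) show "c \<in> N'"
    proof
      assume d: "weak_desc T u v"
      have "blk N' v = blk N v" using br_eqD[OF eq[OF u ne] d] .
      moreover have "lft c \<in> blk N v \<and> rgt c \<in> blk N v" using uv(2) c gap_in_blk[OF c v] self_in_blk[OF v] by blast
      ultimately show ?thesis using gap_of_blk[OF v] by blast
    next
      assume d: "weak_desc T v u"
      then show ?thesis using mem[OF uv(2)] br_nonempty_mono[OF d ne] c by blast
    qed
  qed
  with N'N show ?thesis by blast
qed

section \<open>Collisions as proper tubes\<close>

definition coll :: "'m set \<Rightarrow> 'v bracketing" where
  "coll N = (vec_brackets (ind N), left_right (vec_brackets (ind N)))"

lemma collisions_eq: "collisions T = coll ` {N. tube gap_adj N \<and> N \<noteq> UNIV}"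
proof (intro equalityI subsetI)
  fix C assume "C \<in> collisions T"
  then have C: "C \<in> assoc T" "\<not> is_minimum T C"
    "\<And>B. B \<in> assoc T \<Longrightarrow> \<not> is_minimum T B \<Longrightarrow> br_le B C \<Longrightarrow> B = C" by (auto simp: collisions_def)
  then obtain BS where BS: "bracket_system BS" "C = (BS, left_right BS)" by (auto simp: assoc_eq)
  then have "BS \<noteq> trivial_brackets" using C(2) is_minimum_iff by blast
  then obtain N where N: "tube gap_adj N" "N \<noteq> UNIV" "vec_brackets (ind N) \<subseteq> BS"
    using tube_below BS(1) by blast
  have "N \<noteq> {}" using N(1) by (simp add: tube_def)
  then have "\<not> is_minimum T (coll N)"
    using is_minimum_iff[OF bracket_system_vec] vec_brackets_ind_nontrivial N(2) by (simp add: coll_def)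
  moreover have "coll N \<in> assoc T" using bracket_system_vec by (auto simp: assoc_eq coll_def)
  moreover have "br_le (coll N) C" using N(3) BS(2) by (simp add: coll_def br_le_left_right)
  ultimately have "coll N = C" using C(3) by blast
  then show "C \<in> coll ` {N. tube gap_adj N \<and> N \<noteq> UNIV}" using N by blast
next
  fix C assume "C \<in> coll ` {N. tube gap_adj N \<and> N \<noteq> UNIV}"
  then obtain N where N: "tube gap_adj N" "N \<noteq> UNIV" "C = coll N" by blast
  have "N \<noteq> {}" using N(1) by (simp add: tube_def)
  then have "\<not> is_minimum T C"
    using is_minimum_iff[OF bracket_system_vec] vec_brackets_ind_nontrivial N(2,3) by (simp add: coll_def)
  moreover have "C \<in> assoc T" using bracket_system_vec N(3) by (auto simp: assoc_eq coll_def)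
  moreover have "B = C" if B: "B \<in> assoc T" "\<not> is_minimum T B" "br_le B C" for B
  proof -
    obtain BS where BS: "bracket_system BS" "B = (BS, left_right BS)" using B(1) by (auto simp: assoc_eq)
    then have sub: "BS \<subseteq> vec_brackets (ind N)" using B(3) N(3) by (simp add: coll_def br_le_left_right)
    have "BS \<noteq> trivial_brackets" using B(2) BS is_minimum_iff by blast
    then obtain N' where N': "tube gap_adj N'" "N' \<noteq> UNIV" "vec_brackets (ind N') \<subseteq> BS"
      using tube_below BS(1) by blast
    then have "N' = N" using vec_brackets_tube_eq[OF N(1) N'(1,2)] sub by blast
    then have "BS = vec_brackets (ind N)" using N'(3) sub by blast
    then show ?thesis using BS N(3) by (simp add: coll_def)
  qed
  ultimately show "C \<in> collisions T" by (simp add: collisions_def)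
qed

lemma coll_inj:
  assumes "tube gap_adj N" "tube gap_adj N'" "N' \<noteq> UNIV" "coll N' = coll N"
  shows "N' = N"
  using vec_brackets_tube_eq[OF assms(1-3)] assms(4) by (simp add: coll_def)

lemma coll_le_iff: "br_le (coll N) (BS, left_right BS) \<longleftrightarrow> vec_brackets (ind N) \<subseteq> BS"
  by (simp add: coll_def br_le_left_right)

text \<open>For \<open>v\<close> in the cone, \<open>br_conn_comp\<close> shows that the components
  of its superlevel sets give collisions below the bracketing, and \<open>in_cone_sup_tubes\<close>
  writes \<open>v\<close> in terms of their indicators.\<close>

lemma cone_ones_colls:
  assumes BS: "bracket_system BS"
  shows "cone_ones (ind ` {N. tube gap_adj N \<and> N \<noteq> UNIV \<and> vec_brackets (ind N) \<subseteq> BS}) = bcone BS"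
proof
  show "cone_ones (ind ` {N. tube gap_adj N \<and> N \<noteq> UNIV \<and> vec_brackets (ind N) \<subseteq> BS}) \<subseteq> bcone BS"
    using const_in_bcone[OF BS] by (intro cone_ones_minimal convex_cone_bcone BS) (auto simp: bcone_def)
  show "bcone BS \<subseteq> cone_ones (ind ` {N. tube gap_adj N \<and> N \<noteq> UNIV \<and> vec_brackets (ind N) \<subseteq> BS})"
  proof
    fix v assume v: "v \<in> bcone BS"
    have "sup_tubes v \<subseteq> {N. tube gap_adj N \<and> N \<noteq> UNIV \<and> vec_brackets (ind N) \<subseteq> BS}"
    proof
      fix N assume "N \<in> sup_tubes v"
      then obtain c a where N: "N \<noteq> UNIV" "a \<in> {b. c \<le> v $ b}" "N = conn_comp gap_adj {b. c \<le> v $ b} a"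
        unfolding sup_tubes_def by blast
      have "br N u \<in> BS" if u: "u \<in> verts T" for u
      proof -
        have "br {b. c \<le> v $ b} u \<in> BS" using v vec_bracketsI[OF u] by (auto simp: bcone_def)
        moreover have "br {} u \<in> BS" using trivial_brackets_subset[OF BS] u by blast
        ultimately show ?thesis using br_conn_comp[OF N(2) u] N(3) by auto
      qed
      then have "vec_brackets (ind N) \<subseteq> BS"
        using trivial_brackets_subset[OF BS] unfolding vec_brackets_ind by blast
      then show "N \<in> {N. tube gap_adj N \<and> N \<noteq> UNIV \<and> vec_brackets (ind N) \<subseteq> BS}"
        using N tube_conn_comp by simp
    qed
    then show "v \<in> cone_ones (ind ` {N. tube gap_adj N \<and> N \<noteq> UNIV \<and> vec_brackets (ind N) \<subseteq> BS})"
      using in_cone_sup_tubes cone_ones_mono[OF image_mono] by blast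
  qed
qed

subsection \<open>The fusion bracket of a collision\<close>

text \<open>\<open>s\<close> is an end of a gap of lowest level, so \<open>blk N s\<close> is the top of the fusion bracket.\<close>

lemma tube_base:
  assumes N: "tube gap_adj N"
  obtains s where "s \<in> verts T" "blk N s \<noteq> {s}"
    "\<forall>u \<in> verts T. br N u \<noteq> br {} u \<longleftrightarrow> (\<exists>x \<in> blk N s. weak_desc T u x)"
proof -
  have "N \<noteq> {}" using N by (simp add: tube_def)
  define k where "k = Min (lev ` N)"
  have "k \<in> lev ` N" unfolding k_def using \<open>N \<noteq> {}\<close> by (intro Min_in) auto
  then obtain a where a: "a \<in> N" "lev a = k" by auto
  have k: "k \<le> lev g" if "g \<in> N" for g using that by (simp add: k_def)
  define s where "s = lft a"
  have s: "s \<in> verts T" "vdepth T s = k" using lft_verts vdepth_lft a by (simp_all add: s_def)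
  have sW: "s \<in> blk N s" "rgt a \<in> blk N s" using s self_in_blk rgt_in_blk_lft a by (auto simp: s_def)
  have Wd: "vdepth T x = k" if "x \<in> blk N s" for x using that blk_vdepth s(2) by simp
  define IB where "IB = {u. \<exists>x \<in> blk N s. weak_desc T u x}"
  \<comment> \<open>No edge of \<open>N\<close> leaves the part below the block: the new end is
    comparable with a vertex below some \<open>x\<close> of the block, and as its depth is at least
    \<open>k\<close> it lies below \<open>x\<close> too.\<close>
  have "N \<subseteq> {g. lft g \<in> IB \<and> rgt g \<in> IB}"
  proof (rule tube_closed_eq[OF N a(1)])
    show "a \<in> {g. lft g \<in> IB \<and> rgt g \<in> IB}"
      using sW weak_desc_refl lft_verts rgt_verts unfolding IB_def s_def by blast
  next
    fix b c assume b: "b \<in> {g. lft g \<in> IB \<and> rgt g \<in> IB}" and c: "c \<in> N" and "(b, c) \<in> gap_adj"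
    then obtain u v where uv: "u = lft b \<or> u = rgt b" "v = lft c \<or> v = rgt c"
      "weak_desc T u v \<or> weak_desc T v u" unfolding gap_adj_def by blast
    have v: "v \<in> verts T" "vdepth T v = lev c" using uv(2) lft_verts rgt_verts vdepth_lft vdepth_rgt by auto
    have "u \<in> IB" using uv(1) b by auto
    then obtain x where x: "x \<in> blk N s" "weak_desc T u x" by (auto simp: IB_def)
    have vx: "weak_desc T v x"
      using uv(3)
    proof
      assume "weak_desc T u v"
      then show ?thesis using weak_desc_linear[OF x(2)] Wd[OF x(1)] k[OF c] v(2) by simp
    qed (use x weak_desc_trans in blast)
    have "w \<in> IB" if w: "w \<in> verts T" "vdepth T w = lev c" "w \<in> blk N v" for w
      using vx
    proof (cases rule: weak_descE)
      case 1
      then have "w \<in> blk N s" using x(1) w(3) blk_trans by blast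
      then show ?thesis using weak_desc_refl[OF w(1)] by (auto simp: IB_def)
    next
      case (2 i)
      then have "weak_desc T w x" using weak_desc_spine[OF w(1)] w(2) v(2) by simp
      then show ?thesis using x(1) by (auto simp: IB_def)
    qed
    moreover have "lft c \<in> blk N v" "rgt c \<in> blk N v"
      using uv(2) gap_in_blk[OF c v(1)] self_in_blk[OF v(1), of N] by blast+
    ultimately show "c \<in> {g. lft g \<in> IB \<and> rgt g \<in> IB}"
      using lft_verts rgt_verts vdepth_lft vdepth_rgt by simp
  qed
  then have ends: "x \<in> IB" if "g \<in> N" "x = lft g \<or> x = rgt g" for g x using that by auto
  have "br N u \<noteq> br {} u \<longleftrightarrow> (\<exists>x \<in> blk N s. weak_desc T u x)" if u: "u \<in> verts T" for u
  proof
    assume "br N u \<noteq> br {} u"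
    then obtain x where x: "weak_desc T u x" "blk N x \<noteq> {x}" using br_eq_empty_iff[OF u] by blast
    then obtain g where "g \<in> N" "x = lft g \<or> x = rgt g" using end_of_gap weak_desc_in(2) by metis
    then have "x \<in> IB" using ends by blast
    then show "\<exists>x \<in> blk N s. weak_desc T u x" using x(1) weak_desc_trans by (auto simp: IB_def)
  next
    assume "\<exists>x \<in> blk N s. weak_desc T u x"
    then obtain x where x: "x \<in> blk N s" "weak_desc T u x" by blast
    have "blk N x = blk N s" using blk_eq[OF s(1) x(1)] .
    then have "blk N x \<noteq> {x}" using sW lft_neq_rgt[of a] by (auto simp: s_def)
    then show "br N u \<noteq> br {} u" using br_eq_empty_iff[OF u] x(2) by blast
  qed
  moreover have "blk N s \<noteq> {s}" using sW lft_neq_rgt[of a] by (auto simp: s_def)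
  ultimately show ?thesis using that s(1) by blast
qed

end

text \<open>Fixes what \<open>tube_base\<close> delivers for a proper tube. The vertices with
  nonsingleton bracket \<open>br N u\<close> are those at or below the block of \<open>s\<close>,
  which is the part that the contraction replaces.\<close>

locale based_tube = gap_tree T idx for T :: "'v tree" and idx :: "'m::finite \<Rightarrow> nat \<times> nat" +
  fixes N :: "'m set" and s :: 'v
  assumes proper: "N \<noteq> UNIV" and s_in: "s \<in> verts T" and s_blk: "blk N s \<noteq> {s}"
    and base: "u \<in> verts T \<Longrightarrow> br N u \<noteq> br {} u \<longleftrightarrow> (\<exists>x \<in> blk N s. weak_desc T u x)"
begin

abbreviation "IB \<equiv> in_or_below T (blk N s)"

lemma IB_iff: "u \<in> verts T \<Longrightarrow> u \<in> IB \<longleftrightarrow> br N u \<noteq> br {} u"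
  using base by (auto simp: in_or_below_def)

lemma IB_verts: "u \<in> IB \<Longrightarrow> u \<in> verts T"
  using weak_desc_in by (auto simp: in_or_below_def)

lemma IB_depth: "u \<in> IB \<Longrightarrow> vdepth T s \<le> vdepth T u"
  using weak_desc_vdepth blk_vdepth by (fastforce simp: in_or_below_def)

lemma blk_subset_IB: "u \<in> blk N s \<Longrightarrow> u \<in> IB"
  unfolding in_or_below_def using weak_desc_refl[OF blk_verts] by blast

lemma IB_same_depth: "u \<in> IB \<Longrightarrow> vdepth T u = vdepth T s \<Longrightarrow> u \<in> blk N s"
  unfolding in_or_below_def using blk_vdepth by (auto elim!: weak_descE)

lemma IB_below:
  assumes "u \<in> IB" "vdepth T u \<noteq> vdepth T s"
  shows "spine (vdepth T s) \<in> blk N s" "vdepth T s < vdepth T u"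
proof -
  obtain x where x: "x \<in> blk N s" "weak_desc T u x" using assms(1) by (auto simp: in_or_below_def)
  have d: "vdepth T x = vdepth T s" using blk_vdepth[OF x(1)] .
  from x(2) have "x = spine (vdepth T s) \<and> vdepth T s < vdepth T u"
    using assms(2) d by (cases rule: weak_descE) auto
  then show "spine (vdepth T s) \<in> blk N s" "vdepth T s < vdepth T u" using x(1) by auto
qed

lemma IB_spine:
  assumes u: "u \<in> IB" "vdepth T u \<noteq> vdepth T s" and i: "vdepth T u = Suc i"
  shows "spine i \<in> IB"
proof (cases "i = vdepth T s")
  case True
  then show ?thesis using IB_below(1)[OF u] blk_subset_IB by simp
next
  case False
  have iN: "i < tdepth T" using i vdepth_le[OF IB_verts[OF u(1)]] by simp
  have "vdepth T s < vdepth T (spine i)" using False IB_below(2)[OF u] i spine_depth[OF iN] by simp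
  then show ?thesis
    using weak_desc_spine[OF spine_verts[OF iN]] IB_below(1)[OF u] by (auto simp: in_or_below_def)
qed

text \<open>Everything below the fusion level hangs from its spine vertex, so there the contraction
  affects a whole level or nothing of it.\<close>

lemma IB_level:
  assumes "u \<in> IB" "vdepth T u \<noteq> vdepth T s" "v \<in> verts T" "vdepth T v = vdepth T u"
  shows "v \<in> IB"
  using IB_below[OF assms(1,2)] weak_desc_spine[OF assms(3)] assms(4)
  by (auto simp: in_or_below_def)

lemma IB_desc: "u \<in> IB \<Longrightarrow> weak_desc T v u \<Longrightarrow> v \<in> IB"
  using weak_desc_trans by (auto simp: in_or_below_def)

lemma s_depth: obtains j where "vdepth T s = Suc j" "j < tdepth T" "s \<in> level T (Suc j)"
proof -
  have "vdepth T s \<noteq> 0"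
  proof
    assume "vdepth T s = 0"
    then have "blk N s \<subseteq> {s}" using blk_level[of N s] level_0 vdepth_eq_0_iff[OF s_in] by auto
    then show False using s_blk self_in_blk[OF s_in, of N] by blast
  qed
  then obtain j where "vdepth T s = Suc j" by (cases "vdepth T s") auto
  then show ?thesis using that[of j] vdepth_le[OF s_in] s_in by (simp add: level_iff)
qed

lemma not_IB_blk: "u \<in> verts T \<Longrightarrow> u \<notin> IB \<Longrightarrow> blk N u = {u}"
  using IB_iff br_eq_empty_iff weak_desc_refl by blast

lemma from_nontrivial_br: "u \<in> IB \<Longrightarrow> from_nontrivial T (coll N) (br N u)"
proof -
  assume u: "u \<in> IB"
  then have uv: "u \<in> verts T" "br N u \<noteq> br {} u" using IB_verts IB_iff by blast+
  obtain u' l where "u' \<in> verts T" "nontrivial T (br N u')" "br N u = (butlast ^^ l) (br N u')"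
    using br_extends_to_nontrivial[OF proper uv] .
  moreover have "br N x \<in> fst (coll N)" if "x \<in> verts T" for x
    using that by (simp add: coll_def vec_brackets_ind)
  ultimately show ?thesis using uv(1) unfolding from_nontrivial_def by blast
qed

lemma from_nontrivialE:
  assumes "from_nontrivial T (coll N) E"
  obtains u where "u \<in> verts T" "E = br N u"
proof -
  obtain A' l where A: "A' \<in> vec_brackets (ind N)" "nontrivial T A'" "E = (butlast ^^ l) A'"
      "E \<in> vec_brackets (ind N)"
    using assms by (auto simp: from_nontrivial_def coll_def)
  then obtain u V where u: "u \<in> verts T" "A' = br V u" "V \<in> {{}, N, UNIV}"
    unfolding vec_brackets_ind by blast
  then have "A' = br N u" using A(2) nontrivial_br_iff[OF u(1), of "{}"] nontrivial_br_iff[OF u(1), of UNIV] by auto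
  then have E: "E = (butlast ^^ l) (br N u)" using A(3) by simp
  have "E \<noteq> []" using A(4) by (auto simp: vec_brackets_ind) (metis length_br list.size(3) nat.distinct(1))+
  from butlast_pow_br_cases[OF u(1) E this] that weak_desc_in(2) show ?thesis by metis
qed

text \<open>One level above \<open>s\<close> the brackets of \<open>N\<close> are singletons, and
  deeper brackets project to nonsingletons. At the depth of \<open>s\<close> all nonsingleton
  brackets of \<open>N\<close> coincide.\<close>

lemma fusion_eq: "fusion T (coll N) = br N s"
  unfolding fusion_def
proof (rule the_equality)
  obtain j where j: "vdepth T s = Suc j" "j < tdepth T" "s \<in> level T (Suc j)" by (rule s_depth)
  have "spine j \<notin> IB" using IB_depth[of "spine j"] spine_depth[OF j(2)] j(1) by auto
  then have "br N (spine j) = br {} (spine j)" using IB_iff[OF spine_verts[OF j(2)]] by blast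
  then have "is_sing T (butlast (br N s))"
    using butlast_br[OF j(3)] is_sing_br_iff[OF spine_verts[OF j(2)]] by simp
  moreover have sI: "s \<in> IB" using blk_subset_IB self_in_blk[OF s_in] .
  moreover have "\<not> is_sing T (br N s)" using is_sing_br_iff[OF s_in] IB_iff[OF s_in] sI by simp
  ultimately show "from_nontrivial T (coll N) (br N s) \<and> \<not> is_sing T (br N s) \<and> is_sing T (butlast (br N s))"
    using from_nontrivial_br by blast
next
  fix E assume E: "from_nontrivial T (coll N) E \<and> \<not> is_sing T E \<and> is_sing T (butlast E)"
  then obtain u where u: "u \<in> verts T" "E = br N u" using from_nontrivialE by blast
  then have uI: "u \<in> IB" using IB_iff is_sing_br_iff E by blast
  show "E = br N s"
  proof (cases "vdepth T u = vdepth T s")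
    case True
    then show ?thesis using br_eq[OF s_in IB_same_depth[OF uI]] u(2) by simp
  next
    case False
    then have lt: "vdepth T s < vdepth T u" using IB_below[OF uI] by blast
    then obtain i where i: "vdepth T u = Suc i" by (cases "vdepth T u") auto
    then have il: "i < tdepth T" using vdepth_le[OF u(1)] by simp
    have "spine i \<in> IB" using IB_spine[OF uI False i] .
    then have "br N (spine i) \<noteq> br {} (spine i)" using IB_iff[OF spine_verts[OF il]] by blast
    then have "\<not> is_sing T (butlast E)"
      using butlast_br[of u i N] u i is_sing_br_iff[OF spine_verts[OF il]] by (simp add: level_iff)
    then show ?thesis using E by simp
  qed
qed

lemma last_fusion: "last (fusion T (coll N)) = blk N s"
  using fusion_eq s_in by simp

lemma fusion_parent_eq: "vdepth T s = Suc j \<Longrightarrow> fusion_parent T (coll N) = spine j"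
  unfolding fusion_parent_def
proof (rule the_equality)
  assume j: "vdepth T s = Suc j"
  then have s: "s \<in> level T (Suc j)" and jn: "j < tdepth T"
    using s_in vdepth_le[OF s_in] by (auto simp: level_iff)
  have "spine j \<notin> IB" using IB_depth[of "spine j"] spine_depth[OF jn] j by auto
  then have eq: "butlast (fusion T (coll N)) = sing_br T (spine j)"
    using IB_iff[OF spine_verts[OF jn]] butlast_br[OF s] fusion_eq br_empty[OF spine_verts[OF jn]] by simp
  then show "spine j \<in> verts T \<and> butlast (fusion T (coll N)) = sing_br T (spine j)"
    using spine_verts[OF jn] by simp
  fix w assume w: "w \<in> verts T \<and> butlast (fusion T (coll N)) = sing_br T w"
  then have "last (br {} w) = last (br {} (spine j))"
    using eq br_empty[of w] br_empty[OF spine_verts[OF jn]] by simp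
  then show "w = spine j" using w spine_verts[OF jn] blk_empty by simp
qed

lemma essential_eq: "essential T (coll N) = br N ` IB"
proof (intro equalityI subsetI)
  fix E assume "E \<in> essential T (coll N)"
  then obtain l where E: "from_nontrivial T (coll N) E" "(butlast ^^ l) E = br N s"
    unfolding essential_def fusion_eq by blast
  then obtain u where u: "u \<in> verts T" "E = br N u" using from_nontrivialE by blast
  have "br N s \<noteq> []" by (metis length_br list.size(3) nat.distinct(1))
  then obtain x where x: "weak_desc T u x" "br N s = br N x"
    using butlast_pow_br_cases[of u "br N s" l N] u E(2) by metis
  have xv: "x \<in> verts T" using weak_desc_in(2)[OF x(1)] .
  then have "blk N s = blk N x" using x(2) last_br s_in by metis
  then have "x \<in> blk N s" using self_in_blk[OF xv] by simp
  then have "u \<in> IB" using x(1) by (auto simp: in_or_below_def)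
  then show "E \<in> br N ` IB" using u by blast
next
  fix E assume "E \<in> br N ` IB"
  then obtain u where u: "u \<in> IB" "E = br N u" by blast
  have uv: "u \<in> verts T" using IB_verts[OF u(1)] .
  have "\<exists>l. (butlast ^^ l) E = br N s"
  proof (cases "vdepth T u = vdepth T s")
    case True
    then have "(butlast ^^ 0) E = br N s" using br_eq[OF s_in IB_same_depth[OF u(1)]] u(2) by simp
    then show ?thesis by blast
  next
    case False
    have "br N (spine (vdepth T s)) = br N s" using br_eq[OF s_in IB_below(1)[OF u(1) False]] .
    then show ?thesis using butlast_pow_br[OF uv IB_below(2)[OF u(1) False], of N] u(2) by metis
  qed
  then show "E \<in> essential T (coll N)"
    using from_nontrivial_br[OF u(1)] u(2) unfolding essential_def fusion_eq by blast
qed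

subsection \<open>The contracted tree\<close>

abbreviation "\<psi> \<equiv> contract_map T (coll N)"
abbreviation "T' \<equiv> contract T (coll N)"

lemma psi_out: "u \<notin> IB \<Longrightarrow> \<psi> u = Inl u"
  by (simp add: contract_map_def last_fusion)

lemma psi_in: "u \<in> IB \<Longrightarrow> \<psi> u = Inr (br N u)"
proof -
  assume u: "u \<in> IB"
  have uv: "u \<in> verts T" using IB_verts[OF u] .
  have "(THE E. E \<in> essential T (coll N) \<and> length E = Suc (vdepth T u) \<and> u \<in> last E) = br N u"
  proof (rule the_equality)
    show "br N u \<in> essential T (coll N) \<and> length (br N u) = Suc (vdepth T u) \<and> u \<in> last (br N u)"
      using u uv essential_eq by simp
    fix E assume E: "E \<in> essential T (coll N) \<and> length E = Suc (vdepth T u) \<and> u \<in> last E"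
    then obtain x where x: "x \<in> IB" "E = br N x" using essential_eq by auto
    then have "u \<in> blk N x" using E IB_verts by simp
    then show "E = br N u" using br_eq[OF IB_verts[OF x(1)]] x(2) by simp
  qed
  then show ?thesis using u by (simp add: contract_map_def last_fusion)
qed

text \<open>As the image of \<open>T\<close> under \<open>\<psi>\<close>, the contracted tree
  inherits parents, depths, paths and levels, and positions in it can be computed from vertices of
  \<open>T\<close>.\<close>

lemma verts_T': "verts T' = \<psi> ` verts T"
proof -
  have "verts T' = Inl ` (verts T - IB) \<union> Inr ` br N ` IB"
    by (simp add: contract_def Let_def last_fusion essential_eq)
  also have "\<dots> = \<psi> ` (verts T - IB) \<union> \<psi> ` IB"
    using psi_in psi_out by (force simp: image_image)
  also have "\<dots> = \<psi> ` verts T" using IB_verts by blast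
  finally show ?thesis .
qed

lemma root_not_IB: "troot T \<notin> IB"
proof
  assume "troot T \<in> IB"
  moreover obtain j where "vdepth T s = Suc j" by (rule s_depth)
  ultimately show False using IB_depth[of "troot T"] vdepth_eq_0_iff[of "troot T"] by simp
qed

lemma troot_T': "troot T' = \<psi> (troot T)"
  using psi_out[OF root_not_IB] by (simp add: contract_def Let_def)

lemma psi_root_iff: "u \<in> verts T \<Longrightarrow> \<psi> u = \<psi> (troot T) \<longleftrightarrow> u = troot T"
  using psi_out[OF root_not_IB] psi_in[of u] psi_out[of u] by (cases "u \<in> IB") auto

lemma parent_T':
  assumes u: "u \<in> level T (Suc i)"
  shows "parent T' (\<psi> u) = \<psi> (parent T u)"
proof -
  have uv: "u \<in> verts T" "vdepth T u = Suc i" and iN: "i < tdepth T"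
    using u vdepth_le[of u] by (auto simp: level_iff)
  have p: "parent T u = spine i" using parent_level[OF u] .
  show ?thesis
  proof (cases "u \<in> IB")
    case False
    then have "spine i \<notin> IB" using IB_desc weak_desc_spine[OF uv(1), of i] uv(2) by auto
    then show ?thesis using p psi_out False by (simp add: contract_def Let_def)
  next
    case True
    show ?thesis
    proof (cases "vdepth T u = vdepth T s")
      case eq: True
      then have "br N u = br N s" using br_eq[OF s_in IB_same_depth[OF True]] by simp
      moreover have "spine i \<notin> IB" using IB_depth[of "spine i"] spine_depth[OF iN] eq uv(2) by auto
      ultimately show ?thesis
        using psi_in[OF True] psi_out fusion_eq fusion_parent_eq[of i] eq uv(2) p
        by (simp add: contract_def Let_def)
    next
      case neq: False
      have "br N u \<noteq> br N s" using neq length_br by (metis nat.inject)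
      moreover have "spine i \<in> IB" using IB_spine[OF True neq uv(2)] .
      ultimately show ?thesis
        using psi_in True fusion_eq p butlast_br[OF u] by (simp add: contract_def Let_def)
    qed
  qed
qed

lemma funpow_parent_T': "u \<in> verts T \<Longrightarrow> j \<le> vdepth T u \<Longrightarrow> (parent T' ^^ j) (\<psi> u) = \<psi> ((parent T ^^ j) u)"
proof (induction j)
  case (Suc j)
  then obtain i where i: "vdepth T u = j + Suc i" by (metis Suc_le_D add_Suc_right add_Suc le_Suc_ex)
  then have "(parent T ^^ j) u \<in> level T (Suc i)"
    using funpow_parent_level[of u j "Suc i"] Suc.prems by (simp add: level_iff)
  then show ?case using Suc parent_T' by simp
qed simp

lemma root_at_depth: "u \<in> verts T \<Longrightarrow> (parent T ^^ vdepth T u) u = troot T"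
  using funpow_parent_level[of u "vdepth T u" 0] level_0 by (simp add: level_iff)

lemma vdepth_T': "u \<in> verts T \<Longrightarrow> vdepth T' (\<psi> u) = vdepth T u"
proof -
  assume u: "u \<in> verts T"
  show ?thesis
    unfolding vdepth_def[of T']
  proof (rule Least_equality)
    show "(parent T' ^^ vdepth T u) (\<psi> u) = troot T'"
      using funpow_parent_T'[OF u order_refl] root_at_depth[OF u] troot_T' by simp
    fix j assume j: "(parent T' ^^ j) (\<psi> u) = troot T'"
    show "vdepth T u \<le> j"
    proof (rule ccontr)
      assume "\<not> vdepth T u \<le> j"
      then have le: "j \<le> vdepth T u" "j < vdepth T u" by auto
      obtain i where i: "vdepth T u = j + i" using le(1) le_Suc_ex by blast
      then have "(parent T ^^ j) u \<in> level T i"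
        using funpow_parent_level[of u j i] u by (simp add: level_iff)
      moreover have "\<psi> ((parent T ^^ j) u) = \<psi> (troot T)" using funpow_parent_T'[OF u le(1)] j troot_T' by simp
      ultimately have "(parent T ^^ j) u = troot T" using psi_root_iff by (simp add: level_iff)
      then have "vdepth T u \<le> j" unfolding vdepth_def by (rule Least_le)
      then show False using le by simp
    qed
  qed
qed

lemma path_to_T': "u \<in> verts T \<Longrightarrow> path_to T' (\<psi> u) = map \<psi> (path_to T u)"
  unfolding path_to_def[of T'] path_to_def[of T] using funpow_parent_T' by (simp add: vdepth_T')

lemma level_T': "level T' k = \<psi> ` level T k"
  using verts_T' vdepth_T' by (auto simp: level_def)

lemma sib_T'_simps:
  "(Inl u, Inl v) \<in> sib T' \<longleftrightarrow> u \<in> verts T - IB \<and> v \<in> verts T - IB \<and> (u, v) \<in> sib T"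
  "(Inl u, Inr E) \<in> sib T' \<longleftrightarrow> u \<in> verts T - IB \<and> E = br N s \<and> (\<forall>x \<in> blk N s. (u, x) \<in> sib T)"
  "(Inr E, Inl u) \<in> sib T' \<longleftrightarrow> u \<in> verts T - IB \<and> E = br N s \<and> (\<forall>x \<in> blk N s. (x, u) \<in> sib T)"
  "(Inr E, Inr E') \<in> sib T' \<longleftrightarrow> E \<in> br N ` IB \<and> E' \<in> br N ` IB \<and> (E, E') \<in> left_right (vec_brackets (ind N))"
  unfolding contract_def Let_def last_fusion essential_eq unfolding fusion_eq by (auto simp: coll_def)

lemma sib_T'_irrefl: "(x, x) \<notin> sib T'"
  using sib_irrefl left_right_asym[OF bracket_system_vec] by (cases x) (auto simp: sib_T'_simps)

lemma psi_eq_iff: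
  assumes "u \<in> verts T" "v \<in> verts T" "vdepth T u = vdepth T v"
  shows "\<psi> u = \<psi> v \<longleftrightarrow> v \<in> blk N u"
proof (cases "u \<in> IB")
  case True
  show ?thesis
  proof (cases "v \<in> IB")
    case v: True
    have "br N u = br N v \<longleftrightarrow> v \<in> blk N u"
      using br_eq[OF assms(1)] last_br assms(1,2) self_in_blk by metis
    then show ?thesis using psi_in True v by simp
  next
    case False
    have "v \<notin> blk N u"
    proof
      assume "v \<in> blk N u"
      then have "u \<in> blk N v" by (rule blk_sym[OF assms(1)])
      then have "u = v" using not_IB_blk[OF assms(2) False] by simp
      then show False using True False by simp
    qed
    then show ?thesis using psi_in[OF True] psi_out[OF False] by simp
  qed
next
  case False
  then have "v \<in> blk N u \<longleftrightarrow> v = u" using not_IB_blk[OF assms(1)] by simp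
  then show ?thesis using False psi_out[of u] psi_out[of v] psi_in[of v] by (cases "v \<in> IB") auto
qed

lemma blk_before:
  assumes "u \<in> level T (Suc i)" "x \<in> verts T" "v \<in> blk N x" "y \<in> blk N x" "u \<notin> blk N x" "vdepth T x = Suc i"
  shows "(u, v) \<in> sib T \<Longrightarrow> (u, y) \<in> sib T" and "(v, u) \<in> sib T \<Longrightarrow> (y, u) \<in> sib T"
proof -
  have l: "v \<in> level T (Suc i)" "y \<in> level T (Suc i)"
    using blk_level[of N x] assms(3,4,6) by auto
  have ne: "u \<noteq> y" using assms by blast
  have c: "u \<in> blk N x" if "pos T p \<le> pos T u" "pos T u \<le> pos T q" "p \<in> blk N x" "q \<in> blk N x" for p q
    using blk_convex[OF that(3,4) _ that(1,2) assms(2)] assms(1,6) by simp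
  show "(u, y) \<in> sib T" if "(u, v) \<in> sib T"
  proof (rule ccontr)
    assume "(u, y) \<notin> sib T"
    then have "(y, u) \<in> sib T" using sib_order(3)[OF assms(1) l(2) ne] by blast
    then show False using c[of y v] that assms sib_iff_pos l by (metis less_imp_le)
  qed
  show "(y, u) \<in> sib T" if "(v, u) \<in> sib T"
  proof (rule ccontr)
    assume "(y, u) \<notin> sib T"
    then have "(u, y) \<in> sib T" using sib_order(3)[OF assms(1) l(2) ne] by blast
    then show False using c[of v y] that assms sib_iff_pos l by (metis less_imp_le)
  qed
qed

text \<open>Mixed pairs, one vertex in the collapsed part and one outside, occur only at the fusion
  level by \<open>IB_level\<close>. There the convexity of the block decides on which side it
  lies.\<close>

lemma sib_T'_psi:
  assumes u: "u \<in> level T (Suc i)" and v: "v \<in> level T (Suc i)"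
  shows "(\<psi> u, \<psi> v) \<in> sib T' \<longleftrightarrow> (u, v) \<in> sib T \<and> v \<notin> blk N u"
proof -
  have uv: "u \<in> verts T" "v \<in> verts T" "vdepth T u = Suc i" "vdepth T v = Suc i" using u v by (auto simp: level_iff)
  consider "u \<notin> IB" "v \<notin> IB" | "u \<notin> IB" "v \<in> IB" | "u \<in> IB" "v \<notin> IB" | "u \<in> IB" "v \<in> IB" by blast
  then show ?thesis
  proof cases
    case 1
    then show ?thesis
      using psi_out not_IB_blk[OF uv(1)] sib_irrefl[of u] uv by (auto simp: sib_T'_simps)
  next
    case 2
    then have d: "vdepth T v = vdepth T s" using IB_level uv by metis
    have W: "v \<in> blk N s" using IB_same_depth[OF 2(2) d] .
    have uW: "u \<notin> blk N s" using 2 blk_subset_IB by blast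
    have "\<forall>x\<in>blk N s. (u, x) \<in> sib T" if "(u, v) \<in> sib T"
      using blk_before(1)[OF u s_in W _ uW] that d uv by simp
    then have "(\<forall>x\<in>blk N s. (u, x) \<in> sib T) \<longleftrightarrow> (u, v) \<in> sib T" using W by blast
    moreover have "v \<notin> blk N u" using not_IB_blk[OF uv(1) 2(1)] 2 by auto
    ultimately show ?thesis
      using psi_out[OF 2(1)] psi_in[OF 2(2)] br_eq[OF s_in W] 2 uv by (simp add: sib_T'_simps)
  next
    case 3
    then have d: "vdepth T u = vdepth T s" using IB_level uv by metis
    have W: "u \<in> blk N s" using IB_same_depth[OF 3(1) d] .
    have vW: "v \<notin> blk N s" using 3 blk_subset_IB by blast
    have "\<forall>x\<in>blk N s. (x, v) \<in> sib T" if "(u, v) \<in> sib T"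
      using blk_before(2)[OF v s_in W _ vW] that d uv by simp
    then have "(\<forall>x\<in>blk N s. (x, v) \<in> sib T) \<longleftrightarrow> (u, v) \<in> sib T" using W by blast
    moreover have "v \<notin> blk N u" using vW blk_eq[OF s_in W] by simp
    ultimately show ?thesis
      using psi_in[OF 3(1)] psi_out[OF 3(2)] br_eq[OF s_in W] 3 uv by (simp add: sib_T'_simps)
  next
    case 4
    have mem: "br N u \<in> vec_brackets (ind N)" "br N v \<in> vec_brackets (ind N)"
      using uv vec_brackets_ind by blast+
    have bl: "butlast (br N u) = butlast (br N v)" using butlast_br u v by simp
    have "(br N u, br N v) \<in> left_right (vec_brackets (ind N)) \<longleftrightarrow>
        (\<forall>x \<in> blk N u. \<forall>y \<in> blk N v. (x, y) \<in> sib T)"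
      using mem bl uv by (simp add: left_right_def)
    also have "\<dots> \<longleftrightarrow> (u, v) \<in> sib T \<and> v \<notin> blk N u"
    proof
      assume *: "\<forall>x \<in> blk N u. \<forall>y \<in> blk N v. (x, y) \<in> sib T"
      then show "(u, v) \<in> sib T \<and> v \<notin> blk N u" using self_in_blk uv sib_irrefl by blast
    next
      assume *: "(u, v) \<in> sib T \<and> v \<notin> blk N u"
      have "blk N u \<inter> blk N v = {}"
      proof (rule ccontr)
        assume "blk N u \<inter> blk N v \<noteq> {}"
        then obtain z where "z \<in> blk N u" "z \<in> blk N v" by blast
        then have "blk N u = blk N v" using blk_eq uv by metis
        then show False using * self_in_blk[OF uv(2), of N] by simp
      qed
      then have "last (br N u) \<inter> last (br N v) = {}" using uv by simp
      from disjoint_tops_ordered[OF _ _ this, of "Suc i"]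
      have "(\<forall>x\<in>blk N u. \<forall>y\<in>blk N v. (x, y) \<in> sib T) \<or> (\<forall>x\<in>blk N u. \<forall>y\<in>blk N v. (y, x) \<in> sib T)"
        using is_bracket_br[OF uv(1), of N] is_bracket_br[OF uv(2), of N] uv by simp
      then show "\<forall>x \<in> blk N u. \<forall>y \<in> blk N v. (x, y) \<in> sib T"
        using * sib_asym self_in_blk uv by blast
    qed
    finally show ?thesis using psi_in 4 by (simp add: sib_T'_simps)
  qed
qed

section \<open>Positions in the contracted tree and velocity vectors\<close>

lemma pos_T':
  assumes v: "v \<in> level T (Suc i)"
  shows "pos T' (\<psi> v) = card (\<psi> ` {u \<in> level T (Suc i). (u, v) \<in> sib T \<and> v \<notin> blk N u}) + 1"
proof -
  have vv: "v \<in> verts T" "vdepth T v = Suc i" using v by (auto simp: level_iff)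
  have "(path_to T' (\<psi> u), path_to T' (\<psi> v)) \<in> lexord (sib T') \<longleftrightarrow> (u, v) \<in> sib T \<and> v \<notin> blk N u"
    if u: "u \<in> level T (Suc i)" for u
  proof -
    have uv: "u \<in> verts T" "vdepth T u = Suc i" using u by (auto simp: level_iff)
    have "(path_to T' (\<psi> u), path_to T' (\<psi> v)) \<in> lexord (sib T') \<longleftrightarrow> (\<psi> u, \<psi> v) \<in> sib T'"
      using uv vv sib_T'_irrefl by (simp add: path_to_T' path_to_eq lexord_same_pref_iff)
    then show ?thesis using sib_T'_psi[OF u v] by simp
  qed
  then have "{y \<in> level T' (Suc i). (path_to T' y, path_to T' (\<psi> v)) \<in> lexord (sib T')} =
      \<psi> ` {u \<in> level T (Suc i). (u, v) \<in> sib T \<and> v \<notin> blk N u}"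
    unfolding level_T' by auto
  then show ?thesis using vdepth_T'[OF vv(1)] vv(2) unfolding pos_def by simp
qed

text \<open>The ends of a gap in \<open>N\<close> have one image, and the coordinate is the added 1.
  The ends of any other gap have images in consecutive positions, and the coordinate is 0.\<close>

lemma rho_coll: "rho T idx (coll N) = ind N"
proof (rule vec_eq_iff[THEN iffD2], rule allI)
  fix a
  have ix: "idx a = (lev a, pos T (lft a))" using pos_lft by (simp add: lev_def prod_eq_iff)
  have nl: "nth_vertex T (lev a) (pos T (lft a)) = lft a" using nth_vertex_eq[OF lft_level] .
  have nr: "nth_vertex T (lev a) (Suc (pos T (lft a))) = rgt a"
    using nth_vertex_eq[OF rgt_level] pos_rgt by metis
  have "rho T idx (coll N) $ a = real (pos T' (\<psi> (lft a))) - real (pos T' (\<psi> (rgt a))) + 1"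
    by (simp add: rho_def rho_coord_def ix nl nr)
  also have "\<dots> = ind N $ a"
  proof (cases "a \<in> N")
    case True
    then have "\<psi> (lft a) = \<psi> (rgt a)"
      using psi_eq_iff[OF lft_verts rgt_verts] rgt_in_blk_lft vdepth_lft vdepth_rgt by simp
    then show ?thesis using True by simp
  next
    case False
    obtain i where i: "lev a = Suc i" using lev_ge[of a] by (cases "lev a") auto
    have l: "lft a \<in> level T (Suc i)" "rgt a \<in> level T (Suc i)" using lft_level[of a] rgt_level[of a] i by auto
    let ?B = "\<lambda>v. {u \<in> level T (Suc i). (u, v) \<in> sib T \<and> v \<notin> blk N u}"
    have psi: "\<psi> u = \<psi> (lft a) \<longleftrightarrow> lft a \<in> blk N u" if "u \<in> level T (Suc i)" for u
      using that l psi_eq_iff by (simp add: level_iff)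
    have Br: "u \<in> ?B (rgt a) \<longleftrightarrow> pos T u \<le> pos T (lft a)" if u: "u \<in> level T (Suc i)" for u
    proof -
      have uv: "u \<in> verts T" "vdepth T u = Suc i" using u by (auto simp: level_iff)
      have "rgt a \<notin> blk N u" if le: "pos T u \<le> pos T (lft a)"
      proof
        assume r: "rgt a \<in> blk N u"
        then have "lft a \<in> blk N u"
          using blk_convex[OF self_in_blk[OF uv(1)] r _ le] pos_rgt[of a] l uv by simp
        then show False using gap_of_blk[OF uv(1)] r False by blast
      qed
      then show ?thesis using u sib_iff_pos[OF u l(2)] pos_rgt[of a] by auto
    qed
    \<comment> \<open>Exactly one image precedes that of \<open>rgt a\<close> without preceding that
      of \<open>lft a\<close>, namely the image of \<open>lft a\<close> itself.\<close>
    have "\<psi> ` ?B (rgt a) = insert (\<psi> (lft a)) (\<psi> ` ?B (lft a))"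
    proof (intro equalityI subsetI)
      fix y assume "y \<in> \<psi> ` ?B (rgt a)"
      then obtain u where u: "u \<in> level T (Suc i)" "y = \<psi> u" "pos T u \<le> pos T (lft a)" using Br by blast
      show "y \<in> insert (\<psi> (lft a)) (\<psi> ` ?B (lft a))"
      proof (cases "lft a \<in> blk N u")
        case True
        then show ?thesis using psi u by simp
      next
        case False
        then have "u \<noteq> lft a" using self_in_blk lft_verts by blast
        then have "pos T u \<noteq> pos T (lft a)" using u l inj_onD[OF inj_on_pos] by blast
        then have "u \<in> ?B (lft a)" using u False sib_iff_pos[OF u(1) l(1)] by simp
        then show ?thesis using u by blast
      qed
    next
      fix y assume y: "y \<in> insert (\<psi> (lft a)) (\<psi> ` ?B (lft a))"
      show "y \<in> \<psi> ` ?B (rgt a)"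
      proof (cases "y = \<psi> (lft a)")
        case True
        then show ?thesis using Br[OF l(1)] by blast
      next
        case False
        then obtain u where u: "u \<in> ?B (lft a)" "y = \<psi> u" using y by blast
        then have "pos T u \<le> pos T (lft a)" using sib_iff_pos[of u "Suc i" "lft a"] l by simp
        then show ?thesis using Br u by blast
      qed
    qed
    moreover have "\<psi> (lft a) \<notin> \<psi> ` ?B (lft a)" using psi by force
    ultimately have "card (\<psi> ` ?B (rgt a)) = Suc (card (\<psi> ` ?B (lft a)))" by simp
    then show ?thesis using pos_T'[OF l(1)] pos_T'[OF l(2)] False by simp
  qed
  finally show "rho T idx (coll N) $ a = ind N $ a" .
qed

end

section \<open>The velocity fan and the triangulated velocity fan\<close>

context gap_tree
begin

lemma tube_based:
  assumes "tube gap_adj N" "N \<noteq> UNIV"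
  obtains s where "based_tube T idx N s"
proof -
  obtain s where s: "s \<in> verts T" "blk N s \<noteq> {s}"
    "\<forall>u \<in> verts T. br N u \<noteq> br {} u \<longleftrightarrow> (\<exists>x \<in> blk N s. weak_desc T u x)"
    by (rule tube_base[OF assms(1)])
  have "based_tube T idx N s" by unfold_locales (use assms(2) s in auto)
  then show ?thesis by (rule that)
qed

lemma rho_coll_tube: "tube gap_adj N \<Longrightarrow> N \<noteq> UNIV \<Longrightarrow> rho T idx (coll N) = ind N"
  using tube_based based_tube.rho_coll by metis

text \<open>A common weak descendant has comparable ancestors in the two fusion tops. As these tops
  are not singletons, each such ancestor is an end of a gap of its tube, and the tubes are linked.
  Conversely, linked gaps have comparable ends, and the deeper of these lies below both
  tops.\<close>

lemma coll_sim_iff: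
  assumes N: "tube gap_adj N" "N \<noteq> UNIV" and N': "tube gap_adj N'" "N' \<noteq> UNIV"
  shows "coll_sim T (coll N) (coll N') \<longleftrightarrow> gap_adj \<inter> N \<times> N' = {}"
proof -
  obtain s where "based_tube T idx N s" using tube_based N by blast
  then interpret A: based_tube T idx N s .
  obtain s' where "based_tube T idx N' s'" using tube_based N' by blast
  then interpret B: based_tube T idx N' s' .
  have "A.IB \<inter> B.IB = {} \<longleftrightarrow> gap_adj \<inter> N \<times> N' = {}"
  proof (intro iffI; rule ccontr)
    assume disj: "A.IB \<inter> B.IB = {}" and "gap_adj \<inter> N \<times> N' \<noteq> {}"
    then obtain a b where "(a, b) \<in> gap_adj" and ab: "a \<in> N" "b \<in> N'" by blast
    then obtain u v where uv: "u = lft a \<or> u = rgt a" "v = lft b \<or> v = rgt b"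
      "weak_desc T u v \<or> weak_desc T v u" unfolding gap_adj_def by blast
    have v: "v \<in> verts T" "u \<in> verts T" using uv lft_verts rgt_verts by blast+
    have "u \<in> A.IB" using A.IB_iff[OF v(2)] end_br_nonempty[OF ab(1) uv(1)] by blast
    moreover have "v \<in> B.IB" using B.IB_iff[OF v(1)] end_br_nonempty[OF ab(2) uv(2)] by blast
    ultimately show False using uv(3) A.IB_desc B.IB_desc disj by blast
  next
    assume none: "gap_adj \<inter> N \<times> N' = {}" and "A.IB \<inter> B.IB \<noteq> {}"
    then obtain z where "z \<in> A.IB" "z \<in> B.IB" by blast
    then obtain x x' where x: "x \<in> blk N s" "weak_desc T z x" "x' \<in> blk N' s'" "weak_desc T z x'"
      by (auto simp: in_or_below_def)
    have xv: "x \<in> verts T" "x' \<in> verts T" using x weak_desc_in by blast+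
    have "blk N x = blk N s" "blk N' x' = blk N' s'"
      using blk_eq[OF A.s_in x(1)] blk_eq[OF B.s_in x(3)] by auto
    then have "blk N x \<noteq> {x}" "blk N' x' \<noteq> {x'}"
      using A.s_blk B.s_blk self_in_blk[OF A.s_in, of N] self_in_blk[OF B.s_in, of N'] by auto
    then obtain a b where "a \<in> N" "x = lft a \<or> x = rgt a" "b \<in> N'" "x' = lft b \<or> x' = rgt b"
      using end_of_gap xv by metis
    moreover have "weak_desc T x x' \<or> weak_desc T x' x"
      using weak_desc_linear[OF x(2,4)] weak_desc_linear[OF x(4,2)] by linarith
    ultimately have "(a, b) \<in> gap_adj" by (intro gap_adjI)
    then show False using none \<open>a \<in> N\<close> \<open>b \<in> N'\<close> by blast
  qed
  then show ?thesis unfolding coll_sim_def A.last_fusion B.last_fusion .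
qed

text \<open>Containment of essential brackets transports both ends of each gap of \<open>N\<close>
  into one block of \<open>N'\<close>, so the gap is closed there as well. For nested tubes a common
  upper bound comes from a vector.\<close>

lemma coll_arrow_iff:
  assumes N: "tube gap_adj N" "N \<noteq> UNIV" and N': "tube gap_adj N'" "N' \<noteq> UNIV"
  shows "coll_arrow T (coll N) (coll N') \<longleftrightarrow> N \<subseteq> N'"
proof -
  obtain s where "based_tube T idx N s" using tube_based N by blast
  then interpret A: based_tube T idx N s .
  obtain s' where "based_tube T idx N' s'" using tube_based N' by blast
  then interpret B: based_tube T idx N' s' .
  show ?thesis
  proof
    assume "coll_arrow T (coll N) (coll N')"
    then have ar: "\<exists>u'\<in>B.IB. bsub (br N u) (br N' u')" if "u \<in> A.IB" for u
      using that unfolding coll_arrow_def A.essential_eq B.essential_eq by blast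
    show "N \<subseteq> N'"
    proof
      fix a assume a: "a \<in> N"
      have "lft a \<in> A.IB" using A.IB_iff[OF lft_verts] end_br_nonempty[OF a] by blast
      then obtain u' where u': "u' \<in> B.IB" "bsub (br N (lft a)) (br N' u')" using ar by blast
      have uv: "u' \<in> verts T" using B.IB_verts[OF u'(1)] .
      have "br N (lft a) \<noteq> []" by (metis length_br list.size(3) nat.distinct(1))
      then have "blk N (lft a) \<subseteq> blk N' u'" using bsub_last[OF u'(2)] lft_verts uv by simp
      then have "lft a \<in> blk N' u'" "rgt a \<in> blk N' u'"
        using self_in_blk[OF lft_verts] a rgt_in_blk_lft by blast+
      then show "a \<in> N'" using gap_of_blk[OF uv] by blast
    qed
  next
    assume sub: "N \<subseteq> N'"
    \<comment> \<open>Its superlevel sets at 2 and 1 are \<open>N\<close> and \<open>N'\<close>, so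
      its bracketing lies above both collisions.\<close>
    let ?v = "ind N + ind N'"
    let ?B = "(vec_brackets ?v, left_right (vec_brackets ?v))"
    have s: "{a. 2 \<le> ?v $ a} = N" "{a. 1 \<le> ?v $ a} = N'" using sub by auto
    have "br N u \<in> vec_brackets ?v" "br N' u \<in> vec_brackets ?v" if "u \<in> verts T" for u
      using vec_bracketsI[OF that, of 2 ?v] vec_bracketsI[OF that, of 1 ?v] unfolding s by auto
    then have "vec_brackets (ind N) \<subseteq> vec_brackets ?v" "vec_brackets (ind N') \<subseteq> vec_brackets ?v"
      using br_empty_in_vec_brackets br_UNIV_in_vec_brackets unfolding vec_brackets_ind by auto
    moreover have "?B \<in> assoc T" using bracket_system_vec by (auto simp: assoc_eq)
    ultimately have "\<exists>B \<in> assoc T. br_le (coll N) B \<and> br_le (coll N') B"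
      using coll_le_iff by blast
    moreover have "\<exists>E' \<in> br N' ` B.IB. bsub (br N u) E'" if u: "u \<in> A.IB" for u
    proof -
      have uv: "u \<in> verts T" using A.IB_verts[OF u] .
      have "br N u \<noteq> br {} u" using A.IB_iff[OF uv] u by blast
      then obtain x where x: "weak_desc T u x" "blk N x \<noteq> {x}" using br_eq_empty_iff[OF uv] by blast
      have "x \<in> blk N x" using self_in_blk weak_desc_in(2)[OF x(1)] by blast
      then have "blk N' x \<noteq> {x}" using x(2) blk_mono[OF sub, of x] by blast
      then have "u \<in> B.IB" using B.IB_iff[OF uv] br_eq_empty_iff[OF uv] x(1) by blast
      then show ?thesis using bsub_br_mono[OF sub, of u] by blast
    qed
    ultimately show "coll_arrow T (coll N) (coll N')"
      unfolding coll_arrow_def A.essential_eq B.essential_eq by blast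
  qed
qed

lemma coll_complex_eq: "coll_complex T = (\<lambda>Y. coll ` Y) ` {Y. nested Y}"
proof (intro equalityI subsetI)
  fix S assume "S \<in> coll_complex T"
  then obtain Cs where Cs: "S = set Cs" "set Cs \<subseteq> collisions T"
    "sorted_wrt (\<lambda>C1 C2. coll_sim T C1 C2 \<or> coll_arrow T C1 C2) Cs"
    unfolding coll_complex_def by blast
  define Y where "Y = {N. tube gap_adj N \<and> N \<noteq> UNIV \<and> coll N \<in> S}"
  have SY: "S = coll ` Y"
  proof (intro equalityI subsetI)
    fix C assume C: "C \<in> S"
    then have "C \<in> coll ` {N. tube gap_adj N \<and> N \<noteq> UNIV}" using Cs(1,2) collisions_eq by auto
    then show "C \<in> coll ` Y" using C unfolding Y_def by auto
  qed (auto simp: Y_def)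
  have rel: "gap_adj \<inter> N \<times> N' = {} \<or> N \<subseteq> N'"
    if "N \<in> Y" "N' \<in> Y" "i < j" "j < length Cs" "coll N = Cs ! i" "coll N' = Cs ! j" for N N' i j
  proof -
    have "coll_sim T (coll N) (coll N') \<or> coll_arrow T (coll N) (coll N')"
      using Cs(3) that unfolding sorted_wrt_iff_nth_less by simp
    moreover have "tube gap_adj N" "N \<noteq> UNIV" "tube gap_adj N'" "N' \<noteq> UNIV"
      using that(1,2) by (simp_all add: Y_def)
    ultimately show ?thesis using coll_sim_iff[of N N'] coll_arrow_iff[of N N'] by blast
  qed
  have adj_sym: "gap_adj \<inter> N \<times> N' = {} \<longleftrightarrow> gap_adj \<inter> N' \<times> N = {}" for N N'
    using sym_Q by (auto simp: sym_def)
  have "N \<subseteq> N' \<or> N' \<subseteq> N \<or> gap_adj \<inter> N \<times> N' = {}" if NY: "N \<in> Y" "N' \<in> Y" for N N'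
  proof -
    obtain i j where ij: "i < length Cs" "coll N = Cs ! i" "j < length Cs" "coll N' = Cs ! j"
    proof -
      have "coll N \<in> set Cs" "coll N' \<in> set Cs" using NY Cs(1) by (simp_all add: Y_def)
      then show ?thesis using that unfolding in_set_conv_nth by metis
    qed
    consider "i < j" | "j < i" | "i = j" by linarith
    then show ?thesis
    proof cases
      case 1
      then show ?thesis using rel[OF NY 1 ij(3,2,4)] by blast
    next
      case 2
      then show ?thesis using rel[OF NY(2,1) 2 ij(1,4,2)] adj_sym by blast
    next
      case 3
      then have "coll N' = coll N" using ij by simp
      then have "N' = N" using NY coll_inj[of N N'] unfolding Y_def by blast
      then show ?thesis by blast
    qed
  qed
  then have "nested Y" unfolding nested_def by (auto simp: Y_def)
  then show "S \<in> (\<lambda>Y. coll ` Y) ` {Y. nested Y}" using SY by blast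
next
  fix S assume "S \<in> (\<lambda>Y. coll ` Y) ` {Y. nested Y}"
  then obtain Y where Y: "nested Y" "S = coll ` Y" by blast
  obtain ys where ys: "set ys = Y" "distinct ys" using finite_distinct_list[OF finite[of Y]] by blast
  \<comment> \<open>Listing by size puts each tube before the larger tubes that contain it, which is
    the direction of the arrow.\<close>
  define xs where "xs = sort_key card ys"
  have xs: "set xs = Y" "distinct xs" "sorted (map card xs)" using ys by (simp_all add: xs_def)
  have tY: "tube gap_adj N \<and> N \<noteq> UNIV" if "N \<in> Y" for N using Y(1) that by (simp add: nested_def)
  have "inj_on coll Y"
  proof (rule inj_onI)
    fix N N' assume "N \<in> Y" "N' \<in> Y" "coll N = coll N'"
    then show "N = N'" using coll_inj[of N' N] tY by blast
  qed
  then have "distinct (map coll xs)" using xs by (simp add: distinct_map)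
  moreover have "set (map coll xs) = S" using xs Y by simp
  moreover have "set (map coll xs) \<subseteq> collisions T" using xs(1) tY collisions_eq by auto
  moreover have "sorted_wrt (\<lambda>N N'. coll_sim T (coll N) (coll N') \<or> coll_arrow T (coll N) (coll N')) xs"
    unfolding sorted_wrt_iff_nth_less
  proof (intro allI impI)
    fix i j assume ij: "i < j" "j < length xs"
    let ?N = "xs ! i" and ?N' = "xs ! j"
    have NY: "?N \<in> Y" "?N' \<in> Y" using xs(1) ij nth_mem[of i xs] nth_mem[of j xs] by auto
    have le: "card ?N \<le> card ?N'" using xs(3) ij by (simp add: sorted_iff_nth_mono_less)
    have "?N \<subseteq> ?N' \<or> gap_adj \<inter> ?N \<times> ?N' = {}"
    proof -
      have "?N' \<subseteq> ?N \<Longrightarrow> ?N' = ?N" using le by (intro card_seteq) auto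
      then show ?thesis using Y(1) NY unfolding nested_def by blast
    qed
    then show "coll_sim T (coll ?N) (coll ?N') \<or> coll_arrow T (coll ?N) (coll ?N')"
      using coll_sim_iff[of ?N ?N'] coll_arrow_iff[of ?N ?N'] tY[OF NY(1)] tY[OF NY(2)] by blast
  qed
  then have "sorted_wrt (\<lambda>C1 C2. coll_sim T C1 C2 \<or> coll_arrow T C1 C2) (map coll xs)"
    by (simp add: sorted_wrt_map)
  ultimately show "S \<in> coll_complex T" unfolding coll_complex_def by blast
qed

text \<open>Both sides are the family of the cones \<open>min_cone v\<close>: nested sets are
  exactly the \<open>sup_tubes v\<close>, and nonempty faces of the nestohedron are exactly the
  \<open>min_face v\<close>.\<close>

lemma triangulated_eq_normal_fan: "triangulated_velocity_fan T idx = normal_fan (nestohedron tubes)"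
proof -
  have "rho T idx ` coll ` Y = ind ` Y" if "nested Y" for Y
    using that rho_coll_tube unfolding nested_def by (force simp: image_image)
  then have "triangulated_velocity_fan T idx = (\<lambda>Y. cone_ones (ind ` Y)) ` {Y. nested Y}"
    unfolding triangulated_velocity_fan_def coll_complex_eq image_image by (intro image_cong) auto
  also have "\<dots> = range min_cone"
    unfolding nested_cones_eq[OF tube_UNIV] using min_cone_eq[OF tube_UNIV] by auto
  finally show ?thesis using normal_fan_nestohedron by simp
qed

lemma velocity_fan_eq: "velocity_fan T idx = bcone ` {BS. bracket_system BS}"
proof -
  have "cone_ones (rho T idx ` {C \<in> collisions T. br_le C (BS, left_right BS)}) = bcone BS"
    if "bracket_system BS" for BS
  proof -
    let ?Y = "{N. tube gap_adj N \<and> N \<noteq> UNIV \<and> vec_brackets (ind N) \<subseteq> BS}"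
    have "{C \<in> collisions T. br_le C (BS, left_right BS)} = coll ` ?Y"
      unfolding collisions_eq using coll_le_iff by blast
    moreover have "rho T idx ` coll ` ?Y = ind ` ?Y"
      using rho_coll_tube by (force simp: image_image)
    ultimately show ?thesis using cone_ones_colls[OF that] by simp
  qed
  then show ?thesis unfolding velocity_fan_def assoc_eq image_image by (intro image_cong) auto
qed

lemma coarsens_braid_velocity_fan: "coarsens_braid (velocity_fan T idx)"
  unfolding coarsens_braid_def is_fan_def velocity_fan_eq
proof (intro conjI)
  show "finite (bcone ` {BS. bracket_system BS})" using finite_bracket_systems by simp
  show "\<forall>C\<in>bcone ` {BS. bracket_system BS}. polyhedron C \<and> convex_cone C"
  proof
    fix C assume "C \<in> bcone ` {BS. bracket_system BS}"
    then obtain BS where BS: "bracket_system BS" "C = bcone BS" by blast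
    let ?Y = "{N. tube gap_adj N \<and> N \<noteq> UNIV \<and> vec_brackets (ind N) \<subseteq> BS}"
    \<comment> \<open>The description by generators is used only for polyhedrality; the remaining
      fan axioms come from the description by brackets.\<close>
    have "polyhedron (cone_ones (ind ` ?Y))" by (intro polyhedron_cone_ones) simp
    then show "polyhedron C \<and> convex_cone C"
      using convex_cone_bcone[OF BS(1)] cone_ones_colls[OF BS(1)] BS(2) by simp
  qed
  show "\<forall>C\<in>bcone ` {BS. bracket_system BS}. \<forall>G. G face_of C \<and> G \<noteq> {} \<longrightarrow> G \<in> bcone ` {BS. bracket_system BS}"
  proof (intro ballI allI impI)
    fix C G assume "C \<in> bcone ` {BS. bracket_system BS}" "G face_of C \<and> G \<noteq> {}"
    then obtain x where "G = bcone (vec_brackets x)" using face_of_bcone by blast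
    then show "G \<in> bcone ` {BS. bracket_system BS}" using bracket_system_vec by blast
  qed
  show "\<forall>C\<in>bcone ` {BS. bracket_system BS}. \<forall>D\<in>bcone ` {BS. bracket_system BS}.
      C \<inter> D face_of C \<and> C \<inter> D face_of D"
  proof (intro ballI)
    fix C D assume "C \<in> bcone ` {BS. bracket_system BS}" "D \<in> bcone ` {BS. bracket_system BS}"
    then obtain BS BS' where "bracket_system BS" "C = bcone BS" "bracket_system BS'" "D = bcone BS'" by blast
    then show "C \<inter> D face_of C \<and> C \<inter> D face_of D"
      using bcone_face[of BS BS'] bcone_face[of BS' BS] by (simp add: Int_commute)
  qed
  show "\<forall>C\<in>bcone ` {BS. bracket_system BS}. \<exists>D\<subseteq>braid_fan. C = \<Union> D"
    using bcone_union_of_braid_cones by blast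
qed

end

theorem lemma8p5:
  fixes T :: "'v tree" and idx :: "'m::finite \<Rightarrow> nat \<times> nat"
  assumes "plane_tree T" and "tdepth T \<ge> 1" and "\<not> is_path T" and "concentrated T"
    and "bij_betw idx UNIV (coords T)"
  shows "coarsens_braid (velocity_fan T idx) \<and>
         (\<exists>BB. building_set BB \<and> triangulated_velocity_fan T idx = normal_fan (nestohedron BB))"
proof -
  interpret gap_tree T idx by unfold_locales (use assms in auto)
  show ?thesis using coarsens_braid_velocity_fan building_set_tubes triangulated_eq_normal_fan by blast
qed

end
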